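(* Let $(\mathcal{X},\mathcal{Y}_1,\mathcal{Y}_2,\mathcal{Z},P_{Y_1,Y_2,Z|X})$ be a discrete memoryless two-user broadcast channel with a warden, with $\mathcal{X}=\{0,1,\ldots,K\}$, $Q_x:=P_{Z|X}(\cdot|x)$, $\operatorname{supp}(Q_0)=\mathcal{Z}$, and the no-input symbol $0$ not redundant, i.e. $Q_0\notin\mathrm{conv}\{Q_{x'}: x'\in\mathcal{X}, x'\neq 0\}$. Let $W:=P_{Y_1|X}$ and $V:=P_{Y_2|X}$, and assume $W(\cdot|k)\ll W(\cdot|0)$ and $V(\cdot|k)\ll V(\cdot|0)$ for all $k\in\mathcal{X}\setminus\{0\}$. Let $L_1^*:=L^*(P_{Y_1,Z|X})$ and $L_2^*:=L^*(P_{Y_2,Z|X})$, and assume the following condition: if $L_1^*\ge L_2^*$ then $\max_{P_X} \frac{I(X;Y_1)}{I(X;Y_2)}\le \frac{L_1^*}{L_2^*}$, and otherwise (if $L_2^*\ge L_1^*$) $\max_{P_X}\frac{I(X;Y_2)}{I(X;Y_1)}\le \frac{L_2^*}{L_1^*}$. Assume the secret key may be arbitrarily long. Then for every $\delta>0$ the $\delta$-covert capacity region is $$\mathcal{L}_\delta=\left\{(L_1,L_2)\in\mathbb{R}_+^2:\ \frac{L_1}{L_1^*}+\frac{L_2}{L_2^*}\le 1\right\}.$$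
   Context: A discrete memoryless two-user broadcast channel (BC) with a warden consists of finite alphabets $\mathcal{X},\mathcal{Y}_1,\mathcal{Y}_2,\mathcal{Z}$ and a transition matrix $P_{Y_1,Y_2,Z|X}$, used $n$ times memorylessly; $\mathcal{Y}_1,\mathcal{Y}_2$ are the legitimate receivers and $\mathcal{Z}$ the warden. Symbol $0\in\mathcal{X}$ is the "no-input" symbol; if no communication takes place the warden observes $Z^n\sim Q_0^{\times n}$. An $(n,M_{1n},M_{2n},K_n,\varepsilon,\delta)$-code consists of independent messages $W_j$ uniform on $\{1,\ldots,M_{jn}\}$ ($j=1,2$), a secret key $S$ uniform on $\{1,\ldots,K_n\}$ independent of the messages and shared by the transmitter and both receivers, an encoder $f:\{1..M_{1n}\}\times\{1..M_{2n}\}\times\{1..K_n\}\to\mathcal{X}^n$, and decoders $\varphi_j:\mathcal{Y}_j^n\times\{1..K_n\}\to\{1..M_{jn}\}$, such that $\Pr(\cup_{j=1}^2\{\hat W_j\ne W_j\})\le\varepsilon$ and $D(\hat Q_{Z^n}\|Q_0^{\times n})\le\delta$, where $\hat Q_{Z^n}$ is the warden's output distribution induced by the code and $D$ is relative entropy. With arbitrarily large key sets allowed, $(L_1,L_2)\in\mathbb{R}_+^2$ is $(\varepsilon,\delta)$-achievable if there is a sequence of such codes with error $\varepsilon_n$ and covertness $\delta$ such that $\liminf_{n\to\infty}\frac{1}{\sqrt{n\delta}}\log M_{jn}\ge L_j$ for $j=1,2$ and $\limsup_n\varepsilon_n\le\varepsilon$. $\mathcal{L}_{\varepsilon,\delta}$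 is the closure of the set of $(\varepsilon,\delta)$-achievable pairs, and the $\delta$-covert capacity region is $\mathcal{L}_\delta:=\bigcap_{\varepsilon\in(0,1)}\mathcal{L}_{\varepsilon,\delta}$. For a point-to-point channel with a warden $P_{Y,Z|X}$ with $\mathcal{X}=\{0,\ldots,K\}$, $W':=P_{Y|X}$ and $Q_k:=P_{Z|X}(\cdot|k)$, its covert capacity is $L^*(P_{Y,Z|X}):=\max_{\mathbf p}\sqrt{\frac{2\left(\sum_{k=1}^K p_k D(W'(\cdot|k)\|W'(\cdot|0))\right)^2}{\chi_2\left(\sum_{k=1}^K p_kQ_k\,\middle\|\,Q_0\right)}}$, maximized over probability vectors $\mathbf p=(p_1,\ldots,p_K)$, where $\chi_2(Q_1\|Q_0):=\sum_z (Q_1(z)-Q_0(z))^2/Q_0(z)$. Logarithms are to an arbitrary fixed base. In the condition, the maxima are over input distributions $P_X$ on $\mathcal{X}$, with $(X,Y_1,Y_2)\sim P_X\times P_{Y_1,Y_2|X}$.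
   Formalization: Logarithms are natural (in base b the covert rate scales as 1/√(ln b) but L* as 1/ln b, so the formula fails for b≠e); K≥1; L/0 is read as +∞ for L>0 and as 0 for L=0; the ratio condition on mutual informations is cross-multiplied. *)

theory Defs
  imports "HOL-Analysis.Analysis"
begin

text \<open>Conventions. The input alphabet is {0..K} (natural numbers), the output alphabets
  are finite types. A broadcast channel with a warden is a function
  P x y1 y2 z = P_{Y1,Y2,Z|X}(y1,y2,z|x). All logarithms are natural logarithms.\<close>

definition bc_channel :: "nat \<Rightarrow> (nat \<Rightarrow> 'y1::finite \<Rightarrow> 'y2::finite \<Rightarrow> 'z::finite \<Rightarrow> real) \<Rightarrow> bool" where
  "bc_channel K P \<longleftrightarrow> (\<forall>x\<le>K. (\<forall>y1 y2 z. P x y1 y2 z \<ge> 0) \<and>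
      (\<Sum>y1\<in>UNIV. \<Sum>y2\<in>UNIV. \<Sum>z\<in>UNIV. P x y1 y2 z) = 1)"

definition chanW :: "(nat \<Rightarrow> 'y1::finite \<Rightarrow> 'y2::finite \<Rightarrow> 'z::finite \<Rightarrow> real) \<Rightarrow> nat \<Rightarrow> 'y1 \<Rightarrow> real" where
  "chanW P x y1 = (\<Sum>y2\<in>UNIV. \<Sum>z\<in>UNIV. P x y1 y2 z)"

definition chanV :: "(nat \<Rightarrow> 'y1::finite \<Rightarrow> 'y2::finite \<Rightarrow> 'z::finite \<Rightarrow> real) \<Rightarrow> nat \<Rightarrow> 'y2 \<Rightarrow> real" where
  "chanV P x y2 = (\<Sum>y1\<in>UNIV. \<Sum>z\<in>UNIV. P x y1 y2 z)"

definition chanQ :: "(nat \<Rightarrow> 'y1::finite \<Rightarrow> 'y2::finite \<Rightarrow> 'z::finite \<Rightarrow> real) \<Rightarrow> nat \<Rightarrow> 'z \<Rightarrow> real" where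
  "chanQ P x z = (\<Sum>y1\<in>UNIV. \<Sum>y2\<in>UNIV. P x y1 y2 z)"

definition relent :: "('a \<Rightarrow> real) \<Rightarrow> ('a \<Rightarrow> real) \<Rightarrow> 'a set \<Rightarrow> real" where
  "relent f g A = (\<Sum>a\<in>A. if f a = 0 then 0 else f a * ln (f a / g a))"

definition chi2 :: "('z::finite \<Rightarrow> real) \<Rightarrow> ('z \<Rightarrow> real) \<Rightarrow> real" where
  "chi2 Q1 Q0 = (\<Sum>z\<in>UNIV. (Q1 z - Q0 z)^2 / Q0 z)"

definition abs_cont :: "('a \<Rightarrow> real) \<Rightarrow> ('a \<Rightarrow> real) \<Rightarrow> bool" where
  "abs_cont f g \<longleftrightarrow> (\<forall>a. g a = 0 \<longrightarrow> f a = 0)"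

text \<open>Probability vectors (p_1,...,p_K) (values outside {1..K} irrelevant).\<close>
definition prob_vecs :: "nat \<Rightarrow> (nat \<Rightarrow> real) set" where
  "prob_vecs K = {p. (\<forall>k\<in>{1..K}. 0 \<le> p k) \<and> (\<Sum>k=1..K. p k) = 1}"

text \<open>Covert capacity L^*(P_{Y,Z|X}) of a point-to-point channel with warden,
  given by its main channel W' and warden channel Q (the maximum written as a supremum).\<close>
definition covert_cap :: "nat \<Rightarrow> (nat \<Rightarrow> 'y::finite \<Rightarrow> real) \<Rightarrow> (nat \<Rightarrow> 'z::finite \<Rightarrow> real) \<Rightarrow> real" where
  "covert_cap K W' Q = Sup ((\<lambda>p. sqrt (2 * (\<Sum>k=1..K. p k * relent (W' k) (W' 0) UNIV)^2 /
        chi2 (\<lambda>z. \<Sum>k=1..K. p k * Q k z) (Q 0))) ` prob_vecs K)"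

definition input_dists :: "nat \<Rightarrow> (nat \<Rightarrow> real) set" where
  "input_dists K = {p. (\<forall>x\<in>{0..K}. 0 \<le> p x) \<and> (\<Sum>x=0..K. p x) = 1}"

definition mutual_info :: "nat \<Rightarrow> (nat \<Rightarrow> real) \<Rightarrow> (nat \<Rightarrow> 'y::finite \<Rightarrow> real) \<Rightarrow> real" where
  "mutual_info K p W' = (\<Sum>x=0..K. \<Sum>y\<in>UNIV.
      (if p x * W' x y = 0 then 0
       else p x * W' x y * ln (W' x y / (\<Sum>x'=0..K. p x' * W' x' y))))"

text \<open>Codes. Messages in {1..M1}, {1..M2}, key in {1..Kn}; codewords are lists of
  length n over {0..K}; decoders map an output sequence (list of length n) and a key
  to a message.\<close>
definition is_code :: "nat \<Rightarrow> nat \<Rightarrow> nat \<Rightarrow> nat \<Rightarrow> nat \<Rightarrow>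
    (nat \<Rightarrow> nat \<Rightarrow> nat \<Rightarrow> nat list) \<Rightarrow> ('y1 list \<Rightarrow> nat \<Rightarrow> nat) \<Rightarrow> ('y2 list \<Rightarrow> nat \<Rightarrow> nat) \<Rightarrow> bool" where
  "is_code K n M1 M2 Kn enc dec1 dec2 \<longleftrightarrow> M1 \<ge> 1 \<and> M2 \<ge> 1 \<and> Kn \<ge> 1 \<and>
     (\<forall>w1\<in>{1..M1}. \<forall>w2\<in>{1..M2}. \<forall>s\<in>{1..Kn}.
        length (enc w1 w2 s) = n \<and> set (enc w1 w2 s) \<subseteq> {0..K}) \<and>
     (\<forall>ys s. length ys = n \<and> s \<in> {1..Kn} \<longrightarrow> dec1 ys s \<in> {1..M1}) \<and>
     (\<forall>ys s. length ys = n \<and> s \<in> {1..Kn} \<longrightarrow> dec2 ys s \<in> {1..M2})"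

definition code_error :: "(nat \<Rightarrow> 'y1::finite \<Rightarrow> 'y2::finite \<Rightarrow> 'z::finite \<Rightarrow> real) \<Rightarrow> nat \<Rightarrow> nat \<Rightarrow> nat \<Rightarrow> nat \<Rightarrow>
    (nat \<Rightarrow> nat \<Rightarrow> nat \<Rightarrow> nat list) \<Rightarrow> ('y1 list \<Rightarrow> nat \<Rightarrow> nat) \<Rightarrow> ('y2 list \<Rightarrow> nat \<Rightarrow> nat) \<Rightarrow> real" where
  "code_error P n M1 M2 Kn enc dec1 dec2 =
     (\<Sum>w1=1..M1. \<Sum>w2=1..M2. \<Sum>s=1..Kn.
        \<Sum>y1s\<in>{ys. length ys = n}. \<Sum>y2s\<in>{ys. length ys = n}. \<Sum>zs\<in>{ys. length ys = n}.
          (\<Prod>i<n. P (enc w1 w2 s ! i) (y1s ! i) (y2s ! i) (zs ! i)) *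
          (if dec1 y1s s \<noteq> w1 \<or> dec2 y2s s \<noteq> w2 then 1 else 0)) / (real M1 * real M2 * real Kn)"

definition warden_dist :: "(nat \<Rightarrow> 'y1::finite \<Rightarrow> 'y2::finite \<Rightarrow> 'z::finite \<Rightarrow> real) \<Rightarrow> nat \<Rightarrow> nat \<Rightarrow> nat \<Rightarrow> nat \<Rightarrow>
    (nat \<Rightarrow> nat \<Rightarrow> nat \<Rightarrow> nat list) \<Rightarrow> 'z list \<Rightarrow> real" where
  "warden_dist P n M1 M2 Kn enc zs =
     (\<Sum>w1=1..M1. \<Sum>w2=1..M2. \<Sum>s=1..Kn. \<Prod>i<n. chanQ P (enc w1 w2 s ! i) (zs ! i))
       / (real M1 * real M2 * real Kn)"

definition no_input_dist :: "(nat \<Rightarrow> 'y1::finite \<Rightarrow> 'y2::finite \<Rightarrow> 'z::finite \<Rightarrow> real) \<Rightarrow> nat \<Rightarrow> 'z list \<Rightarrow> real" where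
  "no_input_dist P n zs = (\<Prod>i<n. chanQ P 0 (zs ! i))"

definition covertness :: "(nat \<Rightarrow> 'y1::finite \<Rightarrow> 'y2::finite \<Rightarrow> 'z::finite \<Rightarrow> real) \<Rightarrow> nat \<Rightarrow> nat \<Rightarrow> nat \<Rightarrow> nat \<Rightarrow>
    (nat \<Rightarrow> nat \<Rightarrow> nat \<Rightarrow> nat list) \<Rightarrow> real" where
  "covertness P n M1 M2 Kn enc =
     relent (warden_dist P n M1 M2 Kn enc) (no_input_dist P n) {zs. length zs = n}"

definition achievable :: "nat \<Rightarrow> (nat \<Rightarrow> 'y1::finite \<Rightarrow> 'y2::finite \<Rightarrow> 'z::finite \<Rightarrow> real) \<Rightarrow> real \<Rightarrow> real \<Rightarrow> real \<times> real \<Rightarrow> bool" where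
  "achievable K P \<epsilon> \<delta> L \<longleftrightarrow> fst L \<ge> 0 \<and> snd L \<ge> 0 \<and>
     (\<exists>(M1::nat \<Rightarrow> nat) (M2::nat \<Rightarrow> nat) (Kn::nat \<Rightarrow> nat)
        (enc::nat \<Rightarrow> nat \<Rightarrow> nat \<Rightarrow> nat \<Rightarrow> nat list)
        (dec1::nat \<Rightarrow> 'y1 list \<Rightarrow> nat \<Rightarrow> nat) (dec2::nat \<Rightarrow> 'y2 list \<Rightarrow> nat \<Rightarrow> nat).
        (\<forall>n. is_code K n (M1 n) (M2 n) (Kn n) (enc n) (dec1 n) (dec2 n) \<and>
             covertness P n (M1 n) (M2 n) (Kn n) (enc n) \<le> \<delta>) \<and>
        Liminf sequentially (\<lambda>n. ereal (ln (real (M1 n)) / sqrt (real n * \<delta>))) \<ge> ereal (fst L) \<and>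
        Liminf sequentially (\<lambda>n. ereal (ln (real (M2 n)) / sqrt (real n * \<delta>))) \<ge> ereal (snd L) \<and>
        Limsup sequentially (\<lambda>n. ereal (code_error P n (M1 n) (M2 n) (Kn n) (enc n) (dec1 n) (dec2 n)))
          \<le> ereal \<epsilon>)"

definition region_eps :: "nat \<Rightarrow> (nat \<Rightarrow> 'y1::finite \<Rightarrow> 'y2::finite \<Rightarrow> 'z::finite \<Rightarrow> real) \<Rightarrow> real \<Rightarrow> real \<Rightarrow> (real \<times> real) set" where
  "region_eps K P \<epsilon> \<delta> = closure {L. achievable K P \<epsilon> \<delta> L}"

definition covert_region :: "nat \<Rightarrow> (nat \<Rightarrow> 'y1::finite \<Rightarrow> 'y2::finite \<Rightarrow> 'z::finite \<Rightarrow> real) \<Rightarrow> real \<Rightarrow> (real \<times> real) set" where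
  "covert_region K P \<delta> = (\<Inter>\<epsilon>\<in>{0<..<1}. region_eps K P \<epsilon> \<delta>)"

text \<open>The set {L in R_+^2 : L1/L1* + L2/L2* <= 1}, with L/0 read as +infinity for L > 0
  and as 0 for L = 0.\<close>
definition ratio_term :: "real \<Rightarrow> real \<Rightarrow> ereal" where
  "ratio_term L Ls = (if Ls = 0 then (if L = 0 then 0 else \<infinity>) else ereal (L / Ls))"

end

theory Submission
  imports Defs "HOL-Library.NList" "HOL-Real_Asymp.Real_Asymp"
begin

text \<open>
  Converse. Suppose $L_2^* \le L_1^*$ and put $c = L_2^*/L_1^* \le 1$. The hypothesis
  $c\, I(X;Y_1) \le I(X;Y_2)$ tensorizes (this is where $c \le 1$ is needed), so Fano's inequality for both
  users and the chain rule give
  $c \log M_1 + \log M_2 \lesssim I(X^n;Y_2^n|S) \le n \sum_k \bar p_k D(V_k\|V_0)$, where $\bar p$ is the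
  average input distribution over positions. The warden's divergence is at least $n D(\bar Q\|Q_0)$, which is
  $n \chi_2(\bar Q\|Q_0)/2$ to first order, and the definition of $L_2^*$ turns this into the bound
  $L_2^* \sqrt{n\delta}$. A weak converse suffices because the region is intersected over all error levels.

  Achievability. Since the key is unlimited, it may select the whole random codebook. The warden then sees
  an exact product distribution and the error is exactly the ensemble average, so no resolvability argument is
  needed. The two users share time: a fraction $\theta$ of the block serves user 1, the rest user 2.
\<close>

section \<open>Averages and words over finite alphabets\<close>

definition avg :: "'a set \<Rightarrow> ('a \<Rightarrow> real) \<Rightarrow> real" where
  "avg A f = (\<Sum>a\<in>A. f a) / card A"

lemma avg_cong: "(\<And>a. a \<in> A \<Longrightarrow> f a = g a) \<Longrightarrow> avg A f = avg A g"
  by (simp add: avg_def)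

lemma avg_const: "finite A \<Longrightarrow> A \<noteq> {} \<Longrightarrow> avg A (\<lambda>_. c) = c"
  by (simp add: avg_def)

lemma avg_mono: "(\<And>a. a \<in> A \<Longrightarrow> f a \<le> g a) \<Longrightarrow> avg A f \<le> avg A g"
  unfolding avg_def by (intro divide_right_mono sum_mono) auto

lemma avg_le: "finite A \<Longrightarrow> A \<noteq> {} \<Longrightarrow> (\<And>a. a \<in> A \<Longrightarrow> f a \<le> c) \<Longrightarrow> avg A f \<le> c"
  using avg_mono[of A f "\<lambda>_. c"] by (simp add: avg_const)

lemma avg_nonneg: "(\<And>a. a \<in> A \<Longrightarrow> 0 \<le> f a) \<Longrightarrow> 0 \<le> avg A f"
  unfolding avg_def by (intro divide_nonneg_nonneg sum_nonneg) auto

lemma avg_add: "avg A (\<lambda>a. f a + g a) = avg A f + avg A g"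
  by (simp add: avg_def sum.distrib add_divide_distrib)

lemma avg_diff: "avg A (\<lambda>a. f a - g a) = avg A f - avg A g"
  by (simp add: avg_def sum_subtractf diff_divide_distrib)

lemma avg_mult_left: "avg A (\<lambda>a. c * f a) = c * avg A f"
  by (simp add: avg_def flip: sum_distrib_left)

lemma avg_mult_right: "avg A (\<lambda>a. f a * c) = avg A f * c"
  by (simp add: avg_def flip: sum_distrib_right)

lemma avg_sum: "avg A (\<lambda>a. \<Sum>b\<in>B. f a b) = (\<Sum>b\<in>B. avg A (\<lambda>a. f a b))"
  unfolding avg_def by (subst sum.swap) (simp add: sum_divide_distrib)

lemma avg_Times: "avg (A \<times> B) f = avg A (\<lambda>a. avg B (\<lambda>b. f (a, b)))"
  by (simp add: avg_def sum.cartesian_product' card_cartesian_product mult.commute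
      flip: sum_divide_distrib)

lemma avg_swap: "avg A (\<lambda>a. avg B (f a)) = avg B (\<lambda>b. avg A (\<lambda>a. f a b))"
  unfolding avg_def sum_divide_distrib[symmetric] divide_divide_eq_left
  by (subst sum.swap) (simp add: mult.commute)

lemma avg_reindex_bij_betw: "bij_betw h A B \<Longrightarrow> avg A (\<lambda>a. f (h a)) = avg B f"
  unfolding avg_def by (simp add: bij_betw_same_card sum.reindex_bij_betw)

lemma avg_PiE_prod:
  assumes "finite I" "finite A"
  shows "avg (I \<rightarrow>\<^sub>E A) (\<lambda>\<kappa>. \<Prod>i\<in>I. f i (\<kappa> i)) = (\<Prod>i\<in>I. avg A (f i))"
  using assms by (simp add: avg_def prod_dividef card_PiE prod_sum_PiE)

lemma avg_PiE_component:
  assumes "finite I" "i \<in> I" "finite A" "A \<noteq> {}"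
  shows "avg (I \<rightarrow>\<^sub>E A) (\<lambda>\<kappa>. f (\<kappa> i)) = avg A f"
proof -
  let ?F = "\<lambda>j a. if j = i then f a else 1"
  have "avg (I \<rightarrow>\<^sub>E A) (\<lambda>\<kappa>. \<Prod>j\<in>I. ?F j (\<kappa> j)) = (\<Prod>j\<in>I. avg A (?F j))"
    using assms by (intro avg_PiE_prod)
  also have "\<dots> = (\<Prod>j\<in>I. if j = i then avg A f else 1)"
    using assms by (intro prod.cong refl) (auto simp: avg_const)
  finally show ?thesis using assms by simp
qed

lemma avg_PiE_two_components:
  assumes "finite I" "i \<in> I" "j \<in> I" "i \<noteq> j" "finite A" "A \<noteq> {}"
  shows "avg (I \<rightarrow>\<^sub>E A) (\<lambda>\<kappa>. f (\<kappa> i) * g (\<kappa> j)) = avg A f * avg A g"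
proof -
  let ?F = "\<lambda>k a. (if k = i then f a else 1) * (if k = j then g a else 1)"
  have "avg (I \<rightarrow>\<^sub>E A) (\<lambda>\<kappa>. \<Prod>k\<in>I. ?F k (\<kappa> k)) = (\<Prod>k\<in>I. avg A (?F k))"
    using assms by (intro avg_PiE_prod)
  also have "\<dots> = (\<Prod>k\<in>I. (if k = i then avg A f else 1) * (if k = j then avg A g else 1))"
    using assms by (intro prod.cong refl) (auto simp: avg_const)
  finally show ?thesis using assms by (simp add: prod.distrib)
qed

definition freq :: "'t set \<Rightarrow> ('t \<Rightarrow> 'a) \<Rightarrow> 'a \<Rightarrow> real" where
  "freq T g k = avg T (\<lambda>t. of_bool (g t = k))"

lemma avg_eq_sum_freq:
  assumes "finite X" "g ` T \<subseteq> X"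
  shows "avg T (\<lambda>t. f (g t)) = (\<Sum>k\<in>X. freq T g k * f k)"
proof -
  have "(\<Sum>k\<in>X. of_bool (g t = k) * f k) = f (g t)" if "t \<in> T" for t
    using assms that by (subst sum.remove[of X "g t"]) auto
  then have "avg T (\<lambda>t. f (g t)) = avg T (\<lambda>t. \<Sum>k\<in>X. of_bool (g t = k) * f k)"
    by (intro avg_cong) simp
  then show ?thesis by (simp only: avg_sum avg_mult_right freq_def)
qed

lemma freq_pos:
  assumes "finite T" "t \<in> T"
  shows "0 < freq T g (g t)"
proof -
  have "0 < (\<Sum>s\<in>T. of_bool (g s = g t) :: real)"
    using assms by (intro sum_pos2[of _ t]) auto
  moreover have "0 < card T"
    using assms card_gt_0_iff by blast
  ultimately show ?thesis
    by (simp add: freq_def avg_def)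
qed

lemma freq_Sigma_fst:
  assumes "finite X" "\<And>j. j \<in> X \<Longrightarrow> finite (A j)" "k \<in> X"
  shows "freq (Sigma X A) fst k = card (A k) / (\<Sum>j\<in>X. card (A j))"
proof -
  have "(\<Sum>t\<in>Sigma X A. of_bool (fst t = k) :: real) = (\<Sum>j\<in>X. \<Sum>i\<in>A j. of_bool (j = k))"
    using assms by (subst sum.Sigma) (auto simp: case_prod_unfold)
  also have "\<dots> = card (A k)"
    using assms by (subst sum.remove[of X k]) auto
  finally show ?thesis
    using assms by (simp add: freq_def avg_def)
qed

lemma finite_nlists [simp]: "finite A \<Longrightarrow> finite (nlists n A)"
  unfolding nlists_def using finite_lists_length_eq[of A n] by (simp add: conj_commute)

lemma card_nlists: "finite A \<Longrightarrow> card (nlists n A) = card A ^ n"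
  unfolding nlists_def using card_lists_length_eq[of A n] by (simp add: conj_commute)

lemma bij_betw_Cons_nlists: "bij_betw (\<lambda>(x, xs). x # xs) (A \<times> nlists n A) (nlists (Suc n) A)"
  by (rule bij_betwI[where g = "\<lambda>xs. (hd xs, tl xs)"]) (auto simp: in_nlists_Suc_iff)

lemma bij_betw_append_nlists: "bij_betw (\<lambda>(u, v). u @ v) (nlists m A \<times> nlists k A) (nlists (m + k) A)"
  by (rule bij_betwI[where g = "\<lambda>xs. (take m xs, drop m xs)"])
     (unfold nlists_def, auto dest: in_set_takeD in_set_dropD)

lemma sum_nlists_Suc:
  fixes f :: "'a list \<Rightarrow> 'b::comm_monoid_add"
  shows "(\<Sum>xs\<in>nlists (Suc n) A. f xs) = (\<Sum>x\<in>A. \<Sum>xs\<in>nlists n A. f (x # xs))"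
  by (subst sum.reindex_bij_betw[OF bij_betw_Cons_nlists, symmetric])
     (simp add: sum.cartesian_product' case_prod_unfold)

lemma sum_nlists_append:
  fixes f :: "'a list \<Rightarrow> 'b::comm_monoid_add"
  shows "(\<Sum>xs\<in>nlists (m + k) A. f xs) = (\<Sum>u\<in>nlists m A. \<Sum>v\<in>nlists k A. f (u @ v))"
  by (subst sum.reindex_bij_betw[OF bij_betw_append_nlists, symmetric])
     (simp add: sum.cartesian_product' case_prod_unfold)

section \<open>Product distributions and memoryless channels\<close>

definition prob_dist :: "'a set \<Rightarrow> ('a \<Rightarrow> real) \<Rightarrow> bool" where
  "prob_dist A q \<longleftrightarrow> (\<forall>a\<in>A. 0 \<le> q a) \<and> sum q A = 1"

definition stochastic :: "'a set \<Rightarrow> 'b set \<Rightarrow> ('a \<Rightarrow> 'b \<Rightarrow> real) \<Rightarrow> bool" where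
  "stochastic X Y W \<longleftrightarrow> (\<forall>x\<in>X. prob_dist Y (W x))"

definition mixture :: "'a set \<Rightarrow> ('a \<Rightarrow> real) \<Rightarrow> ('a \<Rightarrow> 'b \<Rightarrow> real) \<Rightarrow> 'b \<Rightarrow> real" where
  "mixture X p W y = (\<Sum>x\<in>X. p x * W x y)"

definition product_dist :: "nat \<Rightarrow> (nat \<Rightarrow> 'a \<Rightarrow> real) \<Rightarrow> 'a list \<Rightarrow> real" where
  "product_dist n f ys = (\<Prod>i<n. f i (ys ! i))"

definition memoryless :: "('a \<Rightarrow> 'b \<Rightarrow> real) \<Rightarrow> 'a list \<Rightarrow> 'b list \<Rightarrow> real" where
  "memoryless W xs = product_dist (length xs) (\<lambda>i. W (xs ! i))"

lemma prob_dist_nonneg: "prob_dist A q \<Longrightarrow> a \<in> A \<Longrightarrow> 0 \<le> q a"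
  by (simp add: prob_dist_def)

lemma prob_dist_sum: "prob_dist A q \<Longrightarrow> sum q A = 1"
  by (simp add: prob_dist_def)

lemma prob_dist_le_1: "prob_dist A q \<Longrightarrow> finite A \<Longrightarrow> a \<in> A \<Longrightarrow> q a \<le> 1"
  using member_le_sum[of a A q] by (auto simp: prob_dist_def)

lemma stochastic_nonneg: "stochastic X Y W \<Longrightarrow> x \<in> X \<Longrightarrow> y \<in> Y \<Longrightarrow> 0 \<le> W x y"
  by (simp add: stochastic_def prob_dist_def)

lemma stochastic_sum: "stochastic X Y W \<Longrightarrow> x \<in> X \<Longrightarrow> (\<Sum>y\<in>Y. W x y) = 1"
  by (simp add: stochastic_def prob_dist_def)

lemma sum_mixture: "(\<Sum>y\<in>Y. mixture X p W y * f y) = (\<Sum>x\<in>X. p x * (\<Sum>y\<in>Y. W x y * f y))"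
  unfolding mixture_def sum_distrib_left sum_distrib_right by (subst sum.swap) (simp add: mult.assoc)

lemma prob_dist_mixture:
  assumes "stochastic X Y W" "prob_dist X p"
  shows "prob_dist Y (mixture X p W)"
proof -
  have "sum (mixture X p W) Y = 1"
    using sum_mixture[of X p W "\<lambda>_. 1" Y] assms by (simp add: stochastic_sum prob_dist_sum)
  then show ?thesis
    using assms unfolding prob_dist_def stochastic_def mixture_def by (auto intro!: sum_nonneg)
qed

lemma abs_cont_mixture: "(\<And>x. x \<in> X \<Longrightarrow> abs_cont (W x) q) \<Longrightarrow> abs_cont (mixture X p W) q"
  by (auto simp: abs_cont_def mixture_def intro!: sum.neutral)

lemma prob_dist_avg:
  assumes "stochastic X Y W" "finite X" "X \<noteq> {}"
  shows "prob_dist Y (\<lambda>y. avg X (\<lambda>x. W x y))"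
  using assms unfolding prob_dist_def
  by (auto simp: stochastic_nonneg stochastic_sum avg_const simp flip: avg_sum intro!: avg_nonneg
      cong: avg_cong)

lemma prob_dist_freq:
  assumes "finite X" "g ` T \<subseteq> X" "finite T" "T \<noteq> {}"
  shows "prob_dist X (freq T g)"
  using avg_eq_sum_freq[OF assms(1,2), of "\<lambda>_. 1"] assms(3,4)
  by (auto simp: prob_dist_def avg_const freq_def intro!: avg_nonneg)

lemma sum_nlists_product_dist: "(\<Sum>ys\<in>nlists n A. product_dist n f ys) = (\<Prod>i<n. \<Sum>y\<in>A. f i y)"
proof (induction n arbitrary: f)
  case 0
  then show ?case by (simp add: product_dist_def)
next
  case (Suc n)
  have "product_dist (Suc n) f (y # ys) = f 0 y * product_dist n (\<lambda>i. f (Suc i)) ys" for y ys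
    unfolding product_dist_def prod.lessThan_Suc_shift by simp
  then show ?case
    by (simp add: sum_nlists_Suc Suc.IH prod.lessThan_Suc_shift sum_product
        flip: sum_distrib_left sum_distrib_right del: prod.lessThan_Suc)
qed

lemma avg_nlists_product_dist: "finite A \<Longrightarrow> avg (nlists n A) (product_dist n f) = (\<Prod>i<n. avg A (f i))"
  by (simp add: avg_def sum_nlists_product_dist card_nlists prod_dividef)

lemma product_dist_eq_0_iff: "product_dist n f ys = 0 \<longleftrightarrow> (\<exists>i<n. f i (ys ! i) = 0)"
  by (auto simp: product_dist_def)

lemma product_dist_divide: "product_dist n f ys / product_dist n g ys
    = product_dist n (\<lambda>i y. f i y / g i y) ys"
  by (simp add: product_dist_def prod_dividef)

lemma product_dist_mult: "product_dist n f ys * product_dist n g ys = product_dist n (\<lambda>i y. f i y * g i y) ys"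
  by (simp add: product_dist_def prod.distrib)

lemma prob_dist_product_dist:
  assumes "\<And>i. i < n \<Longrightarrow> prob_dist A (f i)"
  shows "prob_dist (nlists n A) (product_dist n f)"
  unfolding prob_dist_def sum_nlists_product_dist unfolding product_dist_def
  using assms by (auto simp: prob_dist_sum intro!: prod_nonneg prob_dist_nonneg[OF assms] nlistsE_nth_in)

lemma abs_cont_product_dist:
  assumes "\<And>i. i < n \<Longrightarrow> abs_cont (f i) (g i)"
  shows "abs_cont (product_dist n f) (product_dist n g)"
  using assms unfolding abs_cont_def product_dist_eq_0_iff by blast

lemma sum_nlists_product_dist_additive:
  assumes f_sum_1: "\<And>i. i < n \<Longrightarrow> (\<Sum>y\<in>A. f i y) = 1"
  shows "(\<Sum>ys\<in>nlists n A. product_dist n f ys * (\<Sum>i<n. g i (ys ! i))) = (\<Sum>i<n. \<Sum>y\<in>A. f i y * g i y)"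
proof -
  have "(\<Sum>ys\<in>nlists n A. product_dist n f ys * g i (ys ! i)) = (\<Sum>y\<in>A. f i y * g i y)" if i_less: "i < n" for i
  proof -
    let ?h = "\<lambda>j y. f j y * (if j = i then g i y else 1)"
    have "product_dist n f ys * g i (ys ! i) = product_dist n ?h ys" for ys
      using i_less by (simp add: product_dist_def prod.distrib)
    then have "(\<Sum>ys\<in>nlists n A. product_dist n f ys * g i (ys ! i)) = (\<Prod>j<n. \<Sum>y\<in>A. ?h j y)"
      by (simp only: sum_nlists_product_dist)
    also have "\<dots> = (\<Prod>j<n. if j = i then \<Sum>y\<in>A. f i y * g i y else 1)"
      using f_sum_1 by (intro prod.cong) auto
    finally show ?thesis using i_less by simp
  qed
  then show ?thesis unfolding sum_distrib_left by (subst sum.swap) simp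
qed

lemma sum_nlists_product_dist_ln:
  assumes f_sum_1: "\<And>i. i < n \<Longrightarrow> (\<Sum>y\<in>A. f i y) = 1" and abs_cont: "\<And>i. i < n \<Longrightarrow> abs_cont (f i) (g i)"
  shows "(\<Sum>ys\<in>nlists n A. product_dist n f ys * ln (product_dist n g ys)) = (\<Sum>i<n. \<Sum>y\<in>A. f i y * ln (g i y))"
proof -
  have "product_dist n f ys * ln (product_dist n g ys)
      = product_dist n f ys * (\<Sum>i<n. ln (g i (ys ! i)))" for ys
  proof (cases "product_dist n f ys = 0")
    case False
    then have "g i (ys ! i) \<noteq> 0" if "i < n" for i
      using abs_cont[OF that] that unfolding abs_cont_def product_dist_eq_0_iff by blast
    then have "ln (product_dist n g ys) = (\<Sum>i<n. ln (g i (ys ! i)))"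
      unfolding product_dist_def by (intro ln_prod) auto
    then show ?thesis by simp
  qed simp
  then show ?thesis
    using sum_nlists_product_dist_additive[of n f A "\<lambda>i y. ln (g i y)", OF f_sum_1] by (simp only:)
qed

lemma stochastic_memoryless: "stochastic X Y W \<Longrightarrow> stochastic (nlists n X) (nlists n Y) (memoryless W)"
  unfolding stochastic_def memoryless_def by (simp add: prob_dist_product_dist nlistsE_nth_in)

lemma memoryless_Cons: "memoryless W (x # xs) (y # ys) = W x y * memoryless W xs ys"
  unfolding memoryless_def product_dist_def by (simp add: prod.lessThan_Suc_shift del: prod.lessThan_Suc)

lemma memoryless_append:
  "length us = length xs \<Longrightarrow> memoryless W (xs @ xs') (us @ vs) = memoryless W xs us * memoryless W xs' vs"
  by (induction us xs rule: list_induct2) (simp_all add: memoryless_Cons, simp add: memoryless_def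
      product_dist_def)

lemma memoryless_map: "memoryless W (map g xs) = memoryless (\<lambda>x. W (g x)) xs"
  by (auto simp: memoryless_def product_dist_def)

lemma input_dists_iff: "p \<in> input_dists K \<longleftrightarrow> prob_dist {0..K} p"
  by (simp add: input_dists_def prob_dist_def)

section \<open>Relative entropy and mutual information\<close>

definition xlnx :: "real \<Rightarrow> real" where
  "xlnx t = t * ln t"

definition negentropy :: "'a set \<Rightarrow> ('a \<Rightarrow> real) \<Rightarrow> real" where
  "negentropy A f = (\<Sum>a\<in>A. xlnx (f a))"

lemma xlnx_mult: "xlnx (s * t) = s * xlnx t + t * xlnx s"
  by (simp add: xlnx_def ln_mult algebra_simps)

lemma negentropy_cmult: "negentropy A (\<lambda>a. t * f a) = t * negentropy A f + sum f A * xlnx t"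
  by (simp add: negentropy_def xlnx_mult sum.distrib sum_distrib_left sum_distrib_right)

lemma relent_eq_sum: "relent f g A = (\<Sum>a\<in>A. f a * ln (f a / g a))"
  unfolding relent_def by (intro sum.cong) auto

lemma relent_eq_negentropy:
  assumes "\<And>a. a \<in> A \<Longrightarrow> g a = 0 \<Longrightarrow> f a = 0"
  shows "relent f g A = negentropy A f - (\<Sum>a\<in>A. f a * ln (g a))"
  unfolding relent_eq_sum negentropy_def xlnx_def sum_subtractf[symmetric]
  using assms by (intro sum.cong refl) (auto simp: ln_div algebra_simps)

lemma relent_cong: "(\<And>a. a \<in> A \<Longrightarrow> f a = f' a) \<Longrightarrow> relent f g A = relent f' g A"
  unfolding relent_def by (intro sum.cong) auto

lemma relent_self: "relent f f A = 0"
  by (auto simp: relent_def intro!: sum.neutral)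

lemma relent_ge_diff:
  assumes "\<And>a. a \<in> A \<Longrightarrow> 0 \<le> f a" "\<And>a. a \<in> A \<Longrightarrow> 0 \<le> g a"
    and "\<And>a. a \<in> A \<Longrightarrow> g a = 0 \<Longrightarrow> f a = 0"
  shows "sum f A - sum g A \<le> relent f g A"
  unfolding relent_eq_sum sum_subtractf[symmetric]
proof (intro sum_mono)
  fix a assume a_in_A: "a \<in> A"
  show "f a - g a \<le> f a * ln (f a / g a)"
  proof (cases "f a = 0")
    case False
    then have pos: "0 < f a" "0 < g a" using assms[OF a_in_A] by (auto simp: less_le)
    then have "f a * ln (g a / f a) \<le> f a * (g a / f a - 1)"
      by (intro mult_left_mono ln_le_minus_one) auto
    then show ?thesis using pos by (simp add: ln_div algebra_simps)
  qed (use assms(2)[OF a_in_A] in simp)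
qed

lemma relent_nonneg:
  assumes "prob_dist A f" "prob_dist A g" "abs_cont f g"
  shows "0 \<le> relent f g A"
  using relent_ge_diff[of A f g] assms by (auto simp: prob_dist_def abs_cont_def)

lemma relent_product_dist:
  assumes "\<And>i. i < n \<Longrightarrow> (\<Sum>y\<in>A. f i y) = 1" "\<And>i. i < n \<Longrightarrow> abs_cont (f i) (g i)"
  shows "relent (product_dist n f) (product_dist n g) (nlists n A) = (\<Sum>i<n. relent (f i) (g i) A)"
proof -
  have "abs_cont (f i) (\<lambda>y. f i y / g i y)" if "i < n" for i
    using assms(2)[OF that] by (auto simp: abs_cont_def)
  then show ?thesis
    unfolding relent_eq_sum product_dist_divide by (intro sum_nlists_product_dist_ln assms)
qed

text \<open>Homogeneous of degree 1 in \<open>J\<close>: since \<open>J\<close> need not be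
  normalised, conditional mutual informations are plain sums, and the chain rule is an identity.\<close>

definition joint_info :: "'a set \<Rightarrow> 'b set \<Rightarrow> ('a \<Rightarrow> 'b \<Rightarrow> real) \<Rightarrow> real" where
  "joint_info X Y J = xlnx (\<Sum>x\<in>X. \<Sum>y\<in>Y. J x y) + (\<Sum>x\<in>X. negentropy Y (J x))
     - negentropy X (\<lambda>x. \<Sum>y\<in>Y. J x y) - negentropy Y (\<lambda>y. \<Sum>x\<in>X. J x y)"

lemma joint_info_commute: "joint_info X Y J = joint_info Y X (\<lambda>y x. J x y)"
  unfolding joint_info_def
  using sum.swap[of J Y X] sum.swap[of "\<lambda>x y. xlnx (J x y)" Y X] by (simp add: negentropy_def)

lemma joint_info_cong:
  "(\<And>x y. x \<in> X \<Longrightarrow> y \<in> Y \<Longrightarrow> J x y = J' x y) \<Longrightarrow> joint_info X Y J = joint_info X Y J'"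
  by (simp add: joint_info_def negentropy_def)

lemma joint_info_cmult: "joint_info X Y (\<lambda>x y. t * J x y) = t * joint_info X Y J"
proof -
  have "(\<Sum>y\<in>Y. \<Sum>x\<in>X. J x y) = (\<Sum>x\<in>X. \<Sum>y\<in>Y. J x y)"
    by (rule sum.swap)
  then show ?thesis
    unfolding joint_info_def
    by (simp add: negentropy_cmult xlnx_mult sum.distrib algebra_simps
        flip: sum_distrib_left sum_distrib_right)
qed

lemma joint_info_reindex_bij_betw:
  assumes "bij_betw f X X'" "bij_betw g Y Y'"
  shows "joint_info X Y (\<lambda>x y. J (f x) (g y)) = joint_info X' Y' J"
  unfolding joint_info_def negentropy_def
  by (simp add: sum.reindex_bij_betw[OF assms(1), of "\<lambda>x. \<Sum>y\<in>Y'. J x y"]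
      sum.reindex_bij_betw[OF assms(1), of "\<lambda>x. \<Sum>y\<in>Y'. xlnx (J x y)"]
      sum.reindex_bij_betw[OF assms(1), of "\<lambda>x. xlnx (\<Sum>y\<in>Y'. J x y)"]
      sum.reindex_bij_betw[OF assms(1), of "\<lambda>x. J x y" for y]
      sum.reindex_bij_betw[OF assms(2), of "\<lambda>y. J x y" for x]
      sum.reindex_bij_betw[OF assms(2), of "\<lambda>y. xlnx (J x y)" for x]
      sum.reindex_bij_betw[OF assms(2), of "\<lambda>y. xlnx (\<Sum>x\<in>X'. J x y)"])

lemma joint_info_chain:
  "joint_info X (Y \<times> Z) (\<lambda>x (y, z). J x y z)
     = joint_info X Z (\<lambda>x z. \<Sum>y\<in>Y. J x y z) + (\<Sum>z\<in>Z. joint_info X Y (\<lambda>x y. J x y z))"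
proof -
  have "(\<Sum>y\<in>Y. \<Sum>z\<in>Z. f y z) = (\<Sum>z\<in>Z. \<Sum>y\<in>Y. f y z)" for f :: "'b \<Rightarrow> 'c \<Rightarrow> real"
    by (rule sum.swap)
  moreover have "(\<Sum>z\<in>Z. \<Sum>x\<in>X. f x z) = (\<Sum>x\<in>X. \<Sum>z\<in>Z. f x z)" for f :: "'a \<Rightarrow> 'c \<Rightarrow> real"
    by (rule sum.swap)
  ultimately show ?thesis
    unfolding joint_info_def negentropy_def
    by (simp add: sum.cartesian_product' sum.distrib sum_subtractf)
qed

lemma joint_info_ge_posterior:
  assumes finite_sets: "finite X" "finite Y" and J_nonneg: "\<And>x y. x \<in> X \<Longrightarrow> y \<in> Y \<Longrightarrow> 0 \<le> J x y"
    and posterior: "\<And>x y. x \<in> X \<Longrightarrow> y \<in> Y \<Longrightarrow> 0 \<le> r x y" "\<And>y. y \<in> Y \<Longrightarrow> (\<Sum>x\<in>X. r x y) \<le> 1"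
    and null: "\<And>x y. x \<in> X \<Longrightarrow> y \<in> Y \<Longrightarrow> r x y = 0 \<Longrightarrow> J x y = 0"
  shows "xlnx (\<Sum>x\<in>X. \<Sum>y\<in>Y. J x y) - negentropy X (\<lambda>x. \<Sum>y\<in>Y. J x y)
      + (\<Sum>x\<in>X. \<Sum>y\<in>Y. J x y * ln (r x y)) \<le> joint_info X Y J"
proof -
  define out where "out y = (\<Sum>x\<in>X. J x y)" for y
  have out_nonneg: "0 \<le> out y" if "y \<in> Y" for y
    unfolding out_def using J_nonneg that by (intro sum_nonneg)
  have out_eq_0: "J x y = 0" if "x \<in> X" "y \<in> Y" "out y = 0" for x y
    using that finite_sets J_nonneg by (simp add: out_def sum_nonneg_eq_0_iff)
  have "(\<Sum>x\<in>X. J x y * ln (r x y)) \<le> (\<Sum>x\<in>X. xlnx (J x y)) - xlnx (out y)" if y_in_Y: "y \<in> Y" for y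
  proof -
    have "out y - (\<Sum>x\<in>X. out y * r x y) \<le> relent (\<lambda>x. J x y) (\<lambda>x. out y * r x y) X"
      unfolding out_def[of y]
      using J_nonneg y_in_Y out_nonneg[OF y_in_Y] posterior(1) out_eq_0[of _ y] null
      by (intro relent_ge_diff) (auto simp: out_def)
    moreover have "(\<Sum>x\<in>X. out y * r x y) \<le> out y"
      using posterior(2)[OF y_in_Y] out_nonneg[OF y_in_Y] by (simp add: mult_left_le flip: sum_distrib_left)
    moreover have "relent (\<lambda>x. J x y) (\<lambda>x. out y * r x y) X
        = (\<Sum>x\<in>X. xlnx (J x y) - (J x y * ln (out y) + J x y * ln (r x y)))"
      unfolding relent_eq_sum xlnx_def
    proof (intro sum.cong refl)
      fix x assume x_in_X: "x \<in> X"
      show "J x y * ln (J x y / (out y * r x y))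
          = J x y * ln (J x y) - (J x y * ln (out y) + J x y * ln (r x y))"
        using out_eq_0[OF x_in_X y_in_Y] null[OF x_in_X y_in_Y] by (auto simp: ln_div ln_mult algebra_simps)
    qed
    ultimately show ?thesis
      by (simp add: xlnx_def out_def sum.distrib sum_subtractf flip: sum_distrib_right)
  qed
  then have "(\<Sum>y\<in>Y. \<Sum>x\<in>X. J x y * ln (r x y)) \<le> (\<Sum>y\<in>Y. (\<Sum>x\<in>X. xlnx (J x y)) - xlnx (out y))"
    by (rule sum_mono)
  then show ?thesis
    using sum.swap[of "\<lambda>x y. J x y * ln (r x y)" Y X] sum.swap[of "\<lambda>x y. xlnx (J x y)" Y X]
    unfolding joint_info_def negentropy_def out_def by (simp add: sum_subtractf)
qed

lemma joint_info_nonneg: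
  assumes finite_sets: "finite X" "finite Y" and J_nonneg: "\<And>x y. x \<in> X \<Longrightarrow> y \<in> Y \<Longrightarrow> 0 \<le> J x y"
  shows "0 \<le> joint_info X Y J"
proof -
  define t where "t = (\<Sum>x\<in>X. \<Sum>y\<in>Y. J x y)"
  define \<mu> where "\<mu> x = (\<Sum>y\<in>Y. J x y)" for x
  have \<mu>_nonneg: "0 \<le> \<mu> x" and J_le: "y \<in> Y \<Longrightarrow> J x y \<le> \<mu> x" if "x \<in> X" for x y
    unfolding \<mu>_def using J_nonneg that finite_sets by (auto intro: sum_nonneg member_le_sum)
  have t_eq: "t = sum \<mu> X" and \<mu>_le: "x \<in> X \<Longrightarrow> \<mu> x \<le> t" for x
    unfolding t_def \<mu>_def[symmetric] using \<mu>_nonneg finite_sets by (auto intro: member_le_sum)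
  have "xlnx t - negentropy X \<mu> + (\<Sum>x\<in>X. \<Sum>y\<in>Y. J x y * ln (\<mu> x / t)) \<le> joint_info X Y J"
  proof -
    have "0 \<le> \<mu> x / t" and "\<mu> x / t = 0 \<Longrightarrow> J x y = 0" if "x \<in> X" "y \<in> Y" for x y
      using J_nonneg[OF that] J_le[OF that] \<mu>_nonneg[OF that(1)] \<mu>_le[OF that(1)] by auto
    moreover have "(\<Sum>x\<in>X. \<mu> x / t) \<le> 1" by (simp add: t_eq flip: sum_divide_distrib)
    ultimately show ?thesis
      unfolding t_def \<mu>_def by (intro joint_info_ge_posterior finite_sets J_nonneg)
  qed
  moreover have "(\<Sum>x\<in>X. \<Sum>y\<in>Y. J x y * ln (\<mu> x / t)) = (\<Sum>x\<in>X. xlnx (\<mu> x) - \<mu> x * ln t)"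
  proof (intro sum.cong refl)
    fix x assume "x \<in> X"
    then have "\<mu> x = 0 \<or> t \<noteq> 0" using \<mu>_nonneg \<mu>_le by fastforce
    then show "(\<Sum>y\<in>Y. J x y * ln (\<mu> x / t)) = xlnx (\<mu> x) - \<mu> x * ln t"
      by (auto simp: \<mu>_def[symmetric] xlnx_def ln_div algebra_simps simp flip: sum_distrib_right)
  qed
  ultimately show ?thesis
    by (simp add: negentropy_def sum_subtractf xlnx_def t_eq flip: sum_distrib_right)
qed

section \<open>Mutual information of a kernel\<close>

definition minfo :: "'a set \<Rightarrow> 'b set \<Rightarrow> ('a \<Rightarrow> real) \<Rightarrow> ('a \<Rightarrow> 'b \<Rightarrow> real) \<Rightarrow> real" where
  "minfo X Y \<mu> W = joint_info X Y (\<lambda>x y. \<mu> x * W x y)"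

lemma minfo_cong: "(\<And>x. x \<in> X \<Longrightarrow> \<mu> x = \<nu> x) \<Longrightarrow> minfo X Y \<mu> W = minfo X Y \<nu> W"
  unfolding minfo_def by (intro joint_info_cong) simp

lemma minfo_null: "(\<And>x. x \<in> X \<Longrightarrow> \<mu> x = 0) \<Longrightarrow> minfo X Y \<mu> W = 0"
  by (simp add: minfo_def joint_info_def negentropy_def xlnx_def)

lemma minfo_cmult: "minfo X Y (\<lambda>x. t * \<mu> x) W = t * minfo X Y \<mu> W"
  unfolding minfo_def by (simp add: mult.assoc joint_info_cmult)

lemma minfo_reindex_bij_betw:
  assumes "bij_betw f X X'" "bij_betw g Y Y'"
  shows "minfo X Y (\<lambda>x. \<mu> (f x)) (\<lambda>x y. W (f x) (g y)) = minfo X' Y' \<mu> W"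
  unfolding minfo_def by (rule joint_info_reindex_bij_betw[OF assms])

lemma minfo_nonneg:
  assumes "stochastic X Y W" "finite X" "finite Y" "\<And>x. x \<in> X \<Longrightarrow> 0 \<le> \<mu> x"
  shows "0 \<le> minfo X Y \<mu> W"
  unfolding minfo_def using assms
  by (intro joint_info_nonneg mult_nonneg_nonneg stochastic_nonneg[OF assms(1)])

lemma minfo_eq_negentropy:
  assumes "stochastic X Y W"
  shows "minfo X Y \<mu> W = xlnx (sum \<mu> X) + (\<Sum>x\<in>X. \<mu> x * negentropy Y (W x))
     - negentropy Y (mixture X \<mu> W)"
proof -
  have "(\<Sum>y\<in>Y. \<mu> x * W x y) = \<mu> x" if "x \<in> X" for x
    using stochastic_sum[OF assms that] by (simp flip: sum_distrib_left)
  moreover have "negentropy Y (\<lambda>y. \<mu> x * W x y) = \<mu> x * negentropy Y (W x) + xlnx (\<mu> x)" if "x \<in> X" for x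
    using stochastic_sum[OF assms that] by (simp add: negentropy_cmult)
  ultimately show ?thesis
    by (simp add: minfo_def joint_info_def negentropy_def[of X] sum.distrib mixture_def[abs_def])
qed

lemma minfo_pushforward:
  assumes stochastic_W: "stochastic X Y W" and finite_sets: "finite X" "finite Z" and g_image: "g ` Z \<subseteq> X"
  shows "minfo Z Y \<mu> (\<lambda>z. W (g z)) = minfo X Y (\<lambda>x. \<Sum>z\<in>{z \<in> Z. g z = x}. \<mu> z) W"
proof -
  have "stochastic Z Y (\<lambda>z. W (g z))"
    using stochastic_W g_image by (auto simp: stochastic_def)
  moreover have "(\<Sum>x\<in>X. (\<Sum>z\<in>{z \<in> Z. g z = x}. \<mu> z) * f x) = (\<Sum>z\<in>Z. \<mu> z * f (g z))" for f
  proof -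
    have "(\<Sum>x\<in>X. (\<Sum>z\<in>{z \<in> Z. g z = x}. \<mu> z) * f x) = (\<Sum>x\<in>X. \<Sum>z\<in>{z \<in> Z. g z = x}. \<mu> z * f (g z))"
      by (simp add: sum_distrib_right)
    also have "\<dots> = (\<Sum>z\<in>Z. \<mu> z * f (g z))"
      by (rule sum.group[OF finite_sets(2) finite_sets(1) g_image])
    finally show ?thesis .
  qed
  moreover have "(\<Sum>x\<in>X. \<Sum>z\<in>{z \<in> Z. g z = x}. \<mu> z) = sum \<mu> Z"
    by (rule sum.group[OF finite_sets(2) finite_sets(1) g_image])
  ultimately show ?thesis
    by (simp add: minfo_eq_negentropy stochastic_W mixture_def[abs_def])
qed

lemma minfo_Times_fst:
  assumes "stochastic X Y W" "finite X" "finite X'"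
  shows "minfo (X \<times> X') Y \<mu> (\<lambda>p. W (fst p)) = minfo X Y (\<lambda>x. \<Sum>x'\<in>X'. \<mu> (x, x')) W"
proof -
  have "{p \<in> X \<times> X'. fst p = x} = Pair x ` X'" if "x \<in> X" for x
    using that by auto
  then show ?thesis
    using assms
    by (subst minfo_pushforward[OF assms(1)]) (auto intro!: minfo_cong simp: sum.reindex inj_on_def)
qed

lemma minfo_Times_snd:
  assumes "stochastic X' Y W" "finite X" "finite X'"
  shows "minfo (X \<times> X') Y \<mu> (\<lambda>p. W (snd p)) = minfo X' Y (\<lambda>x'. \<Sum>x\<in>X. \<mu> (x, x')) W"
proof -
  have "{p \<in> X \<times> X'. snd p = x'} = (\<lambda>x. (x, x')) ` X" if "x' \<in> X'" for x'
    using that by auto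
  then show ?thesis
    using assms
    by (subst minfo_pushforward[OF assms(1)]) (auto intro!: minfo_cong simp: sum.reindex inj_on_def)
qed

lemma minfo_superadditive:
  assumes stochastic_W: "stochastic X Y W" and finite_sets: "finite X" "finite Y" "finite Z"
    and \<kappa>_nonneg: "\<And>z x. z \<in> Z \<Longrightarrow> x \<in> X \<Longrightarrow> 0 \<le> \<kappa> z x"
  shows "(\<Sum>z\<in>Z. minfo X Y (\<kappa> z) W) \<le> minfo X Y (\<lambda>x. \<Sum>z\<in>Z. \<kappa> z x) W"
proof -
  let ?J = "\<lambda>y x z. \<kappa> z x * W x y"
  have "minfo X Y (\<lambda>x. \<Sum>z\<in>Z. \<kappa> z x) W = minfo (X \<times> Z) Y (\<lambda>p. \<kappa> (snd p) (fst p)) (\<lambda>p. W (fst p))"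
    using stochastic_W finite_sets by (simp add: minfo_Times_fst)
  also have "\<dots> = joint_info Y (X \<times> Z) (\<lambda>y (x, z). ?J y x z)"
    unfolding minfo_def by (subst joint_info_commute) (simp add: case_prod_unfold)
  also have "\<dots> = joint_info Y Z (\<lambda>y z. \<Sum>x\<in>X. ?J y x z) + (\<Sum>z\<in>Z. minfo X Y (\<kappa> z) W)"
    unfolding joint_info_chain minfo_def by (subst joint_info_commute[of X]) (rule refl)
  finally show ?thesis
    using joint_info_nonneg[of Y Z "\<lambda>y z. \<Sum>x\<in>X. ?J y x z"] finite_sets \<kappa>_nonneg stochastic_W
    by (simp add: sum_nonneg stochastic_nonneg)
qed

lemma minfo_le_relent:
  assumes stochastic_W: "stochastic X Y W" and p_dist: "prob_dist X p" and q_dist: "prob_dist Y q"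
    and abs_cont: "\<And>x. x \<in> X \<Longrightarrow> abs_cont (W x) q"
  shows "minfo X Y p W \<le> (\<Sum>x\<in>X. p x * relent (W x) q Y)"
proof -
  have "abs_cont (mixture X p W) q"
    using abs_cont by (rule abs_cont_mixture)
  then have "0 \<le> negentropy Y (mixture X p W) - (\<Sum>y\<in>Y. mixture X p W y * ln (q y))"
    using relent_nonneg[OF prob_dist_mixture[OF stochastic_W p_dist] q_dist]
        relent_eq_negentropy[of Y q "mixture X p W"]
    by (simp add: abs_cont_def)
  moreover have "relent (W x) q Y = negentropy Y (W x) - (\<Sum>y\<in>Y. W x y * ln (q y))" if "x \<in> X" for x
    using abs_cont[OF that] by (intro relent_eq_negentropy) (simp add: abs_cont_def)
  ultimately show ?thesis
    unfolding minfo_eq_negentropy[OF stochastic_W] sum_mixture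
    by (simp add: prob_dist_sum[OF p_dist] xlnx_def right_diff_distrib sum_subtractf)
qed

lemma mutual_info_eq_minfo:
  assumes p_dist: "prob_dist {0..K} p" and stochastic_W: "stochastic {0..K} UNIV W"
  shows "mutual_info K p W = minfo {0..K} UNIV p W"
proof -
  let ?out = "mixture {0..K} p W"
  have "(if p x * W x y = 0 then 0 else p x * W x y * ln (W x y / ?out y))
      = p x * xlnx (W x y) - p x * (W x y * ln (?out y))" if x_range: "x \<in> {0..K}" for x y
  proof (cases "p x * W x y = 0")
    case False
    then have "0 < p x * W x y"
      using p_dist stochastic_W x_range
      by (simp add: prob_dist_nonneg stochastic_nonneg order.not_eq_order_implies_strict)
    also have "\<dots> \<le> ?out y"
      unfolding mixture_def using p_dist stochastic_W x_range
      by (intro member_le_sum) (auto intro!: mult_nonneg_nonneg simp: prob_dist_nonneg stochastic_nonneg)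
    finally show ?thesis using False by (simp add: xlnx_def ln_div algebra_simps)
  qed (auto simp: xlnx_def)
  then have "mutual_info K p W = (\<Sum>x=0..K. p x * negentropy UNIV (W x))
      - (\<Sum>x=0..K. p x * (\<Sum>y\<in>UNIV. W x y * ln (?out y)))"
    unfolding mutual_info_def mixture_def[symmetric] negentropy_def
    by (simp add: sum_subtractf sum_distrib_left)
  then show ?thesis
    using p_dist
    by (simp add: minfo_eq_negentropy[OF stochastic_W] negentropy_def[of _ ?out] xlnx_def prob_dist_sum
        flip: sum_mixture)
qed

section \<open>More capable kernels\<close>

text \<open>With \<open>c = 1\<close> this is the "more capable" order of Korner and Marton.\<close>

definition more_capable ::
  "real \<Rightarrow> 'a set \<Rightarrow> 'c set \<Rightarrow> ('a \<Rightarrow> 'c \<Rightarrow> real) \<Rightarrow> 'b set \<Rightarrow> ('a \<Rightarrow> 'b \<Rightarrow> real) \<Rightarrow> bool" where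
  "more_capable c X Y' V Y W \<longleftrightarrow>
     (\<forall>\<mu>. (\<forall>x\<in>X. 0 \<le> \<mu> x) \<longrightarrow> c * minfo X Y \<mu> W \<le> minfo X Y' \<mu> V)"

definition kernel_prod :: "('a \<Rightarrow> 'b \<Rightarrow> real) \<Rightarrow> ('c \<Rightarrow> 'd \<Rightarrow> real) \<Rightarrow> 'a \<times> 'c \<Rightarrow> 'b \<times> 'd \<Rightarrow> real" where
  "kernel_prod A B = (\<lambda>p q. A (fst p) (fst q) * B (snd p) (snd q))"

lemma more_capableD:
  "more_capable c X Y' V Y W \<Longrightarrow> (\<And>x. x \<in> X \<Longrightarrow> 0 \<le> \<mu> x) \<Longrightarrow> c * minfo X Y \<mu> W \<le> minfo X Y' \<mu> V"
  by (simp add: more_capable_def)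

lemma minfo_kernel_prod_chain_snd:
  assumes stochastic_A: "stochastic X Y A" and stochastic_B: "stochastic X' Y' B"
    and finite_sets: "finite X" "finite X'"
  shows "minfo (X \<times> X') (Y \<times> Y') \<mu> (kernel_prod A B) = minfo X' Y' (\<lambda>x'. \<Sum>x\<in>X. \<mu> (x, x')) B
     + (\<Sum>y'\<in>Y'. minfo X Y (\<lambda>x. \<Sum>x'\<in>X'. \<mu> (x, x') * B x' y') A)"
proof -
  let ?J = "\<lambda>p y y'. \<mu> p * B (snd p) y' * A (fst p) y"
  have "minfo (X \<times> X') (Y \<times> Y') \<mu> (kernel_prod A B) = joint_info (X \<times> X') (Y \<times> Y') (\<lambda>p (y, y'). ?J p y y')"
    unfolding minfo_def kernel_prod_def by (intro joint_info_cong) (simp add: case_prod_unfold)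
  also have "\<dots> = joint_info (X \<times> X') Y' (\<lambda>p y'. \<Sum>y\<in>Y. ?J p y y')
      + (\<Sum>y'\<in>Y'. joint_info (X \<times> X') Y (\<lambda>p y. ?J p y y'))"
    by (rule joint_info_chain)
  also have "joint_info (X \<times> X') Y' (\<lambda>p y'. \<Sum>y\<in>Y. ?J p y y') = minfo (X \<times> X') Y' \<mu> (\<lambda>p. B (snd p))"
    unfolding minfo_def using stochastic_sum[OF stochastic_A]
    by (intro joint_info_cong) (auto simp flip: sum_distrib_left)
  also have "\<dots> = minfo X' Y' (\<lambda>x'. \<Sum>x\<in>X. \<mu> (x, x')) B"
    by (rule minfo_Times_snd[OF stochastic_B finite_sets])
  also have "(\<Sum>y'\<in>Y'. joint_info (X \<times> X') Y (\<lambda>p y. ?J p y y'))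
      = (\<Sum>y'\<in>Y'. minfo X Y (\<lambda>x. \<Sum>x'\<in>X'. \<mu> (x, x') * B x' y') A)"
    using minfo_Times_fst[OF stochastic_A finite_sets, of "\<lambda>p. \<mu> p * B (snd p) y'" for y']
    by (simp add: minfo_def)
  finally show ?thesis .
qed

lemma minfo_kernel_prod_swap:
  "minfo (X \<times> X') (Y \<times> Y') \<mu> (kernel_prod A B)
      = minfo (X' \<times> X) (Y' \<times> Y) (\<lambda>p. \<mu> (prod.swap p)) (kernel_prod B A)"
proof -
  have "bij_betw prod.swap (X \<times> X') (X' \<times> X)" for X :: "'x set" and X' :: "'y set"
    by (rule bij_betwI[where g = prod.swap]) auto
  from minfo_reindex_bij_betw[OF this this, of X' X Y' Y \<mu> "kernel_prod A B"] show ?thesis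
    by (simp add: kernel_prod_def mult.commute)
qed

lemma minfo_kernel_prod_chain_fst:
  assumes stochastic_A: "stochastic X Y A" and stochastic_B: "stochastic X' Y' B"
    and finite_sets: "finite X" "finite X'"
  shows "minfo (X \<times> X') (Y \<times> Y') \<mu> (kernel_prod A B) = minfo X Y (\<lambda>x. \<Sum>x'\<in>X'. \<mu> (x, x')) A
     + (\<Sum>y\<in>Y. minfo X' Y' (\<lambda>x'. \<Sum>x\<in>X. \<mu> (x, x') * A x y) B)"
  using minfo_kernel_prod_chain_snd[OF stochastic_B stochastic_A finite_sets(2,1), of "\<lambda>p. \<mu> (prod.swap p)"]
  by (subst minfo_kernel_prod_swap) simp

lemma more_capable_kernel_prod:
  fixes A :: "'a \<Rightarrow> 'b \<Rightarrow> real" and B :: "'d \<Rightarrow> 'e \<Rightarrow> real"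
  assumes c_le_1: "c \<le> 1" and finite_sets: "finite X" "finite X'" "finite Y" "finite Y'" "finite Z"
    and stochastic_A: "stochastic X Y A" and stochastic_B: "stochastic X' Y' B"
    and stochastic_C: "stochastic X Z C" and stochastic_D: "stochastic X' Z' D"
    and more_capable_C_A: "more_capable c X Z C Y A" and more_capable_D_B: "more_capable c X' Z' D Y' B"
  shows "more_capable c (X \<times> X') (Z \<times> Z') (kernel_prod C D) (Y \<times> Y') (kernel_prod A B)"
  unfolding more_capable_def
proof (intro allI impI)
  fix \<mu> :: "'a \<times> 'd \<Rightarrow> real" assume \<mu>_nonneg: "\<forall>p\<in>X \<times> X'. 0 \<le> \<mu> p"
  define \<mu>1 where "\<mu>1 = (\<lambda>x. \<Sum>x'\<in>X'. \<mu> (x, x'))"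
  define \<mu>2 where "\<mu>2 = (\<lambda>x'. \<Sum>x\<in>X. \<mu> (x, x'))"
  define \<rho> where "\<rho> y' = (\<lambda>x. \<Sum>x'\<in>X'. \<mu> (x, x') * B x' y')" for y'
  define \<kappa> where "\<kappa> z = (\<lambda>x'. \<Sum>x\<in>X. \<mu> (x, x') * C x z)" for z
  have \<rho>_nonneg: "0 \<le> \<rho> y' x" if "x \<in> X" "y' \<in> Y'" for x y'
    unfolding \<rho>_def using that \<mu>_nonneg stochastic_nonneg[OF stochastic_B] by (auto intro!: sum_nonneg)
  have \<kappa>_nonneg: "0 \<le> \<kappa> z x'" if "x' \<in> X'" "z \<in> Z" for x' z
    unfolding \<kappa>_def using that \<mu>_nonneg stochastic_nonneg[OF stochastic_C] by (auto intro!: sum_nonneg)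
  have \<mu>2_eq: "\<mu>2 = (\<lambda>x'. \<Sum>z\<in>Z. \<kappa> z x')"
    unfolding \<mu>2_def \<kappa>_def using stochastic_sum[OF stochastic_C]
    by (subst sum.swap) (simp flip: sum_distrib_left)
  have superadditive: "(\<Sum>z\<in>Z. minfo X' Y' (\<kappa> z) B) \<le> minfo X' Y' \<mu>2 B"
    unfolding \<mu>2_eq by (intro minfo_superadditive[OF stochastic_B finite_sets(2,4,5)] \<kappa>_nonneg)
  have "(\<Sum>y'\<in>Y'. c * minfo X Y (\<rho> y') A) \<le> (\<Sum>y'\<in>Y'. minfo X Z (\<rho> y') C)"
    by (intro sum_mono more_capableD[OF more_capable_C_A] \<rho>_nonneg)
  \<comment> \<open>Replace \<open>A\<close> by \<open>C\<close> conditionally on the second output, expand the chain rule in the other order,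
    then replace \<open>B\<close> by \<open>D\<close>. The deficit \<open>(1 - c) * minfo X' Y' \<mu>2 B\<close> is paid for by superadditivity.\<close>
  then have "c * minfo (X \<times> X') (Y \<times> Y') \<mu> (kernel_prod A B)
      \<le> minfo (X \<times> X') (Z \<times> Y') \<mu> (kernel_prod C B) - (1 - c) * minfo X' Y' \<mu>2 B"
    unfolding minfo_kernel_prod_chain_snd[OF stochastic_A stochastic_B finite_sets(1,2)]
        minfo_kernel_prod_chain_snd[OF stochastic_C stochastic_B finite_sets(1,2)]
    by (fold \<mu>2_def \<rho>_def) (simp add: algebra_simps sum_distrib_left)
  also have "\<dots> = minfo X Z \<mu>1 C + (\<Sum>z\<in>Z. minfo X' Y' (\<kappa> z) B) - (1 - c) * minfo X' Y' \<mu>2 B"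
    unfolding minfo_kernel_prod_chain_fst[OF stochastic_C stochastic_B finite_sets(1,2)] \<mu>1_def \<kappa>_def ..
  also have "\<dots> \<le> minfo X Z \<mu>1 C + (\<Sum>z\<in>Z. c * minfo X' Y' (\<kappa> z) B)"
    using mult_left_mono[OF superadditive, of "1 - c"] c_le_1
    by (simp add: algebra_simps sum_distrib_left sum_subtractf)
  also have "\<dots> \<le> minfo X Z \<mu>1 C + (\<Sum>z\<in>Z. minfo X' Z' (\<kappa> z) D)"
    by (intro add_left_mono sum_mono more_capableD[OF more_capable_D_B] \<kappa>_nonneg)
  also have "\<dots> = minfo (X \<times> X') (Z \<times> Z') \<mu> (kernel_prod C D)"
    unfolding minfo_kernel_prod_chain_fst[OF stochastic_C stochastic_D finite_sets(1,2)] \<mu>1_def \<kappa>_def ..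
  finally show "c * minfo (X \<times> X') (Y \<times> Y') \<mu> (kernel_prod A B)
      \<le> minfo (X \<times> X') (Z \<times> Z') \<mu> (kernel_prod C D)" .
qed

lemma minfo_memoryless_Suc:
  "minfo (nlists (Suc n) X) (nlists (Suc n) Y) \<mu> (memoryless W)
    = minfo (X \<times> nlists n X) (Y \<times> nlists n Y) (\<lambda>(x, xs). \<mu> (x # xs)) (kernel_prod W (memoryless W))"
  unfolding minfo_reindex_bij_betw[OF bij_betw_Cons_nlists bij_betw_Cons_nlists, symmetric]
  by (simp add: kernel_prod_def case_prod_unfold memoryless_Cons)

lemma more_capable_memoryless:
  assumes c_le_1: "c \<le> 1" and finite_sets: "finite X" "finite Y" "finite Z"
    and stochastic_W: "stochastic X Y W" and stochastic_V: "stochastic X Z V"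
    and more_capable_V_W: "more_capable c X Z V Y W"
  shows "more_capable c (nlists n X) (nlists n Z) (memoryless V) (nlists n Y) (memoryless W)"
proof (induction n)
  case 0
  then show ?case by (simp add: more_capable_def minfo_def joint_info_def negentropy_def)
next
  case (Suc n)
  have "more_capable c (X \<times> nlists n X) (Z \<times> nlists n Z) (kernel_prod V (memoryless V))
      (Y \<times> nlists n Y) (kernel_prod W (memoryless W))"
    using finite_sets
    by (intro more_capable_kernel_prod c_le_1 stochastic_W stochastic_V more_capable_V_W stochastic_memoryless
        Suc.IH) auto
  then show ?case
    unfolding more_capable_def minfo_memoryless_Suc by (auto simp: case_prod_unfold)
qed

lemma more_capable_if_mutual_info_le:
  assumes stochastic_W: "stochastic {0..K} UNIV W" and stochastic_V: "stochastic {0..K} UNIV V"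
    and mutual_info_le: "\<And>p. p \<in> input_dists K \<Longrightarrow> c * mutual_info K p W \<le> mutual_info K p V"
  shows "more_capable c {0..K} UNIV V UNIV W"
  unfolding more_capable_def
proof (intro allI impI)
  fix \<mu> :: "nat \<Rightarrow> real" assume \<mu>_nonneg: "\<forall>x\<in>{0..K}. 0 \<le> \<mu> x"
  define t where "t = sum \<mu> {0..K}"
  show "c * minfo {0..K} UNIV \<mu> W \<le> minfo {0..K} UNIV \<mu> V"
  proof (cases "t = 0")
    case True
    then have null: "\<mu> x = 0" if "x \<in> {0..K}" for x
      using \<mu>_nonneg that sum_nonneg_eq_0_iff[of "{0..K}" \<mu>] by (auto simp: t_def)
    have "minfo {0..K} UNIV \<mu> W = 0" "minfo {0..K} UNIV \<mu> V = 0"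
      by (intro minfo_null null; assumption)+
    then show ?thesis by simp
  next
    case False
    moreover have "0 \<le> t"
      unfolding t_def using \<mu>_nonneg by (intro sum_nonneg) blast
    ultimately have t_pos: "0 < t" by simp
    define p where "p x = \<mu> x / t" for x
    have p_dist: "prob_dist {0..K} p"
      unfolding prob_dist_def p_def sum_divide_distrib[symmetric]
      using \<mu>_nonneg t_pos by (fold t_def) simp
    have scaled: "minfo {0..K} UNIV \<mu> U = t * mutual_info K p U" if "stochastic {0..K} UNIV U"
      for U :: "nat \<Rightarrow> 'x::finite \<Rightarrow> real"
      unfolding mutual_info_eq_minfo[OF p_dist that] minfo_cmult[symmetric]
      using t_pos by (intro minfo_cong) (simp add: p_def)
    have "t * (c * mutual_info K p W) \<le> t * mutual_info K p V"
      using mutual_info_le[of p] p_dist t_pos by (intro mult_left_mono) (auto simp: input_dists_iff)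
    then show ?thesis by (simp only: scaled[OF stochastic_W] scaled[OF stochastic_V] mult.left_commute)
  qed
qed

section \<open>Converse for two messages over a single channel use\<close>

definition decoding_error :: "'b set \<Rightarrow> ('b \<Rightarrow> real) \<Rightarrow> ('b \<Rightarrow> 'm) \<Rightarrow> 'm \<Rightarrow> real" where
  "decoding_error Y q d w = (\<Sum>y\<in>Y. q y * of_bool (d y \<noteq> w))"

definition uniform_info :: "'m set \<Rightarrow> 'b set \<Rightarrow> ('m \<Rightarrow> 'b \<Rightarrow> real) \<Rightarrow> real" where
  "uniform_info A Y T = minfo A Y (\<lambda>_. 1 / real (card A)) T"

lemma Fano_inequality:
  assumes finite_nonempty_A: "finite A" "A \<noteq> {}" and finite_Y: "finite Y" and stochastic_T: "stochastic A Y T"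
    and decoder_range: "\<And>y. y \<in> Y \<Longrightarrow> d y \<in> A"
  shows "(1 - avg A (\<lambda>w. decoding_error Y (T w) d w)) * ln (card A) - ln 2 \<le> uniform_info A Y T"
proof -
  define M where "M = real (card A)"
  have M_pos: "0 < M" using finite_nonempty_A by (simp add: M_def card_gt_0_iff)
  \<comment> \<open>the posterior of a guesser who trusts the decoder with probability 1/2 and guesses blindly otherwise\<close>
  define r where "r w y = (of_bool (d y = w) + 1 / M) / 2" for w y
  have r_pos: "0 < r w y" for w y using M_pos by (simp add: r_def add_nonneg_pos)
  have ln_r: "- ln 2 - of_bool (d y \<noteq> w) * ln M \<le> ln (r w y)" for w y
  proof (cases "d y = w")
    case True
    have "ln (1 / 2) \<le> ln (r w y)" using M_pos True by (intro ln_mono) (auto simp: r_def)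
    then show ?thesis using True by (simp add: ln_div)
  qed (use M_pos in \<open>simp add: r_def ln_div ln_mult\<close>)
  have info: "xlnx (\<Sum>w\<in>A. \<Sum>y\<in>Y. 1 / M * T w y) - negentropy A (\<lambda>w. \<Sum>y\<in>Y. 1 / M * T w y)
      + (\<Sum>w\<in>A. \<Sum>y\<in>Y. 1 / M * T w y * ln (r w y)) \<le> uniform_info A Y T"
    unfolding uniform_info_def minfo_def M_def[symmetric]
  proof (intro joint_info_ge_posterior finite_nonempty_A finite_Y)
    fix y assume y_in_Y: "y \<in> Y"
    have "(\<Sum>w\<in>A. r w y) = ((\<Sum>w\<in>A. of_bool (d y = w)) + card A / M) / 2"
      by (simp add: r_def sum.distrib flip: sum_divide_distrib)
    also have "(\<Sum>w\<in>A. of_bool (d y = w)) = (1 :: real)" using decoder_range[OF y_in_Y] finite_nonempty_A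
      by (simp add: of_bool_def)
    finally show "(\<Sum>w\<in>A. r w y) \<le> 1" using M_pos by (simp add: M_def)
  qed (use M_pos r_pos stochastic_nonneg[OF stochastic_T] in \<open>auto simp: less_imp_le less_imp_neq[symmetric]\<close>)
  have "(\<Sum>y\<in>Y. T w y * (- ln 2 - of_bool (d y \<noteq> w) * ln M)) = - ln 2 - decoding_error Y (T w) d w * ln M"
    if "w \<in> A" for w
    using stochastic_sum[OF stochastic_T that]
    unfolding decoding_error_def right_diff_distrib mult.assoc[symmetric]
    by (simp add: sum_subtractf sum_negf flip: sum_distrib_right)
  then have "- ln 2 - avg A (\<lambda>w. decoding_error Y (T w) d w) * ln M
      = avg A (\<lambda>w. \<Sum>y\<in>Y. T w y * (- ln 2 - of_bool (d y \<noteq> w) * ln M))"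
    by (simp add: avg_diff avg_const[OF finite_nonempty_A] avg_mult_right cong: avg_cong)
  also have "\<dots> \<le> avg A (\<lambda>w. \<Sum>y\<in>Y. T w y * ln (r w y))"
    by (intro avg_mono sum_mono mult_left_mono ln_r stochastic_nonneg[OF stochastic_T])
  also have "\<dots> = (\<Sum>w\<in>A. \<Sum>y\<in>Y. 1 / M * T w y * ln (r w y))"
    by (simp add: avg_def M_def mult.assoc sum_divide_distrib)
  finally show ?thesis
    using info M_pos
    by (simp add: stochastic_sum[OF stochastic_T] negentropy_def xlnx_def ln_div M_def algebra_simps
        flip: sum_distrib_left sum_divide_distrib)
qed

lemma uniform_info_Times:
  assumes "finite A" "finite B"
  shows "uniform_info (A \<times> B) Y T = uniform_info B Y (\<lambda>b y. avg A (\<lambda>a. T (a, b) y))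
     + avg B (\<lambda>b. uniform_info A Y (\<lambda>a. T (a, b)))"
proof -
  let ?J = "\<lambda>y a b. 1 / real (card B) * (1 / real (card A) * T (a, b) y)"
  have "uniform_info (A \<times> B) Y T = joint_info Y (A \<times> B) (\<lambda>y (a, b). ?J y a b)"
    unfolding uniform_info_def minfo_def
    by (subst joint_info_commute) (simp add: case_prod_unfold card_cartesian_product mult.commute)
  also have "\<dots> = joint_info Y B (\<lambda>y b. \<Sum>a\<in>A. ?J y a b) + (\<Sum>b\<in>B. joint_info Y A (\<lambda>y a. ?J y a b))"
    by (rule joint_info_chain)
  also have "joint_info Y B (\<lambda>y b. \<Sum>a\<in>A. ?J y a b) = uniform_info B Y (\<lambda>b y. avg A (\<lambda>a. T (a, b) y))"
    unfolding uniform_info_def minfo_def avg_def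
    by (subst joint_info_commute) (simp flip: sum_divide_distrib)
  also have "(\<Sum>b\<in>B. joint_info Y A (\<lambda>y a. ?J y a b)) = avg B (\<lambda>b. uniform_info A Y (\<lambda>a. T (a, b)))"
    unfolding uniform_info_def minfo_def avg_def joint_info_cmult
    by (subst joint_info_commute) (simp add: sum_divide_distrib mult.commute)
  finally show ?thesis .
qed

lemma more_capable_uniform_info:
  assumes more_capable_V_W: "more_capable c X Y' V Y W" and stochastic_W: "stochastic X Y W"
    and stochastic_V: "stochastic X Y' V"
    and finite_sets: "finite X" "finite A" and f_image: "f ` A \<subseteq> X"
  shows "c * uniform_info A Y (\<lambda>a. W (f a)) \<le> uniform_info A Y' (\<lambda>a. V (f a))"
  unfolding uniform_info_def minfo_pushforward[OF stochastic_W finite_sets f_image]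
      minfo_pushforward[OF stochastic_V finite_sets f_image]
  by (intro more_capableD[OF more_capable_V_W] sum_nonneg) simp

lemma uniform_info_le_avg_relent:
  assumes finite_nonempty_A: "finite A" "A \<noteq> {}" and stochastic_T: "stochastic A Y T"
    and q_dist: "prob_dist Y q"
    and abs_cont: "\<And>a. a \<in> A \<Longrightarrow> abs_cont (T a) q"
  shows "uniform_info A Y T \<le> avg A (\<lambda>a. relent (T a) q Y)"
proof -
  have "prob_dist A (\<lambda>_. 1 / real (card A))"
    using finite_nonempty_A by (simp add: prob_dist_def)
  from minfo_le_relent[OF stochastic_T this q_dist abs_cont] show ?thesis
    by (simp add: uniform_info_def avg_def sum_divide_distrib)
qed

lemma two_message_converse:
  assumes stochastic_W: "stochastic X Y W" and stochastic_V: "stochastic X Y' V"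
    and more_capable_V_W: "more_capable c X Y' V Y W" and c_nonneg: "0 \<le> c"
    and finite_sets: "finite X" "finite Y" "finite Y'" and finite_nonempty_A: "finite A" "A \<noteq> {}"
    and finite_nonempty_B: "finite B" "B \<noteq> {}"
    and q_dist: "prob_dist Y' q" and abs_cont: "\<And>x. x \<in> X \<Longrightarrow> abs_cont (V x) q"
    and enc: "\<And>a b. a \<in> A \<Longrightarrow> b \<in> B \<Longrightarrow> enc (a, b) \<in> X"
    and d1_range: "\<And>y. y \<in> Y \<Longrightarrow> d1 y \<in> A" and d2_range: "\<And>y. y \<in> Y' \<Longrightarrow> d2 y \<in> B"
  defines "e1 \<equiv> avg (A \<times> B) (\<lambda>w. decoding_error Y (W (enc w)) d1 (fst w))"
    and "e2 \<equiv> avg (A \<times> B) (\<lambda>w. decoding_error Y' (V (enc w)) d2 (snd w))"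
  shows "c * ((1 - e1) * ln (card A) - ln 2) + ((1 - e2) * ln (card B) - ln 2)
     \<le> avg (A \<times> B) (\<lambda>w. relent (V (enc w)) q Y')"
proof -
  define f1 where "f1 b = avg A (\<lambda>a. decoding_error Y (W (enc (a, b))) d1 a)" for b
  define T where "T b y = avg A (\<lambda>a. V (enc (a, b)) y)" for b y
  have e1_eq: "e1 = avg B f1"
    unfolding e1_def f1_def avg_Times by (subst avg_swap) simp
  have e2_eq: "e2 = avg B (\<lambda>b. decoding_error Y' (T b) d2 b)"
    unfolding e2_def avg_Times decoding_error_def T_def avg_mult_right[symmetric] avg_sum
    by (subst avg_swap) (simp add: avg_sum)
  have W_enc: "stochastic A Y (\<lambda>a. W (enc (a, b)))" and V_enc: "stochastic A Y' (\<lambda>a. V (enc (a, b)))"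
    and enc_range: "(\<lambda>a. enc (a, b)) ` A \<subseteq> X" if "b \<in> B" for b
    using stochastic_W stochastic_V enc that by (auto simp: stochastic_def)
  have "c * ((1 - f1 b) * ln (card A) - ln 2) \<le> uniform_info A Y' (\<lambda>a. V (enc (a, b)))"
    if b_in_B: "b \<in> B" for b
  proof -
    have "c * ((1 - f1 b) * ln (card A) - ln 2) \<le> c * uniform_info A Y (\<lambda>a. W (enc (a, b)))"
      unfolding f1_def using c_nonneg
      by (intro mult_left_mono Fano_inequality finite_nonempty_A finite_sets W_enc[OF b_in_B] d1_range)
    also have "\<dots> \<le> uniform_info A Y' (\<lambda>a. V (enc (a, b)))"
      by (rule more_capable_uniform_info[OF more_capable_V_W stochastic_W stochastic_V finite_sets(1)
          finite_nonempty_A(1) enc_range[OF b_in_B]])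
    finally show ?thesis .
  qed
  then have "avg B (\<lambda>b. c * ((1 - f1 b) * ln (card A) - ln 2))
      \<le> avg B (\<lambda>b. uniform_info A Y' (\<lambda>a. V (enc (a, b))))"
    by (rule avg_mono)
  then have user1: "c * ((1 - e1) * ln (card A) - ln 2) \<le> avg B (\<lambda>b. uniform_info A Y' (\<lambda>a. V (enc (a, b))))"
    by (simp add: avg_mult_left avg_diff avg_mult_right avg_const[OF finite_nonempty_B] e1_eq)
  have "stochastic B Y' T"
    unfolding stochastic_def T_def using prob_dist_avg[OF V_enc finite_nonempty_A] by blast
  then have user2: "(1 - e2) * ln (card B) - ln 2 \<le> uniform_info B Y' T"
    unfolding e2_eq by (intro Fano_inequality finite_nonempty_B finite_sets d2_range)
  have "uniform_info (A \<times> B) Y' (\<lambda>w. V (enc w)) \<le> avg (A \<times> B) (\<lambda>w. relent (V (enc w)) q Y')"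
    using finite_nonempty_A finite_nonempty_B stochastic_V enc
    by (intro uniform_info_le_avg_relent q_dist abs_cont) (auto simp: stochastic_def)
  then show ?thesis
    using user1 user2 unfolding uniform_info_Times[OF finite_nonempty_A(1) finite_nonempty_B(1)] T_def
    by linarith
qed

lemma two_message_converse_with_key:
  assumes stochastic_W: "stochastic X Y W" and stochastic_V: "stochastic X Y' V"
    and more_capable_V_W: "more_capable c X Y' V Y W"
    and c_bounds: "0 \<le> c" "c \<le> 1" and finite_sets: "finite X" "finite Y" "finite Y'"
    and finite_nonempty_A: "finite A" "A \<noteq> {}" and finite_nonempty_B: "finite B" "B \<noteq> {}"
    and finite_nonempty_S: "finite S" "S \<noteq> {}"
    and q_dist: "prob_dist Y' q" and abs_cont: "\<And>x. x \<in> X \<Longrightarrow> abs_cont (V x) q"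
    and enc: "\<And>a b s. a \<in> A \<Longrightarrow> b \<in> B \<Longrightarrow> s \<in> S \<Longrightarrow> enc (a, b, s) \<in> X"
    and d1_range: "\<And>y s. y \<in> Y \<Longrightarrow> s \<in> S \<Longrightarrow> d1 y s \<in> A" and d2_range: "\<And>y s. y \<in> Y' \<Longrightarrow> s \<in> S \<Longrightarrow> d2 y s \<in> B"
    and error1: "avg (A \<times> B \<times> S) (\<lambda>(a, b, s). decoding_error Y (W (enc (a, b, s))) (\<lambda>y. d1 y s) a) \<le> e"
    and error2: "avg (A \<times> B \<times> S) (\<lambda>(a, b, s). decoding_error Y' (V (enc (a, b, s))) (\<lambda>y. d2 y s) b) \<le> e"
  shows "(1 - e) * (c * ln (card A) + ln (card B)) - 2 * ln 2
     \<le> avg (A \<times> B \<times> S) (\<lambda>w. relent (V (enc w)) q Y')"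
proof -
  have fix_key: "avg (A \<times> B \<times> S) f = avg S (\<lambda>s. avg (A \<times> B) (\<lambda>w. f (fst w, snd w, s)))" for f :: "_ \<Rightarrow> real"
    unfolding avg_Times by (subst avg_swap[of S], intro avg_cong) (subst avg_swap[of S], simp)
  define f1 where "f1 s
      = avg (A \<times> B) (\<lambda>w. decoding_error Y (W (enc (fst w, snd w, s))) (\<lambda>y. d1 y s) (fst w))" for s
  define f2 where "f2 s
      = avg (A \<times> B) (\<lambda>w. decoding_error Y' (V (enc (fst w, snd w, s))) (\<lambda>y. d2 y s) (snd w))" for s
  have errors_le: "avg S f1 \<le> e" "avg S f2 \<le> e"
    using error1 error2 unfolding fix_key f1_def f2_def by simp_all
  have "0 \<le> ln (real (card A))" "0 \<le> ln (real (card B))"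
    using finite_nonempty_A finite_nonempty_B by (simp_all add: card_gt_0_iff Suc_leI)
  then have "c * ((1 - e) * ln (card A)) \<le> c * ((1 - avg S f1) * ln (card A))"
    and "(1 - e) * ln (card B) \<le> (1 - avg S f2) * ln (card B)"
    using errors_le c_bounds by (auto intro!: mult_left_mono mult_right_mono)
  moreover have "c * ln 2 \<le> ln 2" using c_bounds by (simp add: mult_left_le_one_le)
  moreover have "c * (t - ln 2) = c * t - c * ln 2" for t by (rule right_diff_distrib)
  moreover have "(1 - e) * (c * ln (card A) + ln (card B))
      = c * ((1 - e) * ln (card A)) + (1 - e) * ln (card B)"
    by (simp add: algebra_simps)
  ultimately have "(1 - e) * (c * ln (card A) + ln (card B)) - 2 * ln 2
      \<le> c * ((1 - avg S f1) * ln (card A) - ln 2) + ((1 - avg S f2) * ln (card B) - ln 2)"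
    by (simp only:)
  also have "\<dots> = avg S (\<lambda>s. c * ((1 - f1 s) * ln (card A) - ln 2) + ((1 - f2 s) * ln (card B) - ln 2))"
    by (simp add: avg_add avg_mult_left avg_diff avg_mult_right avg_const[OF finite_nonempty_S])
  also have "\<dots> \<le> avg S (\<lambda>s. avg (A \<times> B) (\<lambda>w. relent (V (enc (fst w, snd w, s))) q Y'))"
    unfolding f1_def f2_def
    by (intro avg_mono two_message_converse[OF stochastic_W stochastic_V more_capable_V_W c_bounds(1)
        finite_sets finite_nonempty_A finite_nonempty_B q_dist abs_cont]) (simp_all add: enc d1_range d2_range)
  finally show ?thesis by (simp only: fix_key)
qed

section \<open>Symbol frequencies of a code\<close>

abbreviation symbol_freq :: "'w set \<Rightarrow> nat \<Rightarrow> ('w \<Rightarrow> 'a list) \<Rightarrow> 'a \<Rightarrow> real" where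
  "symbol_freq \<Omega> n enc \<equiv> freq (\<Omega> \<times> {..<n}) (\<lambda>(w, i). enc w ! i)"

lemma symbols_subset:
  "(\<And>w. w \<in> \<Omega> \<Longrightarrow> enc w \<in> nlists n X) \<Longrightarrow> (\<lambda>(w, i). enc w ! i) ` (\<Omega> \<times> {..<n}) \<subseteq> X"
  using nlistsE_nth_in by fastforce

lemma avg_symbols:
  assumes finite_X: "finite X" and enc: "\<And>w. w \<in> \<Omega> \<Longrightarrow> enc w \<in> nlists n X"
  shows "avg \<Omega> (\<lambda>w. \<Sum>i<n. f (enc w ! i)) = n * (\<Sum>k\<in>X. symbol_freq \<Omega> n enc k * f k)"
proof -
  have "(\<Sum>k\<in>X. symbol_freq \<Omega> n enc k * f k) = avg (\<Omega> \<times> {..<n}) (\<lambda>v. f (case v of (w, i) \<Rightarrow> enc w ! i))"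
    by (rule avg_eq_sum_freq[OF finite_X symbols_subset[OF enc], symmetric])
  also have "\<dots> = avg \<Omega> (\<lambda>w. avg {..<n} (\<lambda>i. f (enc w ! i)))"
    by (simp add: avg_Times)
  finally show ?thesis
    by (cases "n = 0") (simp_all add: avg_def flip: sum_divide_distrib)
qed

lemma prob_dist_symbol_freq:
  assumes "finite X" "finite \<Omega>" "\<Omega> \<noteq> {}" "\<And>w. w \<in> \<Omega> \<Longrightarrow> enc w \<in> nlists n X" "1 \<le> n"
  shows "prob_dist X (symbol_freq \<Omega> n enc)"
  using assms by (intro prob_dist_freq symbols_subset) (auto simp: lessThan_empty_iff)

lemma abs_cont_symbol_mixture:
  assumes "finite X" "finite \<Omega>" "\<And>w. w \<in> \<Omega> \<Longrightarrow> enc w \<in> nlists n X" "stochastic X UNIV Q" "w \<in> \<Omega>" "i < n"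
  shows "abs_cont (Q (enc w ! i)) (mixture X (symbol_freq \<Omega> n enc) Q)"
  unfolding abs_cont_def
proof (intro allI impI)
  have p_dist: "prob_dist X (symbol_freq \<Omega> n enc)"
    using assms by (intro prob_dist_symbol_freq) auto
  fix z assume zero: "mixture X (symbol_freq \<Omega> n enc) Q z = 0"
  have "0 \<le> symbol_freq \<Omega> n enc k * Q k z" if "k \<in> X" for k
    using prob_dist_nonneg[OF p_dist that] stochastic_nonneg[OF assms(4) that, of z] by simp
  then have "\<forall>k\<in>X. symbol_freq \<Omega> n enc k * Q k z = 0"
    using zero assms(1) by (simp add: mixture_def sum_nonneg_eq_0_iff)
  moreover have "enc w ! i \<in> X"
    using assms(3,5,6) by (blast intro: nlistsE_nth_in)
  ultimately have "symbol_freq \<Omega> n enc (enc w ! i) * Q (enc w ! i) z = 0" by blast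
  then show "Q (enc w ! i) z = 0" using freq_pos[of "\<Omega> \<times> {..<n}" "(w, i)" "\<lambda>(w, i). enc w ! i"] assms(2,5,6)
    by simp
qed

lemma sum_avg_memoryless_ln:
  assumes finite_X: "finite X" and enc: "\<And>w. w \<in> \<Omega> \<Longrightarrow> enc w \<in> nlists n X" and stochastic_Q: "stochastic X Z Q"
    and abs_cont: "\<And>w i. w \<in> \<Omega> \<Longrightarrow> i < n \<Longrightarrow> abs_cont (Q (enc w ! i)) F"
  shows "(\<Sum>zs\<in>nlists n Z. avg \<Omega> (\<lambda>w. memoryless Q (enc w) zs) * ln (product_dist n (\<lambda>_. F) zs))
    = n * (\<Sum>z\<in>Z. mixture X (symbol_freq \<Omega> n enc) Q z * ln (F z))"
proof -
  have "memoryless Q (enc w) = product_dist n (\<lambda>i. Q (enc w ! i))" if "w \<in> \<Omega>" for w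
    using enc[OF that] by (simp add: memoryless_def)
  then have "(\<Sum>zs\<in>nlists n Z. avg \<Omega> (\<lambda>w. memoryless Q (enc w) zs) * ln (product_dist n (\<lambda>_. F) zs))
      = avg \<Omega> (\<lambda>w. \<Sum>zs\<in>nlists n Z. product_dist n (\<lambda>i. Q (enc w ! i)) zs * ln (product_dist n (\<lambda>_. F) zs))"
    unfolding avg_sum avg_mult_right by (simp cong: avg_cong)
  also have "\<dots> = avg \<Omega> (\<lambda>w. \<Sum>i<n. \<Sum>z\<in>Z. Q (enc w ! i) z * ln (F z))"
    using nlistsE_nth_in[OF enc]
    by (intro avg_cong sum_nlists_product_dist_ln abs_cont stochastic_sum[OF stochastic_Q]) auto
  also have "\<dots> = n * (\<Sum>k\<in>X. symbol_freq \<Omega> n enc k * (\<Sum>z\<in>Z. Q k z * ln (F z)))"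
    by (intro avg_symbols finite_X enc)
  finally show ?thesis by (simp only: sum_mixture)
qed

lemma abs_cont_avg_memoryless:
  assumes enc: "\<And>w. w \<in> \<Omega> \<Longrightarrow> enc w \<in> nlists n X"
    and abs_cont: "\<And>w i. w \<in> \<Omega> \<Longrightarrow> i < n \<Longrightarrow> abs_cont (Q (enc w ! i)) F"
  shows "abs_cont (\<lambda>zs. avg \<Omega> (\<lambda>w. memoryless Q (enc w) zs)) (product_dist n (\<lambda>_. F))"
  unfolding abs_cont_def product_dist_eq_0_iff
proof (intro allI impI)
  fix zs assume "\<exists>i<n. F (zs ! i) = 0"
  then obtain i where zero_at_i: "i < n" "F (zs ! i) = 0" by blast
  have "memoryless Q (enc w) zs = 0" if "w \<in> \<Omega>" for w
    using abs_cont[OF that zero_at_i(1)] zero_at_i nlistsE_length[OF enc[OF that]]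
    unfolding memoryless_def product_dist_eq_0_iff abs_cont_def by blast
  then show "avg \<Omega> (\<lambda>w. memoryless Q (enc w) zs) = 0" by (simp add: avg_def)
qed

lemma relent_avg_memoryless_eq:
  assumes finite_X: "finite X" and enc: "\<And>w. w \<in> \<Omega> \<Longrightarrow> enc w \<in> nlists n X" and stochastic_Q: "stochastic X Z Q"
    and abs_cont: "\<And>w i. w \<in> \<Omega> \<Longrightarrow> i < n \<Longrightarrow> abs_cont (Q (enc w ! i)) F"
  defines "out \<equiv> \<lambda>zs. avg \<Omega> (\<lambda>w. memoryless Q (enc w) zs)"
  shows "relent out (product_dist n (\<lambda>_. F)) (nlists n Z) = negentropy (nlists n Z) out
    - n * (\<Sum>z\<in>Z. mixture X (symbol_freq \<Omega> n enc) Q z * ln (F z))"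
proof -
  have "abs_cont out (product_dist n (\<lambda>_. F))"
    unfolding out_def by (intro abs_cont_avg_memoryless[where X = X] enc abs_cont)
  then have "relent out (product_dist n (\<lambda>_. F)) (nlists n Z)
      = negentropy (nlists n Z) out - (\<Sum>zs\<in>nlists n Z. out zs * ln (product_dist n (\<lambda>_. F) zs))"
    by (intro relent_eq_negentropy) (simp add: abs_cont_def)
  then show ?thesis
    using sum_avg_memoryless_ln[OF finite_X enc stochastic_Q abs_cont] by (simp add: out_def)
qed

lemma relent_avg_memoryless_ge:
  fixes Q :: "'a \<Rightarrow> 'z::finite \<Rightarrow> real"
  assumes finite_X: "finite X" and finite_nonempty_\<Omega>: "finite \<Omega>" "\<Omega> \<noteq> {}"
    and enc: "\<And>w. w \<in> \<Omega> \<Longrightarrow> enc w \<in> nlists n X" and n_ge_1: "1 \<le> n"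
    and stochastic_Q: "stochastic X UNIV Q" and abs_cont: "\<And>x. x \<in> X \<Longrightarrow> abs_cont (Q x) q"
  shows "n * relent (mixture X (symbol_freq \<Omega> n enc) Q) q UNIV
     \<le> relent (\<lambda>zs. avg \<Omega> (\<lambda>w. memoryless Q (enc w) zs)) (product_dist n (\<lambda>_. q)) (nlists n UNIV)"
proof -
  define R where "R = mixture X (symbol_freq \<Omega> n enc) Q"
  define out where "out = (\<lambda>zs. avg \<Omega> (\<lambda>w. memoryless Q (enc w) zs))"
  have R_dist: "prob_dist UNIV R"
    unfolding R_def
    by (intro prob_dist_mixture[OF stochastic_Q] prob_dist_symbol_freq finite_X finite_nonempty_\<Omega> enc n_ge_1)
  have out_dist: "prob_dist (nlists n UNIV) out"
    unfolding out_def using stochastic_memoryless[OF stochastic_Q] enc finite_nonempty_\<Omega>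
    by (intro prob_dist_avg) (auto simp: stochastic_def)
  have ac_q: "abs_cont (Q (enc w ! i)) q" if "w \<in> \<Omega>" "i < n" for w i
    using nlistsE_nth_in[OF enc] that by (intro abs_cont) blast
  have ac_R: "abs_cont (Q (enc w ! i)) R" if "w \<in> \<Omega>" "i < n" for w i
    unfolding R_def by (intro abs_cont_symbol_mixture finite_X finite_nonempty_\<Omega> enc stochastic_Q that)
  have relent_out: "relent out (product_dist n (\<lambda>_. F)) (nlists n UNIV)
      = negentropy (nlists n UNIV) out - n * (\<Sum>z\<in>UNIV. R z * ln (F z))"
    if "\<And>w i. w \<in> \<Omega> \<Longrightarrow> i < n \<Longrightarrow> abs_cont (Q (enc w ! i)) F" for F
    unfolding out_def R_def by (intro relent_avg_memoryless_eq finite_X enc stochastic_Q that)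
  have "abs_cont out (product_dist n (\<lambda>_. R))"
    unfolding out_def by (intro abs_cont_avg_memoryless[where X = X] enc ac_R)
  then have "0 \<le> relent out (product_dist n (\<lambda>_. R)) (nlists n UNIV)"
    by (intro relent_nonneg out_dist prob_dist_product_dist R_dist)
  then have "n * negentropy UNIV R \<le> negentropy (nlists n UNIV) out"
    using relent_out[OF ac_R] by (simp add: negentropy_def xlnx_def)
  moreover have "abs_cont R q"
    unfolding R_def using abs_cont by (rule abs_cont_mixture)
  then have "relent R q UNIV = negentropy UNIV R - (\<Sum>z\<in>UNIV. R z * ln (q z))"
    by (simp add: relent_eq_negentropy abs_cont_def)
  ultimately show ?thesis
    using relent_out[OF ac_q] unfolding R_def[symmetric] out_def[symmetric]
    by (simp add: right_diff_distrib)
qed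

section \<open>Relative entropy near a fixed distribution\<close>

lemma xlnx_near_1:
  fixes u :: real
  assumes "\<bar>u\<bar> \<le> 1/2"
  shows "\<bar>xlnx (1 + u) - u - u\<^sup>2 / 2\<bar> \<le> 2 * \<bar>u\<bar>^3"
proof -
  define f where "f = (\<lambda>x::real. xlnx (1 + x) - x - x\<^sup>2 / 2)"
  have "(f has_field_derivative ln (1 + x) - x) (at x within {-\<bar>u\<bar>..\<bar>u\<bar>})"
    if "x \<in> {-\<bar>u\<bar>..\<bar>u\<bar>}" for x
    unfolding f_def xlnx_def using that assms by (auto intro!: derivative_eq_intros)
  moreover have "norm (ln (1 + x) - x) \<le> 2 * u\<^sup>2" if "x \<in> {-\<bar>u\<bar>..\<bar>u\<bar>}" for x
  proof -
    have abs_x_le: "\<bar>x\<bar> \<le> \<bar>u\<bar>" using that by auto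
    then have "\<bar>ln (1 + x) - x\<bar> \<le> 2 * x\<^sup>2"
      using assms by (intro abs_ln_one_plus_x_minus_x_bound) simp
    also have "\<dots> \<le> 2 * u\<^sup>2" using abs_x_le by (simp add: abs_le_square_iff)
    finally show ?thesis by simp
  qed
  ultimately have "norm (f u - f 0) \<le> 2 * u\<^sup>2 * norm (u - 0)"
    by (intro field_differentiable_bound[of "{-\<bar>u\<bar>..\<bar>u\<bar>}" f "\<lambda>x. ln (1 + x) - x"]) auto
  then show ?thesis by (simp add: f_def xlnx_def power3_eq_cube power2_eq_square)
qed

lemma abs_relent_minus_half_chi2_le:
  fixes q r :: "'z::finite \<Rightarrow> real"
  assumes q_pos: "\<And>z. 0 < q z" and sum_eq: "sum r UNIV = sum q UNIV"
    and near: "\<And>z. \<bar>r z / q z - 1\<bar> \<le> \<eta>" and \<eta>_le_half: "\<eta> \<le> 1/2"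
  shows "\<bar>relent r q UNIV - chi2 r q / 2\<bar> \<le> 2 * \<eta> * chi2 r q"
proof -
  define u where "u z = r z / q z - 1" for z
  have ratio: "r z / q z = 1 + u z" for z by (simp add: u_def)
  have r_eq: "r z = q z * (1 + u z)" for z
    unfolding ratio[symmetric] using q_pos[of z] by simp
  have chi2_eq: "chi2 r q = (\<Sum>z\<in>UNIV. q z * (u z)\<^sup>2)"
    unfolding chi2_def using q_pos
    by (intro sum.cong) (simp_all add: r_eq power2_eq_square less_imp_neq[symmetric] field_simps)
  have "(\<Sum>z\<in>UNIV. r z - q z) = 0" using sum_eq by (simp add: sum_subtractf)
  moreover have "relent r q UNIV - chi2 r q / 2 - (\<Sum>z\<in>UNIV. r z - q z)
      = (\<Sum>z\<in>UNIV. q z * (xlnx (1 + u z) - u z - (u z)\<^sup>2 / 2))"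
    unfolding relent_eq_sum chi2_eq sum_divide_distrib sum_subtractf[symmetric] ratio
    by (intro sum.cong refl) (simp add: r_eq xlnx_def algebra_simps)
  ultimately have "\<bar>relent r q UNIV - chi2 r q / 2\<bar>
      \<le> (\<Sum>z\<in>UNIV. \<bar>q z * (xlnx (1 + u z) - u z - (u z)\<^sup>2 / 2)\<bar>)"
    by (simp only: diff_zero sum_abs)
  also have "\<dots> \<le> (\<Sum>z\<in>UNIV. 2 * \<eta> * (q z * (u z)\<^sup>2))"
  proof (rule sum_mono)
    fix z
    have abs_u_le: "\<bar>u z\<bar> \<le> \<eta>" using near[of z] by (simp add: u_def)
    then have "\<bar>xlnx (1 + u z) - u z - (u z)\<^sup>2 / 2\<bar> \<le> 2 * \<bar>u z\<bar>^3"
      using \<eta>_le_half by (intro xlnx_near_1) simp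
    also have "\<dots> = 2 * \<bar>u z\<bar> * (u z)\<^sup>2" by (simp add: power3_eq_cube power2_eq_square)
    also have "\<dots> \<le> 2 * \<eta> * (u z)\<^sup>2" using abs_u_le by (intro mult_right_mono) auto
    finally have "q z * \<bar>xlnx (1 + u z) - u z - (u z)\<^sup>2 / 2\<bar> \<le> q z * (2 * \<eta> * (u z)\<^sup>2)"
      using q_pos[of z] by (intro mult_left_mono) auto
    then show "\<bar>q z * (xlnx (1 + u z) - u z - (u z)\<^sup>2 / 2)\<bar> \<le> 2 * \<eta> * (q z * (u z)\<^sup>2)"
      using q_pos[of z] by (simp add: abs_mult mult.left_commute)
  qed
  also have "\<dots> = 2 * \<eta> * chi2 r q" by (simp add: chi2_eq sum_distrib_left)
  finally show ?thesis .
qed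

lemma hellinger_le_relent:
  assumes f_dist: "prob_dist A f" and g_dist: "prob_dist A g" and abs_cont: "abs_cont f g"
  shows "(\<Sum>a\<in>A. (sqrt (f a) - sqrt (g a))\<^sup>2) \<le> relent f g A"
proof -
  have "(\<Sum>a\<in>A. (sqrt (f a) - sqrt (g a))\<^sup>2) \<le> (\<Sum>a\<in>A. f a * ln (f a / g a) + (g a - f a))"
  proof (rule sum_mono)
    fix a assume a_in_A: "a \<in> A"
    show "(sqrt (f a) - sqrt (g a))\<^sup>2 \<le> f a * ln (f a / g a) + (g a - f a)"
    proof (cases "f a = 0")
      case False
      then have pos: "0 < f a" "0 < g a"
        using prob_dist_nonneg[OF f_dist a_in_A] prob_dist_nonneg[OF g_dist a_in_A] abs_cont
        by (auto simp: abs_cont_def less_le)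
      then have "f a * ln (sqrt (g a / f a)) \<le> f a * (sqrt (g a / f a) - 1)"
        by (intro mult_left_mono ln_le_minus_one) auto
      moreover have "f a * sqrt (g a / f a) = f a / sqrt (f a) * sqrt (g a)"
        by (simp add: real_sqrt_divide)
      then have "f a * sqrt (g a / f a) = sqrt (f a) * sqrt (g a)"
        using pos by (simp only: real_div_sqrt less_imp_le)
      moreover have "f a * ln (sqrt (g a / f a)) = - (f a * ln (f a / g a)) / 2"
        using pos by (simp add: ln_sqrt ln_div algebra_simps)
      moreover have "(sqrt (f a) - sqrt (g a))\<^sup>2 = f a + g a - 2 * (sqrt (f a) * sqrt (g a))"
        using pos by (simp add: power2_diff)
      ultimately show ?thesis by (simp add: right_diff_distrib)
    qed (use prob_dist_nonneg[OF g_dist a_in_A] in simp)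
  qed
  also have "\<dots> = relent f g A"
    using prob_dist_sum[OF f_dist] prob_dist_sum[OF g_dist]
    by (simp add: relent_eq_sum sum.distrib sum_subtractf)
  finally show ?thesis .
qed

lemma abs_diff_le_sqrt_relent:
  assumes f_dist: "prob_dist A f" and g_dist: "prob_dist A g" and abs_cont: "abs_cont f g" and a_in_A: "a \<in> A"
    and finite_A: "finite A"
  shows "\<bar>f a - g a\<bar> \<le> 2 * sqrt (relent f g A)"
proof -
  have nonneg: "0 \<le> f a" "0 \<le> g a" and le_1: "f a \<le> 1" "g a \<le> 1"
    using prob_dist_nonneg[OF f_dist a_in_A] prob_dist_nonneg[OF g_dist a_in_A]
        prob_dist_le_1[OF f_dist finite_A a_in_A] prob_dist_le_1[OF g_dist finite_A a_in_A]
    by auto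
  have "(sqrt (f a) - sqrt (g a))\<^sup>2 \<le> (\<Sum>a\<in>A. (sqrt (f a) - sqrt (g a))\<^sup>2)"
    using finite_A a_in_A by (intro member_le_sum) auto
  also have "\<dots> \<le> relent f g A" by (rule hellinger_le_relent[OF f_dist g_dist abs_cont])
  finally have diff_le: "\<bar>sqrt (f a) - sqrt (g a)\<bar> \<le> sqrt (relent f g A)"
    by (intro real_le_rsqrt) simp
  have "sqrt (f a) \<le> 1" "sqrt (g a) \<le> 1" using le_1 by simp_all
  then have sum_le_2: "sqrt (f a) + sqrt (g a) \<le> 2" by linarith
  have "f a - g a = (sqrt (f a) - sqrt (g a)) * (sqrt (f a) + sqrt (g a))"
    using nonneg by (simp add: algebra_simps)
  then have "\<bar>f a - g a\<bar> = \<bar>sqrt (f a) - sqrt (g a)\<bar> * (sqrt (f a) + sqrt (g a))"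
    using nonneg by (simp add: abs_mult)
  also have "\<dots> \<le> sqrt (relent f g A) * 2"
    using nonneg relent_nonneg[OF f_dist g_dist abs_cont] by (intro mult_mono diff_le sum_le_2) auto
  finally show ?thesis by simp
qed

section \<open>The covert capacity\<close>

definition chi_form :: "nat \<Rightarrow> (nat \<Rightarrow> 'z::finite \<Rightarrow> real) \<Rightarrow> (nat \<Rightarrow> real) \<Rightarrow> real" where
  "chi_form K Q b = (\<Sum>z\<in>UNIV. (\<Sum>k=1..K. b k * (Q k z - Q 0 z))\<^sup>2 / Q 0 z)"

definition weighted_relent :: "nat \<Rightarrow> (nat \<Rightarrow> 'y::finite \<Rightarrow> real) \<Rightarrow> (nat \<Rightarrow> real) \<Rightarrow> real" where
  "weighted_relent K W b = (\<Sum>k=1..K. b k * relent (W k) (W 0) UNIV)"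

definition dominated :: "nat \<Rightarrow> (nat \<Rightarrow> 'y::finite \<Rightarrow> real) \<Rightarrow> bool" where
  "dominated K W \<longleftrightarrow> stochastic {0..K} UNIV W \<and> (\<forall>k\<le>K. abs_cont (W k) (W 0))"

lemma dominated_stochastic: "dominated K W \<Longrightarrow> stochastic {0..K} UNIV W"
  by (simp add: dominated_def)

lemma dominated_abs_cont: "dominated K W \<Longrightarrow> k \<le> K \<Longrightarrow> abs_cont (W k) (W 0)"
  by (simp add: dominated_def)

lemma dominatedI:
  "stochastic {0..K} UNIV W \<Longrightarrow> \<forall>k\<in>{1..K}. abs_cont (W k) (W 0) \<Longrightarrow> dominated K W"
  unfolding dominated_def abs_cont_def by (metis atLeastAtMost_iff less_one linorder_not_less)

lemma dominated_relent_nonneg: "dominated K W \<Longrightarrow> k \<le> K \<Longrightarrow> 0 \<le> relent (W k) (W 0) UNIV"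
  unfolding dominated_def stochastic_def by (intro relent_nonneg) auto

lemma sum_0_to_K: "(\<Sum>k=0..K. f k) = f 0 + (\<Sum>k=1..K. f k)" for f :: "nat \<Rightarrow> real"
  by (simp add: sum.atLeast_Suc_atMost)

lemma sum_weighted_relent: "(\<Sum>k=0..K. b k * relent (W k) (W 0) UNIV) = weighted_relent K W b"
  by (simp only: sum_0_to_K[of "\<lambda>k. b k * relent (W k) (W 0) UNIV"] weighted_relent_def relent_self
      mult_zero_right add_0)

lemma weighted_relent_cmult: "weighted_relent K W (\<lambda>k. t * b k) = t * weighted_relent K W b"
  by (simp add: weighted_relent_def sum_distrib_left mult.assoc)

lemma weighted_relent_nonneg:
  assumes "dominated K W" "\<And>k. k \<in> {1..K} \<Longrightarrow> 0 \<le> b k"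
  shows "0 \<le> weighted_relent K W b"
  unfolding weighted_relent_def using assms by (auto intro!: sum_nonneg simp: dominated_relent_nonneg)

lemma chi_form_cmult: "chi_form K Q (\<lambda>k. t * b k) = t\<^sup>2 * chi_form K Q b"
  by (simp add: chi_form_def mult.assoc power_mult_distrib flip: sum_distrib_left times_divide_eq_right)

lemma chi_form_nonneg: "stochastic {0..K} UNIV Q \<Longrightarrow> 0 \<le> chi_form K Q b"
  unfolding chi_form_def
  by (auto intro!: sum_nonneg divide_nonneg_nonneg stochastic_nonneg[of "{0..K}" UNIV Q])

lemma mixture_input_dist:
  fixes p :: "nat \<Rightarrow> real"
  assumes "prob_dist {0..K} p"
  shows "mixture {0..K} p W y = W 0 y + (\<Sum>k=1..K. p k * (W k y - W 0 y))"
proof -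
  have p_0_eq: "p 0 = 1 - (\<Sum>k=1..K. p k)"
    using prob_dist_sum[OF assms] sum_0_to_K[of p K] by simp
  show ?thesis
    unfolding mixture_def sum_0_to_K[of "\<lambda>k. p k * W k y"] p_0_eq
    by (simp add: algebra_simps sum_subtractf sum_distrib_left)
qed

lemma chi2_mixture: "prob_dist {0..K} p \<Longrightarrow> chi2 (mixture {0..K} p Q) (Q 0) = chi_form K Q p"
  by (simp add: chi2_def chi_form_def mixture_input_dist)

lemma covert_cap_eq_SUP:
  "covert_cap K W Q = (SUP p\<in>prob_vecs K. sqrt (2 * (weighted_relent K W p)\<^sup>2 / chi_form K Q p))"
proof -
  have "chi2 (\<lambda>z. \<Sum>k=1..K. p k * Q k z) (Q 0) = chi_form K Q p" if "p \<in> prob_vecs K" for p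
    using that unfolding chi2_def chi_form_def prob_vecs_def
    by (simp add: right_diff_distrib sum_subtractf flip: sum_distrib_right)
  then show ?thesis
    unfolding covert_cap_def weighted_relent_def by (intro arg_cong[where f = Sup] image_cong refl) simp
qed

lemma prob_vecs_le_1: "p \<in> prob_vecs K \<Longrightarrow> k \<in> {1..K} \<Longrightarrow> p k \<le> 1"
  using member_le_sum[of k "{1..K}" p] by (auto simp: prob_vecs_def)

lemma of_bool_in_prob_vecs: "k \<in> {1..K} \<Longrightarrow> (\<lambda>j. of_bool (j = k)) \<in> prob_vecs K"
  by (simp add: prob_vecs_def of_bool_def)

lemma convex_hull_eq_prob_vecs:
  fixes v :: "nat \<Rightarrow> 'a::real_vector"
  shows "convex hull (v ` {1..K}) = (\<lambda>p. \<Sum>k=1..K. p k *\<^sub>R v k) ` prob_vecs K" (is "_ = ?T")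
proof
  have "v ` {1..K} \<subseteq> ?T"
  proof (intro image_subsetI image_eqI)
    fix k assume k_range: "k \<in> {1..K}"
    then show "v k = (\<Sum>j=1..K. of_bool (j = k) *\<^sub>R v j)"
      by (simp add: of_bool_def if_distrib[of "\<lambda>c. c *\<^sub>R _"] cong: if_cong)
    show "(\<lambda>j. of_bool (j = k)) \<in> prob_vecs K"
      by (rule of_bool_in_prob_vecs[OF k_range])
  qed
  moreover have "convex ?T"
  proof (rule convexI)
    fix x y and s t :: real
    assume "x \<in> ?T" "y \<in> ?T" and weights: "0 \<le> s" "0 \<le> t" "s + t = 1"
    then obtain p q where x_eq: "p \<in> prob_vecs K" "x = (\<Sum>k=1..K. p k *\<^sub>R v k)"
      and y_eq: "q \<in> prob_vecs K" "y = (\<Sum>k=1..K. q k *\<^sub>R v k)" by blast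
    have "(\<lambda>k. s * p k + t * q k) \<in> prob_vecs K"
      using x_eq(1) y_eq(1) weights by (auto simp: prob_vecs_def sum.distrib simp flip: sum_distrib_left)
    moreover have "s *\<^sub>R x + t *\<^sub>R y = (\<Sum>k=1..K. (s * p k + t * q k) *\<^sub>R v k)"
      by (simp add: x_eq y_eq scaleR_left_distrib sum.distrib scaleR_right.sum)
    ultimately show "s *\<^sub>R x + t *\<^sub>R y \<in> ?T"
      by (intro image_eqI[where x = "\<lambda>k. s * p k + t * q k"])
  qed
  ultimately show "convex hull (v ` {1..K}) \<subseteq> ?T" by (rule hull_minimal)
  show "?T \<subseteq> convex hull (v ` {1..K})"
  proof (rule image_subsetI)
    fix p assume "p \<in> prob_vecs K"
    then show "(\<Sum>k=1..K. p k *\<^sub>R v k) \<in> convex hull (v ` {1..K})"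
      by (intro convex_sum[OF _ convex_convex_hull]) (simp_all add: prob_vecs_def hull_inc)
  qed
qed

locale warden =
  fixes K :: nat and Q :: "nat \<Rightarrow> 'z::finite \<Rightarrow> real"
  assumes K_pos: "1 \<le> K" and stochastic_Q: "stochastic {0..K} UNIV Q" and Q0_pos: "0 < Q 0 z"
    and not_redundant: "\<not> (\<exists>p\<in>prob_vecs K. \<forall>z. Q 0 z = (\<Sum>k=1..K. p k * Q k z))"
begin

lemma Q0_dist: "prob_dist UNIV (Q 0)"
  using stochastic_Q by (simp add: stochastic_def)

lemma chi_form_bounded_below:
  obtains m where "0 < m" "\<And>p. p \<in> prob_vecs K \<Longrightarrow> m \<le> chi_form K Q p"
proof -
  define v where "v k = (\<chi> z. Q k z)" for k
  have "v 0 \<notin> convex hull (v ` {1..K})"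
    unfolding convex_hull_eq_prob_vecs
  proof
    assume "v 0 \<in> (\<lambda>p. \<Sum>k=1..K. p k *\<^sub>R v k) ` prob_vecs K"
    then obtain p where v0_eq: "p \<in> prob_vecs K" "v 0 = (\<Sum>k=1..K. p k *\<^sub>R v k)" by blast
    have "Q 0 z = (\<Sum>k=1..K. p k * Q k z)" for z
      using arg_cong[OF v0_eq(2), of "\<lambda>x. x $ z"] by (simp add: v_def)
    then show False using not_redundant v0_eq(1) by blast
  qed
  moreover have "closed (convex hull (v ` {1..K}))"
    by (simp add: finite_imp_compact_convex_hull compact_imp_closed)
  ultimately have "\<exists>d>0. \<forall>x\<in>convex hull (v ` {1..K}). d \<le> dist (v 0) x"
    by (intro separate_point_closed)
  then obtain d where separation: "0 < d" "\<And>x. x \<in> convex hull (v ` {1..K}) \<Longrightarrow> d \<le> dist (v 0) x"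
    by blast
  have "d\<^sup>2 \<le> chi_form K Q p" if p_prob_vec: "p \<in> prob_vecs K" for p
  proof -
    let ?x = "\<Sum>k=1..K. p k *\<^sub>R v k"
    have "?x - v 0 = (\<chi> z. \<Sum>k=1..K. p k * (Q k z - Q 0 z))"
      using p_prob_vec by (simp add: v_def vec_eq_iff right_diff_distrib sum_subtractf prob_vecs_def
          flip: sum_distrib_right)
    then have "(norm (?x - v 0))\<^sup>2 = (\<Sum>z\<in>UNIV. (\<Sum>k=1..K. p k * (Q k z - Q 0 z))\<^sup>2)"
      by (simp add: norm_vec_def L2_set_def sum_nonneg)
    also have "\<dots> \<le> chi_form K Q p"
      unfolding chi_form_def using Q0_pos prob_dist_le_1[OF Q0_dist]
      by (intro sum_mono) (simp add: pos_le_divide_eq mult_left_le)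
    finally have "(norm (?x - v 0))\<^sup>2 \<le> chi_form K Q p" .
    moreover have "d \<le> norm (?x - v 0)"
      using separation(2)[of ?x] p_prob_vec unfolding convex_hull_eq_prob_vecs
      by (auto simp: dist_norm norm_minus_commute)
    then have "d\<^sup>2 \<le> (norm (?x - v 0))\<^sup>2" using separation(1) by (intro power_mono) auto
    ultimately show ?thesis by linarith
  qed
  then show thesis using separation(1) by (intro that[of "d\<^sup>2"]) auto
qed

end

locale covert_channel = warden K Q for K and Q :: "nat \<Rightarrow> 'z::finite \<Rightarrow> real" +
  fixes W :: "nat \<Rightarrow> 'y::finite \<Rightarrow> real"
  assumes dominated_W: "dominated K W"
begin

abbreviation cap :: real where
  "cap \<equiv> covert_cap K W Q"

lemma chi_form_pos: "p \<in> prob_vecs K \<Longrightarrow> 0 < chi_form K Q p"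
  using chi_form_bounded_below by (metis less_le_trans)

lemma prob_vecs_nonempty: "prob_vecs K \<noteq> {}"
  using of_bool_in_prob_vecs[of 1 K] K_pos by auto

lemma covert_cap_bdd_above:
  "bdd_above ((\<lambda>p. sqrt (2 * (weighted_relent K W p)\<^sup>2 / chi_form K Q p)) ` prob_vecs K)"
proof -
  obtain m where chi_form_ge: "0 < m" "\<And>p. p \<in> prob_vecs K \<Longrightarrow> m \<le> chi_form K Q p"
    using chi_form_bounded_below by blast
  define D where "D = (\<Sum>k=1..K. relent (W k) (W 0) UNIV)"
  have "sqrt (2 * (weighted_relent K W p)\<^sup>2 / chi_form K Q p) \<le> sqrt (2 * D\<^sup>2 / m)"
    if p_prob_vec: "p \<in> prob_vecs K" for p
  proof -
    have "0 \<le> weighted_relent K W p"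
      using p_prob_vec by (intro weighted_relent_nonneg dominated_W) (auto simp: prob_vecs_def)
    moreover have "weighted_relent K W p \<le> D"
      unfolding weighted_relent_def D_def
      using p_prob_vec prob_vecs_le_1[OF p_prob_vec] dominated_relent_nonneg[OF dominated_W]
      by (intro sum_mono mult_left_le_one_le) (auto simp: prob_vecs_def)
    ultimately show ?thesis using chi_form_ge(1) chi_form_ge(2)[OF p_prob_vec]
      by (intro real_sqrt_le_mono frac_le mult_left_mono power_mono) auto
  qed
  then show ?thesis by (intro bdd_aboveI2)
qed

lemma covert_cap_upper:
  assumes p_prob_vec: "p \<in> prob_vecs K"
  shows "weighted_relent K W p \<le> cap * sqrt (chi_form K Q p / 2)"
proof -
  have pos: "0 < chi_form K Q p" by (rule chi_form_pos[OF p_prob_vec])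
  have "weighted_relent K W p \<le> sqrt ((weighted_relent K W p)\<^sup>2)" by simp
  also have "\<dots> = sqrt (2 * (weighted_relent K W p)\<^sup>2 / chi_form K Q p) * sqrt (chi_form K Q p / 2)"
    using pos by (simp flip: real_sqrt_mult)
  also have "\<dots> \<le> cap * sqrt (chi_form K Q p / 2)"
    unfolding covert_cap_eq_SUP using pos
    by (intro mult_right_mono cSUP_upper[OF p_prob_vec covert_cap_bdd_above]) auto
  finally show ?thesis .
qed

lemma covert_cap_nonneg: "0 \<le> cap"
proof -
  obtain p where p_prob_vec: "p \<in> prob_vecs K" using prob_vecs_nonempty by blast
  have "0 \<le> sqrt (2 * (weighted_relent K W p)\<^sup>2 / chi_form K Q p)"
    using chi_form_pos[OF p_prob_vec] by simp
  also have "\<dots> \<le> cap"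
    unfolding covert_cap_eq_SUP by (rule cSUP_upper[OF p_prob_vec covert_cap_bdd_above])
  finally show ?thesis .
qed

lemma weighted_relent_le_covert_cap:
  assumes b_nonneg: "\<And>k. k \<in> {1..K} \<Longrightarrow> 0 \<le> b k"
  shows "weighted_relent K W b \<le> cap * sqrt (chi_form K Q b / 2)"
proof (cases "sum b {1..K} = 0")
  case True
  then have "\<forall>k\<in>{1..K}. b k = 0" using b_nonneg sum_nonneg_eq_0_iff[of "{1..K}" b] by blast
  then show ?thesis
    by (simp add: weighted_relent_def covert_cap_nonneg chi_form_nonneg[OF stochastic_Q])
next
  case False
  define a where "a = sum b {1..K}"
  have a_pos: "0 < a" using False sum_nonneg[of "{1..K}" b, OF b_nonneg] unfolding a_def by linarith
  define p where "p k = b k / a" for k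
  have p_prob_vec: "p \<in> prob_vecs K"
    using a_pos b_nonneg by (auto simp: prob_vecs_def p_def a_def simp flip: sum_divide_distrib)
  have b_eq: "b = (\<lambda>k. a * p k)" using a_pos by (simp add: p_def)
  have "a * weighted_relent K W p \<le> a * (cap * sqrt (chi_form K Q p / 2))"
    using covert_cap_upper[OF p_prob_vec] a_pos by (intro mult_left_mono) auto
  then show ?thesis
    unfolding b_eq weighted_relent_cmult chi_form_cmult using a_pos
    by (simp add: real_sqrt_mult real_sqrt_divide mult_ac)
qed

lemma covert_cap_direction:
  assumes L_bounds: "0 \<le> L" "L < cap" and \<delta>_pos: "0 < \<delta>"
  obtains \<beta> where "\<And>k. k \<in> {1..K} \<Longrightarrow> 0 \<le> \<beta> k" "chi_form K Q \<beta> / 2 < \<delta>" "L * sqrt \<delta> < weighted_relent K W \<beta>"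
proof -
  obtain p where p_prob_vec: "p \<in> prob_vecs K"
    and L_less: "L < sqrt (2 * (weighted_relent K W p)\<^sup>2 / chi_form K Q p)"
    using L_bounds(2) less_cSUP_iff[OF prob_vecs_nonempty covert_cap_bdd_above, of L]
    unfolding covert_cap_eq_SUP by blast
  define D where "D = weighted_relent K W p"
  define x where "x = chi_form K Q p"
  have x_pos: "0 < x" unfolding x_def by (rule chi_form_pos[OF p_prob_vec])
  have p_nonneg: "0 \<le> p k" if "k \<in> {1..K}" for k using p_prob_vec that by (auto simp: prob_vecs_def)
  have D_nonneg: "0 \<le> D" unfolding D_def using p_nonneg by (intro weighted_relent_nonneg dominated_W)
  have "L * sqrt (x / 2) < sqrt (2 * D\<^sup>2 / x) * sqrt (x / 2)"
    using L_less x_pos unfolding D_def x_def by (intro mult_strict_right_mono) auto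
  also have "\<dots> = D" using x_pos D_nonneg by (simp flip: real_sqrt_mult)
  finally have scaled_L_less: "L * sqrt (x / 2) < D" .
  moreover have "0 \<le> L * sqrt (x / 2)" using L_bounds(1) x_pos by simp
  ultimately have D_pos: "0 < D" by linarith
  have "L * sqrt \<delta> / D < sqrt (2 * \<delta> / x)"
    using scaled_L_less D_pos x_pos \<delta>_pos by (simp add: real_sqrt_mult real_sqrt_divide field_simps)
  then obtain s where s_between: "L * sqrt \<delta> / D < s" "s < sqrt (2 * \<delta> / x)" using dense by blast
  have "0 \<le> L * sqrt \<delta> / D" using L_bounds(1) D_pos \<delta>_pos by simp
  then have s_pos: "0 < s" using s_between(1) by linarith
  show thesis
  proof (rule that[of "\<lambda>k. s * p k"])
    have "s\<^sup>2 < (sqrt (2 * \<delta> / x))\<^sup>2" using s_between(2) s_pos by (intro power_strict_mono) auto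
    then show "chi_form K Q (\<lambda>k. s * p k) / 2 < \<delta>"
      using x_pos \<delta>_pos by (simp add: chi_form_cmult x_def[symmetric] pos_less_divide_eq)
    show "L * sqrt \<delta> < weighted_relent K W (\<lambda>k. s * p k)"
      using s_between(1) D_pos by (simp add: weighted_relent_cmult D_def[symmetric] pos_divide_less_eq)
  qed (use p_nonneg s_pos in auto)
qed

end

section \<open>Asymptotics of the covertness constraint\<close>

context warden
begin

abbreviation output_relent :: "(nat \<Rightarrow> real) \<Rightarrow> real" where
  "output_relent p \<equiv> relent (mixture {0..K} p Q) (Q 0) UNIV"

lemma abs_cont_Q0: "abs_cont f (Q 0)"
  using less_imp_neq[OF Q0_pos] by (simp add: abs_cont_def)

lemma output_relent_nonneg: "prob_dist {0..K} p \<Longrightarrow> 0 \<le> output_relent p"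
  by (intro relent_nonneg prob_dist_mixture stochastic_Q Q0_dist abs_cont_Q0)

lemma output_ratio_le:
  obtains C where "\<And>p z. prob_dist {0..K} p \<Longrightarrow> \<bar>mixture {0..K} p Q z / Q 0 z - 1\<bar> \<le> C * sqrt (output_relent p)"
proof -
  define m where "m = Min (range (Q 0))"
  have m_le: "0 < m" "m \<le> Q 0 z" for z using Q0_pos by (auto simp: m_def)
  have "\<bar>mixture {0..K} p Q z / Q 0 z - 1\<bar> \<le> 2 / m * sqrt (output_relent p)"
    if p_dist: "prob_dist {0..K} p" for p z
  proof -
    have "\<bar>mixture {0..K} p Q z / Q 0 z - 1\<bar> = \<bar>mixture {0..K} p Q z - Q 0 z\<bar> / Q 0 z"
      using Q0_pos[of z] by (simp add: abs_if field_simps)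
    also have "\<dots> \<le> 2 * sqrt (output_relent p) / m"
      using m_le output_relent_nonneg[OF p_dist]
      by (intro frac_le abs_diff_le_sqrt_relent prob_dist_mixture[OF stochastic_Q p_dist] Q0_dist abs_cont_Q0)
          auto
    finally show ?thesis by simp
  qed
  then show thesis by (rule that)
qed

lemma chi_form_le_output_relent:
  assumes p_dist: "prob_dist {0..K} p" and near: "\<And>z. \<bar>mixture {0..K} p Q z / Q 0 z - 1\<bar> \<le> \<eta>"
    and \<eta>_less: "\<eta> < 1/4"
  shows "chi_form K Q p / 2 \<le> output_relent p / (1 - 4 * \<eta>)"
proof -
  have "\<bar>output_relent p - chi_form K Q p / 2\<bar> \<le> 2 * \<eta> * chi_form K Q p"
    unfolding chi2_mixture[OF p_dist, symmetric]
    using \<eta>_less prob_dist_sum[OF prob_dist_mixture[OF stochastic_Q p_dist]] prob_dist_sum[OF Q0_dist]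
    by (intro abs_relent_minus_half_chi2_le Q0_pos near) auto
  then have "chi_form K Q p / 2 * (1 - 4 * \<eta>) \<le> output_relent p"
    by (simp add: algebra_simps)
  then show ?thesis using \<eta>_less by (simp add: field_simps)
qed

lemma chi_form_le_covertness:
  assumes \<delta>_pos: "0 < \<delta>"
  obtains r where "r \<longlonglongrightarrow> 1"
    and "\<forall>\<^sub>F n in sequentially. 0 < r n \<and> (\<forall>p. prob_dist {0..K} p \<longrightarrow> real n * output_relent p \<le> \<delta>
      \<longrightarrow> chi_form K Q p / 2 \<le> (r n)\<^sup>2 * (\<delta> / n))"
proof -
  obtain C where ratio_le: "\<And>p z. prob_dist {0..K} p \<Longrightarrow> \<bar>mixture {0..K} p Q z / Q 0 z - 1\<bar>
      \<le> C * sqrt (output_relent p)"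
    using output_ratio_le by blast
  define \<eta> where "\<eta> n = \<bar>C\<bar> * sqrt (\<delta> / real n)" for n
  have \<eta>_lim: "\<eta> \<longlonglongrightarrow> 0" unfolding \<eta>_def using \<delta>_pos by real_asymp
  define r where "r n = 1 / sqrt (1 - 4 * \<eta> n)" for n
  have "r \<longlonglongrightarrow> 1 / sqrt (1 - 4 * 0)"
    unfolding r_def by (intro tendsto_intros \<eta>_lim) simp
  moreover have "\<forall>\<^sub>F n in sequentially. \<eta> n < 1/4"
    using \<eta>_lim by (rule order_tendstoD(2)) simp
  then have "\<forall>\<^sub>F n in sequentially. 0 < r n \<and> (\<forall>p. prob_dist {0..K} p \<longrightarrow> real n * output_relent p \<le> \<delta>
      \<longrightarrow> chi_form K Q p / 2 \<le> (r n)\<^sup>2 * (\<delta> / n))"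
    using eventually_gt_at_top[of 0]
  proof eventually_elim
    case (elim n)
    have "chi_form K Q p / 2 \<le> (r n)\<^sup>2 * (\<delta> / n)"
      if p_dist: "prob_dist {0..K} p" and cov: "real n * output_relent p \<le> \<delta>" for p
    proof -
      have relent_le: "output_relent p \<le> \<delta> / n"
        using cov elim by (simp add: pos_le_divide_eq mult.commute)
      have "C * sqrt (output_relent p) \<le> \<bar>C\<bar> * sqrt (\<delta> / n)"
        using output_relent_nonneg[OF p_dist] relent_le by (intro mult_mono) auto
      then have "chi_form K Q p / 2 \<le> output_relent p / (1 - 4 * \<eta> n)"
        using ratio_le[OF p_dist] elim unfolding \<eta>_def
        by (intro chi_form_le_output_relent p_dist) (auto intro: order_trans)
      also have "\<dots> \<le> \<delta> / n / (1 - 4 * \<eta> n)"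
        using relent_le elim by (intro divide_right_mono) auto
      also have "\<dots> = (r n)\<^sup>2 * (\<delta> / n)"
        using elim by (simp add: r_def power_divide)
      finally show ?thesis .
    qed
    then show ?case using elim by (simp add: r_def)
  qed
  ultimately show thesis using that[of r] by simp
qed

end

context covert_channel
begin

lemma covert_rate_le:
  assumes \<delta>_pos: "0 < \<delta>"
  obtains r where "r \<longlonglongrightarrow> 1"
    and "\<forall>\<^sub>F n in sequentially. \<forall>p. prob_dist {0..K} p \<longrightarrow> real n * output_relent p \<le> \<delta>
      \<longrightarrow> real n * weighted_relent K W p \<le> cap * r n * sqrt (real n * \<delta>)"
proof -
  obtain r where r_lim: "r \<longlonglongrightarrow> 1"
    "\<forall>\<^sub>F n in sequentially. 0 < r n \<and> (\<forall>p. prob_dist {0..K} p \<longrightarrow> real n * output_relent p \<le> \<delta>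
      \<longrightarrow> chi_form K Q p / 2 \<le> (r n)\<^sup>2 * (\<delta> / n))"
    using chi_form_le_covertness[OF \<delta>_pos] by blast
  from r_lim(2) eventually_gt_at_top[of 0]
  have "\<forall>\<^sub>F n in sequentially. \<forall>p. prob_dist {0..K} p \<longrightarrow> real n * output_relent p \<le> \<delta>
      \<longrightarrow> real n * weighted_relent K W p \<le> cap * r n * sqrt (real n * \<delta>)"
  proof eventually_elim
    case (elim n)
    have "real n * weighted_relent K W p \<le> cap * r n * sqrt (real n * \<delta>)"
      if p_dist: "prob_dist {0..K} p" and cov: "real n * output_relent p \<le> \<delta>" for p
    proof -
      have "weighted_relent K W p \<le> cap * sqrt (chi_form K Q p / 2)"
        using p_dist by (intro weighted_relent_le_covert_cap) (simp add: prob_dist_def)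
      also have "\<dots> \<le> cap * sqrt ((r n)\<^sup>2 * (\<delta> / n))"
        using elim p_dist cov by (intro mult_left_mono real_sqrt_le_mono covert_cap_nonneg) blast
      also have "\<dots> = cap * r n * sqrt (\<delta> / n)"
        unfolding real_sqrt_mult using elim by simp
      finally have "real n * weighted_relent K W p \<le> real n * (cap * r n * sqrt (\<delta> / n))"
        by (intro mult_left_mono) auto
      also have "\<dots> = cap * r n * (real n * sqrt (\<delta> / n))" by simp
      also have "real n * sqrt (\<delta> / n) = sqrt (real n * \<delta>)"
        using elim by (simp add: real_sqrt_divide real_sqrt_mult field_simps)
      finally show ?thesis .
    qed
    then show ?case by blast
  qed
  then show thesis using r_lim(1) that by blast
qed

end

lemma weighted_Liminf_le:
  fixes x y e u :: "nat \<Rightarrow> real"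
  assumes x_Liminf: "ereal L1 \<le> Liminf sequentially (\<lambda>n. ereal (x n))"
    and y_Liminf: "ereal L2 \<le> Liminf sequentially (\<lambda>n. ereal (y n))"
    and e_Limsup: "Limsup sequentially (\<lambda>n. ereal (e n)) \<le> ereal \<epsilon>" and \<epsilon>_less_1: "\<epsilon> < 1"
    and c_nonneg: "0 \<le> c"
    and nonneg: "\<And>n. 0 \<le> x n" "\<And>n. 0 \<le> y n"
    and bound: "\<forall>\<^sub>F n in sequentially. (1 - e n) * (c * x n + y n) \<le> u n" and u_lim: "u \<longlonglongrightarrow> B"
  shows "(1 - \<epsilon>) * (c * L1 + L2) \<le> B"
proof -
  have "(1 - \<epsilon> - \<tau>) * (c * (L1 - \<tau>) + (L2 - \<tau>)) \<le> B" if \<tau>_bounds: "0 < \<tau>" "\<tau> < 1 - \<epsilon>" for \<tau>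
  proof (rule tendsto_lowerbound[OF u_lim])
    have "\<forall>\<^sub>F n in sequentially. L1 - \<tau> < x n" "\<forall>\<^sub>F n in sequentially. L2 - \<tau> < y n"
      "\<forall>\<^sub>F n in sequentially. e n < \<epsilon> + \<tau>"
      using \<tau>_bounds less_LiminfD[of "ereal (L1 - \<tau>)" sequentially "\<lambda>n. ereal (x n)"]
        less_LiminfD[of "ereal (L2 - \<tau>)" sequentially "\<lambda>n. ereal (y n)"]
        Limsup_lessD[of sequentially "\<lambda>n. ereal (e n)" "ereal (\<epsilon> + \<tau>)"]
        order_less_le_trans[OF _ x_Liminf, of "ereal (L1 - \<tau>)"]
            order_less_le_trans[OF _ y_Liminf, of "ereal (L2 - \<tau>)"]
        order_le_less_trans[OF e_Limsup, of "ereal (\<epsilon> + \<tau>)"] by simp_all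
    then show "\<forall>\<^sub>F n in sequentially. (1 - \<epsilon> - \<tau>) * (c * (L1 - \<tau>) + (L2 - \<tau>)) \<le> u n"
      using bound
    proof eventually_elim
      case (elim n)
      have "(1 - \<epsilon> - \<tau>) * (c * (L1 - \<tau>) + (L2 - \<tau>)) \<le> (1 - \<epsilon> - \<tau>) * (c * x n + y n)"
        using elim c_nonneg \<tau>_bounds by (intro mult_left_mono add_mono) auto
      also have "\<dots> \<le> (1 - e n) * (c * x n + y n)"
        using elim c_nonneg nonneg by (intro mult_right_mono) auto
      finally show ?case using elim by linarith
    qed
  qed simp
  then have "\<forall>\<^sub>F \<tau> in at_right 0. (1 - \<epsilon> - \<tau>) * (c * (L1 - \<tau>) + (L2 - \<tau>)) \<le> B"
    unfolding eventually_at_right_field using \<epsilon>_less_1 by (intro exI[of _ "1 - \<epsilon>"]) auto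
  moreover have "((\<lambda>\<tau>. (1 - \<epsilon> - \<tau>) * (c * (L1 - \<tau>) + (L2 - \<tau>)))
      \<longlongrightarrow> (1 - \<epsilon> - 0) * (c * (L1 - 0) + (L2 - 0))) (at_right 0)"
    by (intro tendsto_intros)
  ultimately have "(1 - \<epsilon> - 0) * (c * (L1 - 0) + (L2 - 0)) \<le> B"
    by (intro tendsto_upperbound[OF _ _ trivial_limit_at_right_real])
  then show ?thesis by simp
qed

section \<open>Codes for the broadcast channel\<close>

declare One_nat_def [simp del]

lemma stochastic_chanW: "bc_channel K P \<Longrightarrow> stochastic {0..K} UNIV (chanW P)"
  by (auto simp: bc_channel_def stochastic_def prob_dist_def chanW_def intro!: sum_nonneg)

definition swap_users :: "('x \<Rightarrow> 'y1 \<Rightarrow> 'y2 \<Rightarrow> 'z \<Rightarrow> real) \<Rightarrow> 'x \<Rightarrow> 'y2 \<Rightarrow> 'y1 \<Rightarrow> 'z \<Rightarrow> real" where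
  "swap_users P x y2 y1 = P x y1 y2"

lemma chanW_swap_users: "chanW (swap_users P) = chanV P"
  and chanV_swap_users: "chanV (swap_users P) = chanW P"
  by (simp_all add: fun_eq_iff chanW_def chanV_def swap_users_def)

lemma chanQ_swap_users: "chanQ (swap_users P) = chanQ P"
  unfolding chanQ_def[abs_def] swap_users_def by (intro ext sum.swap)

lemma bc_channel_swap_users:
  fixes P :: "nat \<Rightarrow> 'y1::finite \<Rightarrow> 'y2::finite \<Rightarrow> 'z::finite \<Rightarrow> real"
  assumes "bc_channel K P"
  shows "bc_channel K (swap_users P)"
proof -
  have "(\<Sum>y2\<in>UNIV. \<Sum>y1\<in>UNIV. \<Sum>z\<in>UNIV. P x y1 y2 z) = (\<Sum>y1\<in>UNIV. \<Sum>y2\<in>UNIV. \<Sum>z\<in>UNIV. P x y1 y2 z)" for x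
    by (rule sum.swap)
  then show ?thesis
    using assms by (simp add: bc_channel_def swap_users_def)
qed

lemma stochastic_chanV: "bc_channel K P \<Longrightarrow> stochastic {0..K} UNIV (chanV P)"
  using stochastic_chanW[OF bc_channel_swap_users] by (simp add: chanW_swap_users)

lemma stochastic_chanQ:
  fixes P :: "nat \<Rightarrow> 'y1::finite \<Rightarrow> 'y2::finite \<Rightarrow> 'z::finite \<Rightarrow> real"
  assumes "bc_channel K P"
  shows "stochastic {0..K} UNIV (chanQ P)"
proof -
  have "(\<Sum>z\<in>UNIV. chanQ P x z) = (\<Sum>y1\<in>UNIV. \<Sum>y2\<in>UNIV. \<Sum>z\<in>UNIV. P x y1 y2 z)" for x
    unfolding chanQ_def by (subst sum.swap, intro sum.cong refl sum.swap)
  then show ?thesis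
    using assms by (auto simp: bc_channel_def stochastic_def prob_dist_def chanQ_def intro!: sum_nonneg)
qed

definition joint_error :: "('x \<Rightarrow> 'y1::finite \<Rightarrow> 'y2::finite \<Rightarrow> 'z::finite \<Rightarrow> real) \<Rightarrow> nat \<Rightarrow> 'x list \<Rightarrow>
    ('y1 list \<Rightarrow> 'm1) \<Rightarrow> ('y2 list \<Rightarrow> 'm2) \<Rightarrow> 'm1 \<Rightarrow> 'm2 \<Rightarrow> real" where
  "joint_error P n xs d1 d2 w1 w2 =
     (\<Sum>y1s\<in>nlists n UNIV. \<Sum>y2s\<in>nlists n UNIV. \<Sum>zs\<in>nlists n UNIV.
        (\<Prod>i<n. P (xs ! i) (y1s ! i) (y2s ! i) (zs ! i)) * of_bool (d1 y1s \<noteq> w1 \<or> d2 y2s \<noteq> w2))"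

lemma joint_error_swap_users: "joint_error (swap_users P) n xs d2 d1 w2 w1 = joint_error P n xs d1 d2 w1 w2"
  unfolding joint_error_def swap_users_def by (subst sum.swap) (simp add: disj_commute)

lemma sum_joint_eq_memoryless:
  fixes P :: "nat \<Rightarrow> 'y1::finite \<Rightarrow> 'y2::finite \<Rightarrow> 'z::finite \<Rightarrow> real"
  assumes "length xs = n"
  shows "(\<Sum>y2s\<in>nlists n UNIV. \<Sum>zs\<in>nlists n UNIV. \<Prod>i<n. P (xs ! i) (y1s ! i) (y2s ! i) (zs ! i))
      = memoryless (chanW P) xs y1s"
proof -
  have "(\<Sum>zs\<in>nlists n UNIV. \<Prod>i<n. P (xs ! i) (y1s ! i) (y2s ! i) (zs ! i))
      = (\<Prod>i<n. \<Sum>z\<in>UNIV. P (xs ! i) (y1s ! i) (y2s ! i) z)" for y2s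
    by (rule sum_nlists_product_dist[unfolded product_dist_def])
  then show ?thesis
    using sum_nlists_product_dist[of n "\<lambda>i y2. \<Sum>z\<in>UNIV. P (xs ! i) (y1s ! i) y2 z" UNIV]
    by (simp add: assms memoryless_def chanW_def product_dist_def)
qed

lemma decoding_error_eq_sum_joint:
  fixes P :: "nat \<Rightarrow> 'y1::finite \<Rightarrow> 'y2::finite \<Rightarrow> 'z::finite \<Rightarrow> real"
  assumes "length xs = n"
  shows "decoding_error (nlists n UNIV) (memoryless (chanW P) xs) d w
    = (\<Sum>y1s\<in>nlists n UNIV. \<Sum>y2s\<in>nlists n UNIV. \<Sum>zs\<in>nlists n UNIV.
        (\<Prod>i<n. P (xs ! i) (y1s ! i) (y2s ! i) (zs ! i)) * of_bool (d y1s \<noteq> w))"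
  unfolding decoding_error_def sum_joint_eq_memoryless[OF assms, symmetric] sum_distrib_right ..

lemma joint_prob_nonneg:
  assumes "bc_channel K P" "xs \<in> nlists n {0..K}"
  shows "0 \<le> (\<Prod>i<n. P (xs ! i) (y1s ! i) (y2s ! i) (zs ! i))"
  using assms(1) nlistsE_nth_in[OF assms(2)] by (intro prod_nonneg) (auto simp: bc_channel_def)

lemma decoding_error_le_joint_error:
  assumes bc_channel_P: "bc_channel K P" and xs_word: "xs \<in> nlists n {0..K}"
  shows "decoding_error (nlists n UNIV) (memoryless (chanW P) xs) d1 w1 \<le> joint_error P n xs d1 d2 w1 w2"
  unfolding decoding_error_eq_sum_joint[OF nlistsE_length[OF xs_word]] joint_error_def
  by (intro sum_mono mult_left_mono joint_prob_nonneg[OF bc_channel_P xs_word]) simp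

lemma joint_error_le:
  assumes bc_channel_P: "bc_channel K P" and xs_word: "xs \<in> nlists n {0..K}"
  shows "joint_error P n xs d1 d2 w1 w2
    \<le> decoding_error (nlists n UNIV) (memoryless (chanW P) xs) d1 w1
      + decoding_error (nlists n UNIV) (memoryless (chanV P) xs) d2 w2"
proof -
  let ?p = "\<lambda>y1s y2s zs. \<Prod>i<n. P (xs ! i) (y1s ! i) (y2s ! i) (zs ! i)"
  have "decoding_error (nlists n UNIV) (memoryless (chanV P) xs) d2 w2
      = (\<Sum>y1s\<in>nlists n UNIV. \<Sum>y2s\<in>nlists n UNIV. \<Sum>zs\<in>nlists n UNIV. ?p y1s y2s zs * of_bool (d2 y2s \<noteq> w2))"
    using decoding_error_eq_sum_joint[OF nlistsE_length[OF xs_word], of "swap_users P" d2 w2]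
    unfolding chanW_swap_users swap_users_def by (subst sum.swap)
  then have "decoding_error (nlists n UNIV) (memoryless (chanW P) xs) d1 w1
      + decoding_error (nlists n UNIV) (memoryless (chanV P) xs) d2 w2
    = (\<Sum>y1s\<in>nlists n UNIV. \<Sum>y2s\<in>nlists n UNIV. \<Sum>zs\<in>nlists n UNIV.
        ?p y1s y2s zs * (of_bool (d1 y1s \<noteq> w1) + of_bool (d2 y2s \<noteq> w2)))"
    by (simp only: decoding_error_eq_sum_joint[OF nlistsE_length[OF xs_word]] sum.distrib distrib_left)
  also have "\<dots> \<ge> joint_error P n xs d1 d2 w1 w2"
    unfolding joint_error_def
    by (intro sum_mono mult_left_mono joint_prob_nonneg[OF bc_channel_P xs_word]) simp
  finally show ?thesis .
qed

abbreviation code_index :: "nat \<Rightarrow> nat \<Rightarrow> nat \<Rightarrow> (nat \<times> nat \<times> nat) set" where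
  "code_index M1 M2 Kn \<equiv> {1..M1} \<times> {1..M2} \<times> {1..Kn}"

definition user1_error :: "('x \<Rightarrow> 'y::finite \<Rightarrow> real) \<Rightarrow> nat \<Rightarrow> nat \<Rightarrow> nat \<Rightarrow> nat \<Rightarrow>
    (nat \<Rightarrow> nat \<Rightarrow> nat \<Rightarrow> 'x list) \<Rightarrow> ('y list \<Rightarrow> nat \<Rightarrow> nat) \<Rightarrow> real" where
  "user1_error W n M1 M2 Kn enc dec = avg (code_index M1 M2 Kn)
     (\<lambda>(w1, w2, s). decoding_error (nlists n UNIV) (memoryless W (enc w1 w2 s)) (\<lambda>ys. dec ys s) w1)"

definition user2_error :: "('x \<Rightarrow> 'y::finite \<Rightarrow> real) \<Rightarrow> nat \<Rightarrow> nat \<Rightarrow> nat \<Rightarrow> nat \<Rightarrow>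
    (nat \<Rightarrow> nat \<Rightarrow> nat \<Rightarrow> 'x list) \<Rightarrow> ('y list \<Rightarrow> nat \<Rightarrow> nat) \<Rightarrow> real" where
  "user2_error V n M1 M2 Kn enc dec = avg (code_index M1 M2 Kn)
     (\<lambda>(w1, w2, s). decoding_error (nlists n UNIV) (memoryless V (enc w1 w2 s)) (\<lambda>ys. dec ys s) w2)"

lemma Collect_length_eq: "{xs. length xs = n} = nlists n UNIV"
  by (simp add: set_eq_iff in_nlists_UNIV)

lemma avg_code_index:
  "(\<Sum>w1=1..M1. \<Sum>w2=1..M2. \<Sum>s=1..Kn. f w1 w2 s) / (real M1 * real M2 * real Kn)
    = avg (code_index M1 M2 Kn) (\<lambda>(w1, w2, s). f w1 w2 s)"
  by (simp add: avg_def sum.cartesian_product' card_cartesian_product mult.assoc)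

lemma code_error_eq_avg:
  "code_error P n M1 M2 Kn enc dec1 dec2 = avg (code_index M1 M2 Kn)
     (\<lambda>(w1, w2, s). joint_error P n (enc w1 w2 s) (\<lambda>ys. dec1 ys s) (\<lambda>ys. dec2 ys s) w1 w2)"
  unfolding avg_code_index[symmetric] code_error_def joint_error_def Collect_length_eq of_bool_def ..

lemma is_code_enc:
  "is_code K n M1 M2 Kn enc dec1 dec2 \<Longrightarrow> w1 \<in> {1..M1} \<Longrightarrow> w2 \<in> {1..M2} \<Longrightarrow> s \<in> {1..Kn} \<Longrightarrow>
    enc w1 w2 s \<in> nlists n {0..K}"
  unfolding is_code_def nlists_def by blast

lemma is_code_swap_users:
  "is_code K n M1 M2 Kn enc dec1 dec2 \<Longrightarrow> is_code K n M2 M1 Kn (\<lambda>w2 w1. enc w1 w2) dec2 dec1"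
  unfolding is_code_def by blast

lemma avg_code_index_swap:
  "avg (code_index M2 M1 Kn) (\<lambda>(w2, w1, s). f w1 w2 s) = avg (code_index M1 M2 Kn) (\<lambda>(w1, w2, s). f w1 w2 s)"
  unfolding avg_Times by (simp add: avg_swap[of "{1..M2}"])

lemma code_error_swap_users:
  "code_error (swap_users P) n M2 M1 Kn (\<lambda>w2 w1. enc w1 w2) dec2 dec1 = code_error P n M1 M2 Kn enc dec1 dec2"
  unfolding code_error_eq_avg joint_error_swap_users by (rule avg_code_index_swap)

lemma covertness_eq:
  assumes "is_code K n M1 M2 Kn enc dec1 dec2"
  shows "covertness P n M1 M2 Kn enc
    = relent (\<lambda>zs. avg (code_index M1 M2 Kn) (\<lambda>(w1, w2, s). memoryless (chanQ P) (enc w1 w2 s) zs))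
        (product_dist n (\<lambda>_. chanQ P 0)) (nlists n UNIV)"
proof -
  have "warden_dist P n M1 M2 Kn enc zs
      = avg (code_index M1 M2 Kn) (\<lambda>(w1, w2, s). memoryless (chanQ P) (enc w1 w2 s) zs)" for zs
    unfolding warden_dist_def avg_code_index
  proof (intro avg_cong)
    fix w assume "w \<in> code_index M1 M2 Kn"
    then obtain w1 w2 s where "w = (w1, w2, s)" and "length (enc w1 w2 s) = n"
      using nlistsE_length[OF is_code_enc[OF assms]] by blast
    then show "(case w of (w1, w2, s) \<Rightarrow> \<Prod>i<n. chanQ P (enc w1 w2 s ! i) (zs ! i))
        = (case w of (w1, w2, s) \<Rightarrow> memoryless (chanQ P) (enc w1 w2 s) zs)"
      by (simp add: memoryless_def product_dist_def)
  qed
  then have warden_dist: "warden_dist P n M1 M2 Kn enc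
      = (\<lambda>zs. avg (code_index M1 M2 Kn) (\<lambda>(w1, w2, s). memoryless (chanQ P) (enc w1 w2 s) zs))"
    by (rule ext)
  have no_input_dist: "no_input_dist P n = product_dist n (\<lambda>_. chanQ P 0)"
    by (simp add: fun_eq_iff no_input_dist_def product_dist_def)
  show ?thesis
    unfolding covertness_def Collect_length_eq warden_dist no_input_dist ..
qed

lemma covertness_swap_users:
  "covertness (swap_users P) n M2 M1 Kn (\<lambda>w2 w1. enc w1 w2) = covertness P n M1 M2 Kn enc"
  unfolding covertness_def warden_dist_def no_input_dist_def chanQ_swap_users avg_code_index
  by (subst avg_code_index_swap) simp

lemma user1_error_le_code_error:
  assumes bc_channel_P: "bc_channel K P" and code: "is_code K n M1 M2 Kn enc dec1 dec2"
  shows "user1_error (chanW P) n M1 M2 Kn enc dec1 \<le> code_error P n M1 M2 Kn enc dec1 dec2"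
  unfolding user1_error_def code_error_eq_avg
  by (intro avg_mono) (auto intro!: decoding_error_le_joint_error[OF bc_channel_P] is_code_enc[OF code])

lemma user2_error_le_code_error:
  assumes bc_channel_P: "bc_channel K P" and code: "is_code K n M1 M2 Kn enc dec1 dec2"
  shows "user2_error (chanV P) n M1 M2 Kn enc dec2 \<le> code_error P n M1 M2 Kn enc dec1 dec2"
  using user1_error_le_code_error[OF bc_channel_swap_users[OF bc_channel_P] is_code_swap_users[OF code]]
  by (simp add: code_error_swap_users chanW_swap_users user1_error_def user2_error_def
      avg_code_index_swap[of M2 M1])

lemma code_error_le:
  assumes bc_channel_P: "bc_channel K P" and code: "is_code K n M1 M2 Kn enc dec1 dec2"
  shows "code_error P n M1 M2 Kn enc dec1 dec2
    \<le> user1_error (chanW P) n M1 M2 Kn enc dec1 + user2_error (chanV P) n M1 M2 Kn enc dec2"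
  unfolding user1_error_def user2_error_def code_error_eq_avg avg_add[symmetric]
  by (intro avg_mono) (auto intro!: joint_error_le[OF bc_channel_P] is_code_enc[OF code])

lemma achievable_swap_users:
  assumes "achievable K P \<epsilon> \<delta> L"
  shows "achievable K (swap_users P) \<epsilon> \<delta> (prod.swap L)"
proof -
  obtain M1 M2 Kn enc dec1 dec2 where code: "\<forall>n. is_code K n (M1 n) (M2 n) (Kn n) (enc n) (dec1 n) (dec2 n) \<and>
      covertness P n (M1 n) (M2 n) (Kn n) (enc n) \<le> \<delta>"
    and rates: "ereal (fst L) \<le> Liminf sequentially (\<lambda>n. ereal (ln (real (M1 n)) / sqrt (real n * \<delta>)))"
      "ereal (snd L) \<le> Liminf sequentially (\<lambda>n. ereal (ln (real (M2 n)) / sqrt (real n * \<delta>)))"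
    and error: "Limsup sequentially (\<lambda>n. ereal (code_error P n (M1 n) (M2 n) (Kn n) (enc n) (dec1 n) (dec2 n)))
        \<le> ereal \<epsilon>"
    and nonneg: "0 \<le> fst L" "0 \<le> snd L"
    using assms unfolding achievable_def by blast
  have "\<forall>n. is_code K n (M2 n) (M1 n) (Kn n) (\<lambda>w2 w1. enc n w1 w2) (dec2 n) (dec1 n) \<and>
      covertness (swap_users P) n (M2 n) (M1 n) (Kn n) (\<lambda>w2 w1. enc n w1 w2) \<le> \<delta>"
    using code by (simp add: covertness_swap_users is_code_swap_users)
  moreover have "Limsup sequentially (\<lambda>n. ereal (code_error (swap_users P) n (M2 n) (M1 n) (Kn n)
      (\<lambda>w2 w1. enc n w1 w2) (dec2 n) (dec1 n))) \<le> ereal \<epsilon>"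
    using error by (simp only: code_error_swap_users)
  ultimately show ?thesis
    unfolding achievable_def using rates nonneg by fastforce
qed

lemma covert_region_swap_users:
  assumes "L \<in> covert_region K P \<delta>"
  shows "prod.swap L \<in> covert_region K (swap_users P) \<delta>"
  unfolding covert_region_def region_eps_def
proof (rule INT_I)
  fix \<epsilon> :: real assume "\<epsilon> \<in> {0<..<1}"
  then have "L \<in> closure {L. achievable K P \<epsilon> \<delta> L}"
    using assms by (auto simp: covert_region_def region_eps_def)
  moreover have "prod.swap ` closure {L. achievable K P \<epsilon> \<delta> L}
      \<subseteq> closure {L. achievable K (swap_users P) \<epsilon> \<delta> L}"
    using closure_subset achievable_swap_users
    by (intro image_closure_subset) (fastforce simp: prod.swap_def intro!: continuous_intros)+
  ultimately show "prod.swap L \<in> closure {L. achievable K (swap_users P) \<epsilon> \<delta> L}" by blast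
qed

section \<open>Converse\<close>

lemma more_capable_0: "stochastic X Z V \<Longrightarrow> finite X \<Longrightarrow> finite Z \<Longrightarrow> more_capable 0 X Z V Y W"
  by (auto simp: more_capable_def intro!: minfo_nonneg)

lemma dominated_prob_dist: "dominated K W \<Longrightarrow> k \<le> K \<Longrightarrow> prob_dist UNIV (W k)"
  by (simp add: dominated_def stochastic_def)

lemma abs_cont_memoryless:
  assumes dominated_V: "dominated K V" and xs_word: "xs \<in> nlists n {0..K}"
  shows "abs_cont (memoryless V xs) (product_dist n (\<lambda>_. V 0))"
  unfolding memoryless_def nlistsE_length[OF xs_word]
  using nlistsE_nth_in[OF xs_word] by (intro abs_cont_product_dist dominated_abs_cont[OF dominated_V]) simp

lemma relent_memoryless:
  assumes dominated_V: "dominated K V" and xs_word: "xs \<in> nlists n {0..K}"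
  shows "relent (memoryless V xs) (product_dist n (\<lambda>_. V 0)) (nlists n UNIV)
      = (\<Sum>i<n. relent (V (xs ! i)) (V 0) UNIV)"
  unfolding memoryless_def nlistsE_length[OF xs_word] using nlistsE_nth_in[OF xs_word]
  by (intro relent_product_dist dominated_abs_cont[OF dominated_V]
      prob_dist_sum[OF dominated_prob_dist[OF dominated_V]]) simp_all

locale covert_bc = warden K "chanQ P" for K and P :: "nat \<Rightarrow> 'y1::finite \<Rightarrow> 'y2::finite \<Rightarrow> 'z::finite \<Rightarrow> real" +
  assumes bc_channel: "bc_channel K P"
    and dominated_chanW: "dominated K (chanW P)" and dominated_chanV: "dominated K (chanV P)"

sublocale covert_bc \<subseteq> user1: covert_channel K "chanQ P" "chanW P"
  by unfold_locales (rule dominated_chanW)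

sublocale covert_bc \<subseteq> user2: covert_channel K "chanQ P" "chanV P"
  by unfold_locales (rule dominated_chanV)

context covert_bc
begin

lemma covert_bc_swap_users: "covert_bc K (swap_users P)"
  by (intro covert_bc.intro covert_bc_axioms.intro)
     (simp_all add: chanQ_swap_users chanW_swap_users chanV_swap_users warden_axioms bc_channel_swap_users
        bc_channel dominated_chanW dominated_chanV)

lemma code_rates_le_avg_relent:
  assumes code: "is_code K n M1 M2 Kn enc dec1 dec2" and c_bounds: "0 \<le> c" "c \<le> 1"
    and more_capable_V_W: "more_capable c {0..K} UNIV (chanV P) UNIV (chanW P)"
  shows "(1 - code_error P n M1 M2 Kn enc dec1 dec2) * (c * ln M1 + ln M2) - 2 * ln 2
    \<le> avg (code_index M1 M2 Kn) (\<lambda>(w1, w2, s). \<Sum>i<n. relent (chanV P (enc w1 w2 s ! i)) (chanV P 0) UNIV)"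
proof -
  let ?enc = "\<lambda>(w1, w2, s). enc w1 w2 s"
  have "(1 - code_error P n M1 M2 Kn enc dec1 dec2) * (c * ln (card {1..M1}) + ln (card {1..M2})) - 2 * ln 2
      \<le> avg (code_index M1 M2 Kn)
          (\<lambda>w. relent (memoryless (chanV P) (?enc w)) (product_dist n (\<lambda>_. chanV P 0)) (nlists n UNIV))"
  proof (rule two_message_converse_with_key)
    show "more_capable c (nlists n {0..K}) (nlists n UNIV) (memoryless (chanV P))
        (nlists n UNIV) (memoryless (chanW P))"
      by (intro more_capable_memoryless c_bounds more_capable_V_W dominated_stochastic dominated_chanW
          dominated_chanV) auto
    show "prob_dist (nlists n UNIV) (product_dist n (\<lambda>_. chanV P 0))"
      by (intro prob_dist_product_dist dominated_prob_dist[OF dominated_chanV]) simp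
  qed (use code c_bounds is_code_enc[OF code] abs_cont_memoryless[OF dominated_chanV]
      user1_error_le_code_error[OF bc_channel code] user2_error_le_code_error[OF bc_channel code]
      in \<open>auto intro!: stochastic_memoryless dominated_stochastic dominated_chanW dominated_chanV
        simp: user1_error_def user2_error_def case_prod_unfold is_code_def\<close>)
  also have "\<dots> = avg (code_index M1 M2 Kn)
      (\<lambda>(w1, w2, s). \<Sum>i<n. relent (chanV P (enc w1 w2 s ! i)) (chanV P 0) UNIV)"
    by (intro avg_cong) (auto intro!: relent_memoryless[OF dominated_chanV] is_code_enc[OF code])
  finally show ?thesis by simp
qed

lemma code_converse:
  assumes code: "is_code K n M1 M2 Kn enc dec1 dec2" and n_ge_1: "1 \<le> n" and c_bounds: "0 \<le> c" "c \<le> 1"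
    and more_capable_V_W: "more_capable c {0..K} UNIV (chanV P) UNIV (chanW P)"
  obtains p where "prob_dist {0..K} p" "real n * output_relent p \<le> covertness P n M1 M2 Kn enc"
    "(1 - code_error P n M1 M2 Kn enc dec1 dec2) * (c * ln M1 + ln M2) - 2 * ln 2
      \<le> real n * weighted_relent K (chanV P) p"
proof
  let ?\<Omega> = "code_index M1 M2 Kn"
  let ?enc = "\<lambda>(w1, w2, s). enc w1 w2 s"
  let ?p = "symbol_freq ?\<Omega> n ?enc"
  have enc: "?enc w \<in> nlists n {0..K}" if "w \<in> ?\<Omega>" for w
    using is_code_enc[OF code] that by auto
  have finite_nonempty_\<Omega>: "finite ?\<Omega>" "?\<Omega> \<noteq> {}"
    using code by (auto simp: is_code_def)
  show "prob_dist {0..K} ?p"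
    by (intro prob_dist_symbol_freq finite_nonempty_\<Omega> enc n_ge_1) simp
  show "real n * output_relent ?p \<le> covertness P n M1 M2 Kn enc"
    unfolding covertness_eq[OF code] case_prod_unfold
    using relent_avg_memoryless_ge[OF _ finite_nonempty_\<Omega> enc n_ge_1 stochastic_Q abs_cont_Q0]
    by (simp add: case_prod_unfold)
  have "avg ?\<Omega> (\<lambda>(w1, w2, s). \<Sum>i<n. relent (chanV P (enc w1 w2 s ! i)) (chanV P 0) UNIV)
      = real n * weighted_relent K (chanV P) ?p"
    using avg_symbols[of "{0..K}" ?\<Omega> ?enc n "\<lambda>k. relent (chanV P k) (chanV P 0) UNIV"] enc
    by (simp add: sum_weighted_relent case_prod_unfold)
  then show "(1 - code_error P n M1 M2 Kn enc dec1 dec2) * (c * ln M1 + ln M2) - 2 * ln 2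
      \<le> real n * weighted_relent K (chanV P) ?p"
    using code_rates_le_avg_relent[OF code c_bounds more_capable_V_W] by simp
qed

lemma code_normalized_rates_le:
  assumes code: "is_code K n M1 M2 Kn enc dec1 dec2" and cov: "covertness P n M1 M2 Kn enc \<le> \<delta>"
    and n_ge_1: "1 \<le> n" and \<delta>_pos: "0 < \<delta>" and c_bounds: "0 \<le> c" "c \<le> 1"
    and more_capable_V_W: "more_capable c {0..K} UNIV (chanV P) UNIV (chanW P)"
    and relent_le: "\<forall>p. prob_dist {0..K} p \<longrightarrow> real n * output_relent p \<le> \<delta>
      \<longrightarrow> real n * weighted_relent K (chanV P) p \<le> B * sqrt (real n * \<delta>)"
  shows "(1 - code_error P n M1 M2 Kn enc dec1 dec2)
      * (c * (ln M1 / sqrt (real n * \<delta>)) + ln M2 / sqrt (real n * \<delta>)) \<le> 2 * ln 2 / sqrt (real n * \<delta>) + B"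
proof -
  define s where "s = sqrt (real n * \<delta>)"
  have s_pos: "0 < s" using n_ge_1 \<delta>_pos by (simp add: s_def)
  obtain p where p_covert: "prob_dist {0..K} p" "real n * output_relent p \<le> covertness P n M1 M2 Kn enc"
    and sum_rate: "(1 - code_error P n M1 M2 Kn enc dec1 dec2) * (c * ln M1 + ln M2) - 2 * ln 2
        \<le> real n * weighted_relent K (chanV P) p"
    using code_converse[OF code n_ge_1 c_bounds more_capable_V_W] by blast
  have "real n * weighted_relent K (chanV P) p \<le> B * s"
    using relent_le p_covert cov unfolding s_def by (meson order_trans)
  then have "(1 - code_error P n M1 M2 Kn enc dec1 dec2) * (c * ln M1 + ln M2) / s \<le> (2 * ln 2 + B * s) / s"
    using sum_rate s_pos by (intro divide_right_mono) auto
  then show ?thesis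
    using s_pos by (simp add: s_def[symmetric] add_divide_distrib distrib_left)
qed

lemma achievable_weighted_sum_le:
  assumes achievable_L: "achievable K P \<epsilon> \<delta> L" and \<delta>_pos: "0 < \<delta>" and \<epsilon>_less_1: "\<epsilon> < 1"
    and c_bounds: "0 \<le> c" "c \<le> 1"
    and more_capable_V_W: "more_capable c {0..K} UNIV (chanV P) UNIV (chanW P)"
  shows "(1 - \<epsilon>) * (c * fst L + snd L) \<le> user2.cap"
proof -
  obtain M1 M2 Kn enc dec1 dec2 where
    code: "\<And>n. is_code K n (M1 n) (M2 n) (Kn n) (enc n) (dec1 n) (dec2 n)"
    and cov: "\<And>n. covertness P n (M1 n) (M2 n) (Kn n) (enc n) \<le> \<delta>"
    and rates: "ereal (fst L) \<le> Liminf sequentially (\<lambda>n. ereal (ln (real (M1 n)) / sqrt (real n * \<delta>)))"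
      "ereal (snd L) \<le> Liminf sequentially (\<lambda>n. ereal (ln (real (M2 n)) / sqrt (real n * \<delta>)))"
    and error: "Limsup sequentially (\<lambda>n. ereal (code_error P n (M1 n) (M2 n) (Kn n) (enc n) (dec1 n) (dec2 n)))
        \<le> ereal \<epsilon>"
    using achievable_L unfolding achievable_def by blast
  define e where "e n = code_error P n (M1 n) (M2 n) (Kn n) (enc n) (dec1 n) (dec2 n)" for n
  obtain r where r_lim: "r \<longlonglongrightarrow> 1"
    and rate: "\<forall>\<^sub>F n in sequentially. \<forall>p. prob_dist {0..K} p \<longrightarrow> real n * output_relent p \<le> \<delta>
      \<longrightarrow> real n * weighted_relent K (chanV P) p \<le> user2.cap * r n * sqrt (real n * \<delta>)"
    using user2.covert_rate_le[OF \<delta>_pos] by blast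
  have messages: "1 \<le> M1 n" "1 \<le> M2 n" for n using code[of n] by (simp_all add: is_code_def)
  show ?thesis
  proof (rule weighted_Liminf_le[OF rates error[folded e_def] \<epsilon>_less_1 c_bounds(1)])
    show "\<forall>\<^sub>F n in sequentially.
        (1 - e n) * (c * (ln (real (M1 n)) / sqrt (real n * \<delta>)) + ln (real (M2 n)) / sqrt (real n * \<delta>))
        \<le> 2 * ln 2 / sqrt (real n * \<delta>) + user2.cap * r n"
      using rate eventually_ge_at_top[of 1]
      by eventually_elim
         (unfold e_def, rule code_normalized_rates_le[OF code cov _ \<delta>_pos c_bounds more_capable_V_W])
    have "(\<lambda>n. 2 * ln 2 / sqrt (real n * \<delta>)) \<longlonglongrightarrow> 0" using \<delta>_pos by real_asymp
    from tendsto_add[OF this tendsto_mult[OF tendsto_const r_lim]]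
    show "(\<lambda>n. 2 * ln 2 / sqrt (real n * \<delta>) + user2.cap * r n) \<longlonglongrightarrow> user2.cap" by simp
  qed (use messages in \<open>simp_all add: \<delta>_pos less_imp_le\<close>)
qed

lemma covert_region_weighted_sum_le:
  assumes L_in_region: "L \<in> covert_region K P \<delta>" and \<delta>_pos: "0 < \<delta>" and c_bounds: "0 \<le> c" "c \<le> 1"
    and more_capable_V_W: "more_capable c {0..K} UNIV (chanV P) UNIV (chanW P)"
  shows "c * fst L + snd L \<le> user2.cap"
proof -
  have "(1 - \<epsilon>) * (c * fst L + snd L) \<le> user2.cap" if \<epsilon>_bounds: "0 < \<epsilon>" "\<epsilon> < 1" for \<epsilon>
  proof -
    have "closure {L. achievable K P \<epsilon> \<delta> L} \<subseteq> {L. (1 - \<epsilon>) * (c * fst L + snd L) \<le> user2.cap}"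
      using achievable_weighted_sum_le[OF _ \<delta>_pos \<epsilon>_bounds(2) c_bounds more_capable_V_W]
      by (intro closure_minimal closed_Collect_le continuous_intros) auto
    then show ?thesis using L_in_region \<epsilon>_bounds by (auto simp: covert_region_def region_eps_def)
  qed
  then have "\<forall>\<^sub>F \<epsilon> in at_right 0. (1 - \<epsilon>) * (c * fst L + snd L) \<le> user2.cap"
    unfolding eventually_at_right_field by (intro exI[of _ 1]) auto
  moreover have "((\<lambda>\<epsilon>. (1 - \<epsilon>) * (c * fst L + snd L)) \<longlongrightarrow> (1 - 0) * (c * fst L + snd L)) (at_right 0)"
    by (intro tendsto_intros)
  ultimately have "(1 - 0) * (c * fst L + snd L) \<le> user2.cap"
    by (intro tendsto_upperbound[OF _ _ trivial_limit_at_right_real])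
  then show ?thesis by simp
qed

lemma covert_region_snd_le:
  assumes "L \<in> covert_region K P \<delta>" "0 < \<delta>"
  shows "snd L \<le> user2.cap"
proof -
  have "more_capable 0 {0..K} UNIV (chanV P) UNIV (chanW P)"
    by (intro more_capable_0 dominated_stochastic dominated_chanV) simp_all
  from covert_region_weighted_sum_le[OF assms _ _ this] show ?thesis by simp
qed

lemma covert_region_fst_le:
  assumes "L \<in> covert_region K P \<delta>" "0 < \<delta>"
  shows "fst L \<le> user1.cap"
  using covert_bc.covert_region_snd_le[OF covert_bc_swap_users covert_region_swap_users[OF assms(1)] assms(2)]
  by (simp add: chanQ_swap_users chanV_swap_users)

lemma covert_region_time_sharing_bound_if_le:
  assumes L_in_region: "L \<in> covert_region K P \<delta>" and \<delta>_pos: "0 < \<delta>" and cap_le: "user2.cap \<le> user1.cap"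
    and cond: "\<And>p. p \<in> input_dists K \<Longrightarrow> mutual_info K p (chanW P) * user2.cap
        \<le> user1.cap * mutual_info K p (chanV P)"
  shows "fst L * user2.cap + snd L * user1.cap \<le> user1.cap * user2.cap"
proof (cases "user1.cap = 0")
  case True
  then show ?thesis using cap_le user2.covert_cap_nonneg by simp
next
  case False
  then have pos: "0 < user1.cap" using user1.covert_cap_nonneg by simp
  have "more_capable (user2.cap / user1.cap) {0..K} UNIV (chanV P) UNIV (chanW P)"
    using cond pos
    by (intro more_capable_if_mutual_info_le dominated_stochastic dominated_chanW dominated_chanV)
       (simp add: field_simps)
  from covert_region_weighted_sum_le[OF L_in_region \<delta>_pos _ _ this]
  have "user2.cap / user1.cap * fst L + snd L \<le> user2.cap"
    using cap_le pos user2.covert_cap_nonneg by simp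
  then show ?thesis using pos by (simp add: field_simps)
qed

lemma covert_region_time_sharing_bound:
  assumes L_in_region: "L \<in> covert_region K P \<delta>" and \<delta>_pos: "0 < \<delta>"
    and cond1: "\<And>p. user2.cap \<le> user1.cap \<Longrightarrow> p \<in> input_dists K \<Longrightarrow>
      mutual_info K p (chanW P) * user2.cap \<le> user1.cap * mutual_info K p (chanV P)"
    and cond2: "\<And>p. user1.cap < user2.cap \<Longrightarrow> p \<in> input_dists K \<Longrightarrow>
      mutual_info K p (chanV P) * user1.cap \<le> user2.cap * mutual_info K p (chanW P)"
  shows "fst L * user2.cap + snd L * user1.cap \<le> user1.cap * user2.cap"
proof (cases "user2.cap \<le> user1.cap")
  case True
  from this cond1[OF True] show ?thesis by (rule covert_region_time_sharing_bound_if_le[OF L_in_region \<delta>_pos])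
next
  case False
  then have cap_less: "user1.cap < user2.cap" by simp
  have "snd L * user1.cap + fst L * user2.cap \<le> user2.cap * user1.cap"
    using covert_bc.covert_region_time_sharing_bound_if_le[OF covert_bc_swap_users covert_region_swap_users[OF
        L_in_region] \<delta>_pos,
        unfolded chanQ_swap_users chanV_swap_users chanW_swap_users, OF less_imp_le[OF cap_less]
            cond2[OF cap_less]]
    by simp
  then show ?thesis by (simp add: mult.commute add.commute)
qed

end

lemma covert_region_nonneg:
  assumes "L \<in> covert_region K P \<delta>"
  shows "0 \<le> fst L" "0 \<le> snd L"
proof -
  have "(1/2 :: real) \<in> {0<..<1}" by simp
  then have "L \<in> closure {L. achievable K P (1/2) \<delta> L}"
    using assms unfolding covert_region_def region_eps_def by blast
  moreover have "closure {L. achievable K P (1/2) \<delta> L} \<subseteq> {L. 0 \<le> fst L \<and> 0 \<le> snd L}"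
    by (intro closure_minimal closed_Collect_conj closed_Collect_le continuous_intros)
       (auto simp: achievable_def)
  ultimately show "0 \<le> fst L" "0 \<le> snd L" by auto
qed

text \<open>Clearing denominators makes the junk case of a vanishing capacity uniform with the others.\<close>

lemma ratio_term_add_le_1_iff:
  assumes "0 \<le> a" "0 \<le> b" "0 \<le> A" "0 \<le> B"
  shows "ratio_term a A + ratio_term b B \<le> 1 \<longleftrightarrow> a \<le> A \<and> b \<le> B \<and> a * B + b * A \<le> A * B"
proof (cases "A = 0 \<or> B = 0")
  case True
  then show ?thesis using assms
    by (auto simp: ratio_term_def one_ereal_def divide_le_eq_1 zero_ereal_def split: if_splits)
next
  case False
  then have pos: "0 < A" "0 < B" using assms by auto
  have "a \<le> A" "b \<le> B" if "a * B + b * A \<le> A * B"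
  proof -
    have "0 \<le> a * B" "0 \<le> b * A" using assms by simp_all
    then have "a * B \<le> A * B" "A * b \<le> A * B" using that by (simp_all add: mult.commute)
    then show "a \<le> A" "b \<le> B" using pos by simp_all
  qed
  moreover have "a / A + b / B \<le> 1 \<longleftrightarrow> a * B + b * A \<le> A * B"
    using pos by (simp add: field_simps)
  ultimately show ?thesis using pos by (auto simp: ratio_term_def one_ereal_def)
qed

section \<open>Random codes with a threshold decoder\<close>

definition select :: "nat \<Rightarrow> (nat \<Rightarrow> bool) \<Rightarrow> nat" where
  "select M A = (if \<exists>w\<in>{1..M}. A w then SOME w. w \<in> {1..M} \<and> A w else 1)"

lemma select_accepted:
  assumes "w \<in> {1..M}" "A w"
  shows "select M A \<in> {1..M}" "A (select M A)"
proof -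
  have "\<exists>w\<in>{1..M}. A w" using assms by blast
  then have "select M A = (SOME w. w \<in> {1..M} \<and> A w)" by (simp only: select_def if_True)
  moreover have "(SOME w. w \<in> {1..M} \<and> A w) \<in> {1..M} \<and> A (SOME w. w \<in> {1..M} \<and> A w)"
    by (rule someI[of _ w]) (use assms in blast)
  ultimately show "select M A \<in> {1..M}" "A (select M A)" by simp_all
qed

lemma select_range: "1 \<le> M \<Longrightarrow> select M A \<in> {1..M}"
  using select_accepted(1)[of _ M A] by (cases "\<exists>w\<in>{1..M}. A w") (blast, simp add: select_def)

lemma select_error_le:
  assumes w_message: "w \<in> {1..M}"
  shows "(of_bool (select M A \<noteq> w) :: real) \<le> of_bool (\<not> A w) + (\<Sum>w'\<in>{1..M} - {w}. of_bool (A w'))"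
proof (cases "A w \<and> select M A \<noteq> w")
  case True
  have "select M A \<in> {1..M}" "A (select M A)"
    using True select_accepted[of w M A, OF w_message] by blast+
  then have "(1 :: real) \<le> (\<Sum>w'\<in>{1..M} - {w}. of_bool (A w'))"
    using True member_le_sum[of "select M A" "{1..M} - {w}" "\<lambda>w'. of_bool (A w') :: real"] by simp
  then show ?thesis using True by simp
next
  case False
  have "(0 :: real) \<le> (\<Sum>w'\<in>{1..M} - {w}. of_bool (A w'))"
    by (intro sum_nonneg) simp
  then show ?thesis using False by auto
qed

definition accepts :: "('t \<Rightarrow> 'y \<Rightarrow> real) \<Rightarrow> ('y \<Rightarrow> real) \<Rightarrow> nat \<Rightarrow> real \<Rightarrow> 't list \<Rightarrow> 'y list \<Rightarrow> bool" where
  "accepts U q m \<gamma> xs ys \<longleftrightarrow> exp \<gamma> * product_dist m (\<lambda>_. q) ys < memoryless U xs ys"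

definition threshold_dec ::
    "('t \<Rightarrow> 'y \<Rightarrow> real) \<Rightarrow> ('y \<Rightarrow> real) \<Rightarrow> nat \<Rightarrow> real \<Rightarrow> nat \<Rightarrow> (nat \<Rightarrow> 't list) \<Rightarrow> 'y list \<Rightarrow> nat" where
  "threshold_dec U q m \<gamma> M \<kappa> ys = select M (\<lambda>w. accepts U q m \<gamma> (\<kappa> w) ys)"

lemma threshold_dec_range: "1 \<le> M \<Longrightarrow> threshold_dec U q m \<gamma> M \<kappa> ys \<in> {1..M}"
  by (simp only: threshold_dec_def select_range)

text \<open>The moment generating function, at \<open>- t\<close>, of the information density relative to \<open>q\<close>.\<close>

definition tilt :: "('t \<Rightarrow> 'y::finite \<Rightarrow> real) \<Rightarrow> ('y \<Rightarrow> real) \<Rightarrow> real \<Rightarrow> 't \<Rightarrow> real" where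
  "tilt U q t x = (\<Sum>y\<in>UNIV. U x y * exp (- t * ln (U x y / q y)))"

definition codebooks :: "nat \<Rightarrow> nat \<Rightarrow> 't set \<Rightarrow> (nat \<Rightarrow> 't list) set" where
  "codebooks M m T = {1..M} \<rightarrow>\<^sub>E nlists m T"

lemma nlists_nonempty: "T \<noteq> {} \<Longrightarrow> nlists m T \<noteq> {}"
  using nlists_not_empty[of T m] by blast

lemma finite_codebooks: "finite T \<Longrightarrow> finite (codebooks M m T)"
  unfolding codebooks_def by (intro finite_PiE) auto

lemma codebooks_nonempty: "T \<noteq> {} \<Longrightarrow> codebooks M m T \<noteq> {}"
  unfolding codebooks_def by (simp add: PiE_eq_empty_iff nlists_nonempty)

lemma codebook_word: "\<kappa> \<in> codebooks M m T \<Longrightarrow> w \<in> {1..M} \<Longrightarrow> \<kappa> w \<in> nlists m T"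
  unfolding codebooks_def by (rule PiE_mem)

lemma avg_codebook_word:
  "finite T \<Longrightarrow> T \<noteq> {} \<Longrightarrow> w \<in> {1..M} \<Longrightarrow> avg (codebooks M m T) (\<lambda>\<kappa>. f (\<kappa> w)) = avg (nlists m T) f"
  unfolding codebooks_def by (intro avg_PiE_component) (simp_all add: nlists_nonempty)

lemma avg_memoryless:
  assumes "finite T"
  shows "avg (nlists m T) (\<lambda>xs. memoryless U xs ys) = product_dist m (\<lambda>_ y. avg T (\<lambda>t. U t y)) ys"
proof -
  have "avg (nlists m T) (\<lambda>xs. memoryless U xs ys) = avg (nlists m T) (product_dist m (\<lambda>i t. U t (ys ! i)))"
    by (intro avg_cong) (simp add: memoryless_def product_dist_def)
  then show ?thesis by (simp add: avg_nlists_product_dist[OF assms] product_dist_def)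
qed

context
  fixes T :: "'t set" and U :: "'t \<Rightarrow> 'y::finite \<Rightarrow> real" and q :: "'y \<Rightarrow> real"
  assumes stochastic_U: "stochastic T UNIV U" and q_dist: "prob_dist UNIV q"
    and abs_cont: "\<And>t. t \<in> T \<Longrightarrow> abs_cont (U t) q"
begin

lemma memoryless_nonneg: "xs \<in> nlists m T \<Longrightarrow> 0 \<le> memoryless U xs ys"
  unfolding memoryless_def product_dist_def
  by (intro prod_nonneg stochastic_nonneg[OF stochastic_U]) (simp_all add: nlistsE_nth_in)

lemma of_bool_accepts_le:
  assumes xs_word: "xs \<in> nlists m T"
  shows "of_bool (accepts U q m \<gamma> xs ys) \<le> exp (- \<gamma>) * (memoryless U xs ys / product_dist m (\<lambda>_. q) ys)"
proof -
  let ?v = "product_dist m (\<lambda>_. q) ys"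
  have v_nonneg: "0 \<le> ?v"
    unfolding product_dist_def by (intro prod_nonneg) (simp add: prob_dist_nonneg[OF q_dist])
  show ?thesis
  proof (cases "accepts U q m \<gamma> xs ys")
    case True
    have "abs_cont (memoryless U xs) (product_dist m (\<lambda>_. q))"
      unfolding memoryless_def nlistsE_length[OF xs_word]
      by (intro abs_cont_product_dist abs_cont nlistsE_nth_in[OF xs_word])
    then have "?v \<noteq> 0" using True by (auto simp: accepts_def abs_cont_def)
    then have "0 < ?v" using v_nonneg by simp
    then show ?thesis using True by (simp add: accepts_def exp_minus field_simps)
  qed (use memoryless_nonneg[OF xs_word] v_nonneg in simp)
qed

lemma likelihood_pos:
  assumes xs_word: "xs \<in> nlists m T" and nonzero: "memoryless U xs ys \<noteq> 0" and i_less: "i < m"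
  shows "0 < U (xs ! i) (ys ! i)" "0 < q (ys ! i)"
proof -
  have in_T: "xs ! i \<in> T" by (rule nlistsE_nth_in[OF xs_word i_less])
  have "U (xs ! i) (ys ! i) \<noteq> 0"
    using nonzero i_less unfolding memoryless_def nlistsE_length[OF xs_word] product_dist_eq_0_iff by blast
  moreover from this have "q (ys ! i) \<noteq> 0" using abs_cont[OF in_T] unfolding abs_cont_def by blast
  ultimately show "0 < U (xs ! i) (ys ! i)" "0 < q (ys ! i)"
    using stochastic_nonneg[OF stochastic_U in_T, of "ys ! i"] prob_dist_nonneg[OF q_dist, of "ys ! i"]
    by simp_all
qed

lemma sum_information_density_le:
  assumes xs_word: "xs \<in> nlists m T" and nonzero: "memoryless U xs ys \<noteq> 0"
    and rejected: "\<not> accepts U q m \<gamma> xs ys"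
  shows "(\<Sum>i<m. ln (U (xs ! i) (ys ! i) / q (ys ! i))) \<le> \<gamma>"
proof -
  note pos = likelihood_pos[OF xs_word nonzero]
  have mem: "memoryless U xs ys = product_dist m (\<lambda>i. U (xs ! i)) ys"
    by (simp add: memoryless_def nlistsE_length[OF xs_word])
  then have "0 < memoryless U xs ys" "0 < product_dist m (\<lambda>_. q) ys"
    unfolding product_dist_def using pos by (auto intro!: prod_pos)
  then have "ln (memoryless U xs ys / product_dist m (\<lambda>_. q) ys) \<le> ln (exp \<gamma>)"
    using rejected by (intro ln_mono) (auto simp: accepts_def pos_divide_le_eq)
  moreover have "(\<Sum>i<m. ln (U (xs ! i) (ys ! i) / q (ys ! i))) = ln (\<Prod>i<m. U (xs ! i) (ys ! i) / q (ys ! i))"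
    using pos by (intro ln_prod[symmetric]) (auto simp: less_imp_neq[symmetric])
  ultimately show ?thesis
    unfolding mem product_dist_divide by (simp add: product_dist_def)
qed

lemma miss_probability_le:
  assumes xs_word: "xs \<in> nlists m T" and t_nonneg: "0 \<le> t"
  shows "(\<Sum>ys\<in>nlists m UNIV. memoryless U xs ys * of_bool (\<not> accepts U q m \<gamma> xs ys))
    \<le> exp (t * \<gamma>) * product_dist m (\<lambda>_. tilt U q t) xs"
proof -
  define f where "f i y = U (xs ! i) y * exp (- t * ln (U (xs ! i) y / q y))" for i y
  have in_T: "xs ! i \<in> T" if "i < m" for i using nlistsE_nth_in[OF xs_word that] .
  have "memoryless U xs ys * of_bool (\<not> accepts U q m \<gamma> xs ys) \<le> exp (t * \<gamma>) * product_dist m f ys" for ys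
  proof (cases "memoryless U xs ys = 0 \<or> accepts U q m \<gamma> xs ys")
    case True
    have "0 \<le> product_dist m f ys"
      unfolding product_dist_def f_def
      by (intro prod_nonneg) (simp add: stochastic_nonneg[OF stochastic_U in_T])
    then show ?thesis using True by auto
  next
    case False
    then have "t * (\<Sum>i<m. ln (U (xs ! i) (ys ! i) / q (ys ! i))) \<le> t * \<gamma>"
      using sum_information_density_le[OF xs_word] t_nonneg by (intro mult_left_mono) auto
    then have "1 \<le> exp (t * \<gamma>) * exp (\<Sum>i<m. - t * ln (U (xs ! i) (ys ! i) / q (ys ! i)))"
      by (simp add: sum_negf flip: exp_add sum_distrib_left)
    then have "memoryless U xs ys * 1
        \<le> memoryless U xs ys * (exp (t * \<gamma>) * exp (\<Sum>i<m. - t * ln (U (xs ! i) (ys ! i) / q (ys ! i))))"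
      by (intro mult_left_mono memoryless_nonneg[OF xs_word])
    also have "\<dots> = exp (t * \<gamma>) * product_dist m f ys"
      by (simp add: memoryless_def nlistsE_length[OF xs_word] product_dist_def f_def prod.distrib exp_sum
          mult_ac)
    finally show ?thesis using False by simp
  qed
  then have "(\<Sum>ys\<in>nlists m UNIV. memoryless U xs ys * of_bool (\<not> accepts U q m \<gamma> xs ys))
      \<le> (\<Sum>ys\<in>nlists m UNIV. exp (t * \<gamma>) * product_dist m f ys)"
    by (rule sum_mono)
  also have "\<dots> = exp (t * \<gamma>) * product_dist m (\<lambda>_. tilt U q t) xs"
    unfolding sum_distrib_left[symmetric] sum_nlists_product_dist
    by (simp add: f_def tilt_def product_dist_def)
  finally show ?thesis .
qed

lemma threshold_decoding_error_le:
  assumes \<kappa>_codebook: "\<kappa> \<in> codebooks M m T" and w_message: "w \<in> {1..M}" and t_nonneg: "0 \<le> t"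
  shows "decoding_error (nlists m UNIV) (memoryless U (\<kappa> w)) (threshold_dec U q m \<gamma> M \<kappa>) w
    \<le> exp (t * \<gamma>) * product_dist m (\<lambda>_. tilt U q t) (\<kappa> w)
      + (\<Sum>w'\<in>{1..M} - {w}. \<Sum>ys\<in>nlists m UNIV.
          exp (- \<gamma>) * (memoryless U (\<kappa> w) ys * memoryless U (\<kappa> w') ys / product_dist m (\<lambda>_. q) ys))"
proof -
  have word: "\<kappa> v \<in> nlists m T" if "v \<in> {1..M}" for v using codebook_word[OF \<kappa>_codebook that] .
  let ?u = "\<lambda>w ys. memoryless U (\<kappa> w) ys" and ?A = "\<lambda>w ys. accepts U q m \<gamma> (\<kappa> w) ys"
  have "decoding_error (nlists m UNIV) (?u w) (threshold_dec U q m \<gamma> M \<kappa>) w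
      \<le> (\<Sum>ys\<in>nlists m UNIV. ?u w ys * (of_bool (\<not> ?A w ys) + (\<Sum>w'\<in>{1..M} - {w}. of_bool (?A w' ys))))"
    unfolding decoding_error_def threshold_dec_def
    by (intro sum_mono mult_left_mono select_error_le memoryless_nonneg[OF word[OF w_message]] w_message)
  also have "\<dots> = (\<Sum>ys\<in>nlists m UNIV. ?u w ys * of_bool (\<not> ?A w ys))
      + (\<Sum>w'\<in>{1..M} - {w}. \<Sum>ys\<in>nlists m UNIV. ?u w ys * of_bool (?A w' ys))"
    unfolding distrib_left sum.distrib sum_distrib_left by (subst (2) sum.swap) (rule refl)
  also have "\<dots> \<le> exp (t * \<gamma>) * product_dist m (\<lambda>_. tilt U q t) (\<kappa> w)
      + (\<Sum>w'\<in>{1..M} - {w}. \<Sum>ys\<in>nlists m UNIV.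
          ?u w ys * (exp (- \<gamma>) * (?u w' ys / product_dist m (\<lambda>_. q) ys)))"
    by (intro add_mono miss_probability_le sum_mono mult_left_mono of_bool_accepts_le
        memoryless_nonneg[OF word[OF w_message]] word w_message t_nonneg) auto
  finally show ?thesis by (simp add: mult_ac)
qed

lemma sum_avg_collision:
  assumes finite_nonempty_T: "finite T" "T \<noteq> {}"
    and distinct_messages: "w \<in> {1..M}" "w' \<in> {1..M}" "w \<noteq> w'"
  shows "avg (codebooks M m T) (\<lambda>\<kappa>. \<Sum>ys\<in>nlists m UNIV.
      memoryless U (\<kappa> w) ys * memoryless U (\<kappa> w') ys / product_dist m (\<lambda>_. q) ys)
    = (1 + chi2 (\<lambda>y. avg T (\<lambda>t. U t y)) q)^m"
proof -
  let ?u = "\<lambda>y. avg T (\<lambda>t. U t y)"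
  have "(?u y)\<^sup>2 / q y = (?u y - q y)\<^sup>2 / q y + 2 * ?u y - q y" for y
  proof (cases "q y = 0")
    case True
    then have "?u y = 0" using abs_cont by (simp add: avg_def abs_cont_def)
    then show ?thesis using True by simp
  qed (simp add: field_simps power2_eq_square)
  then have moment: "(\<Sum>y\<in>UNIV. (?u y)\<^sup>2 / q y) = 1 + chi2 ?u q"
    using prob_dist_sum[OF prob_dist_avg[OF stochastic_U finite_nonempty_T]] prob_dist_sum[OF q_dist]
    by (simp add: chi2_def sum.distrib sum_subtractf flip: sum_distrib_left)
  have "avg (codebooks M m T) (\<lambda>\<kappa>. \<Sum>ys\<in>nlists m UNIV.
      memoryless U (\<kappa> w) ys * memoryless U (\<kappa> w') ys / product_dist m (\<lambda>_. q) ys)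
    = (\<Sum>ys\<in>nlists m UNIV. avg (codebooks M m T) (\<lambda>\<kappa>. memoryless U (\<kappa> w) ys * memoryless U (\<kappa> w') ys)
        / product_dist m (\<lambda>_. q) ys)"
    unfolding avg_sum by (simp add: divide_inverse avg_mult_right)
  also have "\<dots> = (\<Sum>ys\<in>nlists m UNIV. product_dist m (\<lambda>_ y. (?u y)\<^sup>2 / q y) ys)"
    using avg_PiE_two_components[of "{1..M}" w w' "nlists m T"
        "\<lambda>xs. memoryless U xs ys" "\<lambda>xs. memoryless U xs ys" for ys] distinct_messages finite_nonempty_T
    by (simp add: codebooks_def nlists_nonempty avg_memoryless product_dist_mult product_dist_divide
        power2_eq_square)
  also have "\<dots> = (1 + chi2 ?u q)^m"
    by (simp add: sum_nlists_product_dist moment)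
  finally show ?thesis .
qed

lemma random_coding_error_le:
  assumes finite_nonempty_T: "finite T" "T \<noteq> {}" and w_message: "w \<in> {1..M}" and t_nonneg: "0 \<le> t"
  shows "avg (codebooks M m T)
      (\<lambda>\<kappa>. decoding_error (nlists m UNIV) (memoryless U (\<kappa> w)) (threshold_dec U q m \<gamma> M \<kappa>) w)
    \<le> exp (t * \<gamma>) * (avg T (tilt U q t))^m + M * (exp (- \<gamma>) * (1 + chi2 (\<lambda>y. avg T (\<lambda>t. U t y)) q)^m)"
proof -
  let ?B = "(1 + chi2 (\<lambda>y. avg T (\<lambda>t. U t y)) q)^m"
  let ?col = "\<lambda>w' \<kappa>. \<Sum>ys\<in>nlists m UNIV.
      memoryless U (\<kappa> w) ys * memoryless U (\<kappa> w') ys / product_dist m (\<lambda>_. q) ys"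
  have "0 \<le> chi2 (\<lambda>y. avg T (\<lambda>t. U t y)) q"
    unfolding chi2_def by (intro sum_nonneg divide_nonneg_nonneg) (simp_all add: prob_dist_nonneg[OF q_dist])
  then have B_nonneg: "0 \<le> ?B" by simp
  have collision: "avg (codebooks M m T) (?col w') = ?B" if "w' \<in> {1..M} - {w}" for w'
    using that w_message by (intro sum_avg_collision finite_nonempty_T) auto
  have "avg (codebooks M m T)
      (\<lambda>\<kappa>. decoding_error (nlists m UNIV) (memoryless U (\<kappa> w)) (threshold_dec U q m \<gamma> M \<kappa>) w)
    \<le> avg (codebooks M m T) (\<lambda>\<kappa>. exp (t * \<gamma>) * product_dist m (\<lambda>_. tilt U q t) (\<kappa> w)
        + (\<Sum>w'\<in>{1..M} - {w}. exp (- \<gamma>) * ?col w' \<kappa>))"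
    using threshold_decoding_error_le[OF _ w_message t_nonneg]
    by (intro avg_mono) (simp add: sum_distrib_left)
  also have "\<dots> = exp (t * \<gamma>) * avg (nlists m T) (product_dist m (\<lambda>_. tilt U q t))
      + (\<Sum>w'\<in>{1..M} - {w}. exp (- \<gamma>) * avg (codebooks M m T) (?col w'))"
    by (simp only: avg_add avg_sum avg_mult_left avg_codebook_word[OF finite_nonempty_T w_message])
  also have "\<dots> = exp (t * \<gamma>) * (avg T (tilt U q t))^m + (\<Sum>w'\<in>{1..M} - {w}. exp (- \<gamma>) * ?B)"
    by (simp add: avg_nlists_product_dist[OF finite_nonempty_T(1)] collision)
  also have "\<dots> \<le> exp (t * \<gamma>) * (avg T (tilt U q t))^m + M * (exp (- \<gamma>) * ?B)"
    using B_nonneg w_message by (simp add: mult_right_mono)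
  finally show ?thesis .
qed

end

section \<open>Codes with a common key\<close>

definition keyed_code :: "nat \<Rightarrow> (nat \<Rightarrow> 'y::finite \<Rightarrow> real) \<Rightarrow> (nat \<Rightarrow> 'z::finite \<Rightarrow> real) \<Rightarrow> nat \<Rightarrow> nat \<Rightarrow>
    'k set \<Rightarrow> (nat \<Rightarrow> 'k \<Rightarrow> nat list) \<Rightarrow> ('k \<Rightarrow> 'y list \<Rightarrow> nat) \<Rightarrow> ('z \<Rightarrow> real) \<Rightarrow> real \<Rightarrow> bool" where
  "keyed_code K W Q m M S enc dec R e \<longleftrightarrow> finite S \<and> S \<noteq> {} \<and> 1 \<le> M \<and> prob_dist UNIV R \<and>
     (\<forall>w\<in>{1..M}. \<forall>s\<in>S. enc w s \<in> nlists m {0..K}) \<and> (\<forall>s ys. dec s ys \<in> {1..M}) \<and>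
     (\<forall>w\<in>{1..M}. avg S (\<lambda>s. decoding_error (nlists m UNIV) (memoryless W (enc w s)) (dec s) w) \<le> e) \<and>
     (\<forall>w\<in>{1..M}. \<forall>zs. avg S (\<lambda>s. memoryless Q (enc w s) zs) = product_dist m (\<lambda>_. R) zs)"

lemma keyed_code_single_message:
  assumes "prob_dist UNIV (Q 0)"
  shows "keyed_code K W Q m 1 {undefined} (\<lambda>_ _. replicate m 0) (\<lambda>_ _. 1) (Q 0) 0"
proof -
  have "memoryless Q (replicate m 0) = product_dist m (\<lambda>_. Q 0)"
    by (simp add: fun_eq_iff memoryless_def product_dist_def)
  then show ?thesis
    using assms by (simp add: keyed_code_def avg_def decoding_error_def nlists_replicateI)
qed

lemma map_codebook_word:
  assumes "\<kappa> \<in> codebooks M m T" "w \<in> {1..M}" "g ` T \<subseteq> X"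
  shows "map g (\<kappa> w) \<in> nlists m X"
proof (rule nlistsI)
  have word: "\<kappa> w \<in> nlists m T" by (rule codebook_word[OF assms(1,2)])
  show "length (map g (\<kappa> w)) = m" using nlistsE_length[OF word] by simp
  show "set (map g (\<kappa> w)) \<subseteq> X" using nlistsE_set[OF word] assms(3) by (simp only: set_map) blast
qed

lemma avg_codebooks_memoryless_map:
  assumes "finite T" "T \<noteq> {}" "w \<in> {1..M}"
  shows "avg (codebooks M m T) (\<lambda>\<kappa>. memoryless Q (map g (\<kappa> w)) zs)
      = product_dist m (\<lambda>_ z. avg T (\<lambda>t. Q (g t) z)) zs"
  unfolding memoryless_map avg_codebook_word[OF assms, of m "\<lambda>xs. memoryless (\<lambda>t. Q (g t)) xs zs"]
  by (rule avg_memoryless[OF assms(1)])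

lemma keyed_code_codebooks:
  assumes dominated_W: "dominated K W" and stochastic_Q: "stochastic {0..K} UNIV Q"
    and finite_nonempty_T: "finite T" "T \<noteq> {}" and g_image: "g ` T \<subseteq> {0..K}"
    and M_ge_1: "1 \<le> M" and t_nonneg: "0 \<le> t"
  defines "p \<equiv> freq T g"
  shows "keyed_code K W Q m M (codebooks M m T) (\<lambda>w \<kappa>. map g (\<kappa> w)) (threshold_dec (\<lambda>t. W (g t)) (W 0) m \<gamma> M)
    (mixture {0..K} p Q)
    (exp (t * \<gamma>) * (\<Sum>k=0..K. p k * tilt W (W 0) t k)^m + M * (exp (- \<gamma>) * (1 + chi_form K W p)^m))"
proof -
  have p_dist: "prob_dist {0..K} p"
    unfolding p_def using finite_nonempty_T g_image by (intro prob_dist_freq) auto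
  have avg_letters: "avg T (\<lambda>t. f (g t)) = (\<Sum>k=0..K. p k * f k)" for f
    unfolding p_def using g_image by (intro avg_eq_sum_freq) auto
  have stochastic_U: "stochastic T UNIV (\<lambda>t. W (g t))" and abs_cont: "t \<in> T \<Longrightarrow> abs_cont (W (g t)) (W 0)" for t
    using dominated_W g_image by (auto simp: dominated_def stochastic_def)
  have "(\<lambda>y. avg T (\<lambda>t. W (g t) y)) = mixture {0..K} p W"
    using avg_letters[of "\<lambda>k. W k y" for y] by (simp add: mixture_def[abs_def])
  then have chi2: "chi2 (\<lambda>y. avg T (\<lambda>t. W (g t) y)) (W 0) = chi_form K W p"
    using chi2_mixture[OF p_dist] by simp
  have tilt: "avg T (tilt (\<lambda>t. W (g t)) (W 0) t) = (\<Sum>k=0..K. p k * tilt W (W 0) t k)"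
    using avg_letters[of "tilt W (W 0) t"] by (simp add: tilt_def[abs_def])
  have error: "avg (codebooks M m T) (\<lambda>\<kappa>. decoding_error (nlists m UNIV) (memoryless W (map g (\<kappa> w)))
        (threshold_dec (\<lambda>t. W (g t)) (W 0) m \<gamma> M \<kappa>) w)
      \<le> exp (t * \<gamma>) * (\<Sum>k=0..K. p k * tilt W (W 0) t k)^m + M * (exp (- \<gamma>) * (1 + chi_form K W p)^m)"
    if "w \<in> {1..M}" for w
    using random_coding_error_le[OF stochastic_U dominated_prob_dist[OF dominated_W] abs_cont
        finite_nonempty_T that t_nonneg, of m \<gamma>]
    by (simp add: memoryless_map chi2 tilt)
  have warden_output: "avg (codebooks M m T) (\<lambda>\<kappa>. memoryless Q (map g (\<kappa> w)) zs)
      = product_dist m (\<lambda>_. mixture {0..K} p Q) zs" if "w \<in> {1..M}" for w zs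
    unfolding avg_codebooks_memoryless_map[OF finite_nonempty_T that]
    using avg_letters[of "\<lambda>k. Q k z" for z] by (simp add: mixture_def[abs_def])
  show ?thesis
    unfolding keyed_code_def
    by (intro conjI ballI allI finite_codebooks codebooks_nonempty finite_nonempty_T M_ge_1
        prob_dist_mixture[OF stochastic_Q p_dist] error
        warden_output map_codebook_word[OF _ _ g_image] threshold_dec_range)
qed

lemma product_dist_append:
  assumes "length us = m"
  shows "product_dist (m + k) (\<lambda>i. if i < m then f else g) (us @ vs)
    = product_dist m (\<lambda>_. f) us * product_dist k (\<lambda>_. g) vs"
proof -
  let ?F = "\<lambda>i. (if i < m then f else g) ((us @ vs) ! i)"
  have "(\<Prod>i<m + k. ?F i) = (\<Prod>i<m. ?F i) * (\<Prod>i<k. ?F (m + i))"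
    by (induction k) (simp_all add: mult.assoc)
  also have "\<dots> = (\<Prod>i<m. f (us ! i)) * (\<Prod>i<k. g (vs ! i))"
    using assms by (intro arg_cong2[where f = "(*)"] prod.cong refl) (simp_all add: nth_append)
  finally show ?thesis by (simp only: product_dist_def)
qed

lemma decoding_error_append:
  assumes stochastic_W: "stochastic X UNIV W" and xs_word: "xs \<in> nlists m X" and xs'_word: "xs' \<in> nlists k X"
  shows decoding_error_append_take:
      "decoding_error (nlists (m + k) UNIV) (memoryless W (xs @ xs')) (\<lambda>ys. d (take m ys)) w
      = decoding_error (nlists m UNIV) (memoryless W xs) d w"
    and decoding_error_append_drop:
      "decoding_error (nlists (m + k) UNIV) (memoryless W (xs @ xs')) (\<lambda>ys. d (drop m ys)) w
      = decoding_error (nlists k UNIV) (memoryless W xs') d w"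
proof -
  have split: "(\<Sum>ys\<in>nlists (m + k) UNIV. memoryless W (xs @ xs') ys * f (take m ys) (drop m ys))
      = (\<Sum>us\<in>nlists m UNIV. \<Sum>vs\<in>nlists k UNIV. memoryless W xs us * memoryless W xs' vs * f us vs)" for f
    unfolding sum_nlists_append
    by (intro sum.cong refl) (simp add: memoryless_append nlistsE_length[OF xs_word] in_nlists_UNIV)
  have one: "(\<Sum>us\<in>nlists m UNIV. memoryless W xs us) = 1" "(\<Sum>vs\<in>nlists k UNIV. memoryless W xs' vs) = 1"
    using stochastic_sum[OF stochastic_memoryless[OF stochastic_W]] xs_word xs'_word by auto
  show "decoding_error (nlists (m + k) UNIV) (memoryless W (xs @ xs')) (\<lambda>ys. d (take m ys)) w
      = decoding_error (nlists m UNIV) (memoryless W xs) d w"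
    unfolding decoding_error_def split[of "\<lambda>us vs. of_bool (d us \<noteq> w)"]
    by (intro sum.cong refl)
       (simp add: mult.commute[of "memoryless W xs _"] mult.left_commute[of "memoryless W xs' _"] one
           mult.assoc
          flip: sum_distrib_left sum_distrib_right)
  show "decoding_error (nlists (m + k) UNIV) (memoryless W (xs @ xs')) (\<lambda>ys. d (drop m ys)) w
      = decoding_error (nlists k UNIV) (memoryless W xs') d w"
    unfolding decoding_error_def split[of "\<lambda>us vs. of_bool (d vs \<noteq> w)"]
    by (simp only: mult.assoc sum_distrib_left[symmetric] sum_distrib_right[symmetric] one mult_1_left)
qed

section \<open>Covert random codes\<close>

lemma nat_floor_mult_tendsto:
  fixes c :: real
  assumes "0 \<le> c"
  shows "(\<lambda>n. real (nat \<lfloor>c * real n\<rfloor>) / real n) \<longlonglongrightarrow> c"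
proof (cases "c = 0")
  case False
  with assms have "0 < c" by simp
  then show ?thesis by real_asymp
qed simp

lemma exp_sqrt_tendsto_0:
  assumes "x \<longlonglongrightarrow> l" "l < 0"
  shows "(\<lambda>n. exp (x n * sqrt (real n))) \<longlonglongrightarrow> 0"
  by (intro filterlim_compose[OF exp_at_bot] filterlim_tendsto_neg_mult_at_bot[OF assms]
      filterlim_compose[OF sqrt_at_top filterlim_real_sequentially])

lemma frequencies_approximating:
  assumes \<beta>_nonneg: "\<And>k. k \<in> {1..K} \<Longrightarrow> 0 \<le> \<beta> k"
  obtains T :: "nat \<Rightarrow> (nat \<times> nat) set" where "\<And>n. finite (T n)" "\<And>n. T n \<noteq> {}" "\<And>n. fst ` T n \<subseteq> {0..K}"
    "\<And>k. k \<in> {1..K} \<Longrightarrow> (\<lambda>n. sqrt (real n) * freq (T n) fst k) \<longlonglongrightarrow> \<beta> k"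
proof -
  define b where "b n k = (if k = 0 then Suc (nat \<lceil>real n * sqrt (real n)\<rceil>) else nat \<lfloor>\<beta> k * real n\<rfloor>)"
    for n k :: nat
  define T where "T n = Sigma {0..K} (\<lambda>k. {..<b n k})" for n
  define N where "N n = (\<Sum>k=0..K. real (b n k))" for n
  have freq: "freq (T n) fst k = b n k / N n" if "k \<in> {0..K}" for n k
    unfolding T_def N_def using that by (simp add: freq_Sigma_fst)
  have letters: "(\<lambda>n. real (b n k) / real n) \<longlonglongrightarrow> \<beta> k" if "k \<in> {1..K}" for k
    using nat_floor_mult_tendsto[OF \<beta>_nonneg[OF that]] that by (simp add: b_def)
  have "(\<lambda>n. real (b n 0) / (real n * sqrt (real n))) \<longlonglongrightarrow> 1"
    unfolding b_def by (simp, real_asymp)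
  moreover have "(\<lambda>n. \<Sum>k=1..K. real (b n k) / real n * (1 / sqrt (real n))) \<longlonglongrightarrow> (\<Sum>k=1..K. \<beta> k * 0)"
    by (intro tendsto_sum tendsto_mult letters) (assumption, real_asymp)
  ultimately have "(\<lambda>n. real (b n 0) / (real n * sqrt (real n))
        + (\<Sum>k=1..K. real (b n k) / real n * (1 / sqrt (real n))))
      \<longlonglongrightarrow> 1 + (\<Sum>k=1..K. \<beta> k * 0)"
    by (rule tendsto_add)
  then have N_lim: "(\<lambda>n. N n / (real n * sqrt (real n))) \<longlonglongrightarrow> 1"
    by (simp add: N_def sum_0_to_K add_divide_distrib sum_divide_distrib)
  have "(\<lambda>n. sqrt (real n) * freq (T n) fst k) \<longlonglongrightarrow> \<beta> k" if k_range: "k \<in> {1..K}" for k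
  proof (rule Lim_transform_eventually)
    show "(\<lambda>n. (real (b n k) / real n) / (N n / (real n * sqrt (real n)))) \<longlonglongrightarrow> \<beta> k"
      using tendsto_divide[OF letters[OF k_range] N_lim] by simp
    show "\<forall>\<^sub>F n in sequentially. (real (b n k) / real n) / (N n / (real n * sqrt (real n)))
        = sqrt (real n) * freq (T n) fst k"
      using eventually_gt_at_top[of 0] by eventually_elim (use k_range in \<open>simp add: freq\<close>)
  qed
  moreover have "(0, 0) \<in> T n" for n by (simp add: T_def b_def)
  then have "T n \<noteq> {}" for n by blast
  moreover have "finite (T n)" "fst ` T n \<subseteq> {0..K}" for n by (auto simp: T_def)
  ultimately show thesis using that by blast
qed

lemma tilt_self:
  assumes "prob_dist UNIV (W x)"
  shows "tilt W (W x) t x = 1"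
proof -
  have "W x y * exp (- t * ln (W x y / W x y)) = W x y" for y by (cases "W x y = 0") auto
  then show ?thesis unfolding tilt_def by (simp only: prob_dist_sum[OF assms])
qed

lemma DERIV_tilt: "((\<lambda>t. tilt W q t x) has_real_derivative - relent (W x) q UNIV) (at 0)"
proof -
  have "((\<lambda>t. tilt W q t x) has_real_derivative
      (\<Sum>y\<in>UNIV. W x y * (exp (- 0 * ln (W x y / q y)) * (- ln (W x y / q y))))) (at 0)"
    unfolding tilt_def by (auto intro!: derivative_eq_intros simp: mult.commute)
  also have "(\<Sum>y\<in>UNIV. W x y * (exp (- 0 * ln (W x y / q y)) * (- ln (W x y / q y)))) = - relent (W x) q UNIV"
    unfolding relent_def sum_negf[symmetric] by (intro sum.cong refl) simp
  finally show ?thesis .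
qed

lemma tilt_exponent:
  assumes dominated_W: "dominated K W" and D_less: "D < weighted_relent K W \<beta>"
  obtains t where "0 < t" "t * D < (\<Sum>k=1..K. \<beta> k * (1 - tilt W (W 0) t k))"
proof -
  define E where "E t = (\<Sum>k=1..K. \<beta> k * (1 - tilt W (W 0) t k))" for t
  have "(E has_real_derivative (\<Sum>k=1..K. \<beta> k * (0 - (- relent (W k) (W 0) UNIV)))) (at 0)"
    unfolding E_def by (intro DERIV_sum DERIV_cmult DERIV_diff DERIV_const DERIV_tilt)
  moreover have "E 0 = 0"
    unfolding E_def tilt_def using prob_dist_sum[OF dominated_prob_dist[OF dominated_W]]
    by (intro sum.neutral) auto
  ultimately have "((\<lambda>t. E t / t) \<longlongrightarrow> weighted_relent K W \<beta>) (at_right 0)"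
    by (simp add: has_field_derivative_iff weighted_relent_def filterlim_at_split)
  then have "\<forall>\<^sub>F t in at_right 0. D < E t / t" using D_less by (rule order_tendstoD(1))
  then have "\<forall>\<^sub>F t in at_right 0. 0 < t \<and> t * D < E t"
    using eventually_at_right_less[of 0] by eventually_elim (simp add: pos_less_divide_eq mult.commute)
  then obtain t where "0 < t" "t * D < E t"
    using eventually_happens'[OF trivial_limit_at_right_real] by blast
  then show thesis unfolding E_def by (rule that)
qed

context
  fixes K :: nat and p :: "nat \<Rightarrow> nat \<Rightarrow> real" and \<beta> :: "nat \<Rightarrow> real"
  assumes p_dist: "\<And>n. prob_dist {0..K} (p n)"
    and lim: "\<And>k. k \<in> {1..K} \<Longrightarrow> (\<lambda>n. sqrt (real n) * p n k) \<longlonglongrightarrow> \<beta> k"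
begin

lemma scaled_chi_form_tendsto: "(\<lambda>n. real n * chi_form K W (p n)) \<longlonglongrightarrow> chi_form K W \<beta>"
proof -
  have "(\<lambda>n. chi_form K W (\<lambda>k. sqrt (real n) * p n k)) \<longlonglongrightarrow> chi_form K W \<beta>"
    unfolding chi_form_def divide_inverse by (intro tendsto_intros lim) simp
  then show ?thesis by (simp add: chi_form_cmult)
qed

lemma mixture_tendsto: "(\<lambda>n. mixture {0..K} (p n) W y) \<longlonglongrightarrow> W 0 y"
proof -
  have "(\<lambda>n. p n k) \<longlonglongrightarrow> 0" if k_range: "k \<in> {1..K}" for k
  proof (rule Lim_transform_eventually)
    have "(\<lambda>n. 1 / sqrt (real n)) \<longlonglongrightarrow> 0" by real_asymp
    from tendsto_mult[OF lim[OF k_range] this]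
    show "(\<lambda>n. sqrt (real n) * p n k * (1 / sqrt (real n))) \<longlonglongrightarrow> 0" by simp
    show "\<forall>\<^sub>F n in sequentially. sqrt (real n) * p n k * (1 / sqrt (real n)) = p n k"
      using eventually_gt_at_top[of 0] by eventually_elim simp
  qed
  then have "(\<lambda>n. W 0 y + (\<Sum>k=1..K. p n k * (W k y - W 0 y))) \<longlonglongrightarrow> W 0 y + (\<Sum>k=1..K. 0 * (W k y - W 0 y))"
    by (intro tendsto_intros) simp
  then show ?thesis by (simp add: mixture_input_dist[OF p_dist])
qed

lemma scaled_output_relent_tendsto:
  assumes Q_channel: "stochastic {0..K} UNIV Q" "\<And>z. 0 < Q 0 z"
  shows "(\<lambda>n. real n * relent (mixture {0..K} (p n) Q) (Q 0) UNIV) \<longlonglongrightarrow> chi_form K Q \<beta> / 2"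
proof (rule Lim_transform)
  show "(\<lambda>n. real n * chi_form K Q (p n) / 2) \<longlonglongrightarrow> chi_form K Q \<beta> / 2"
    by (intro tendsto_intros scaled_chi_form_tendsto) simp
  define \<eta> where "\<eta> n = (\<Sum>z\<in>UNIV. \<bar>mixture {0..K} (p n) Q z / Q 0 z - 1\<bar>)" for n
  have "\<eta> \<longlonglongrightarrow> (\<Sum>z\<in>UNIV. \<bar>Q 0 z / Q 0 z - 1\<bar>)"
    unfolding \<eta>_def using Q_channel(2)
    by (intro tendsto_intros mixture_tendsto) (simp add: less_imp_neq[symmetric])
  also have "(\<Sum>z\<in>UNIV. \<bar>Q 0 z / Q 0 z - 1\<bar>) = 0" using Q_channel(2) by (simp add: less_imp_neq[symmetric])
  finally have \<eta>_lim: "\<eta> \<longlonglongrightarrow> 0" .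
  have gap: "\<forall>\<^sub>F n in sequentially.
      norm (real n * relent (mixture {0..K} (p n) Q) (Q 0) UNIV - real n * chi_form K Q (p n) / 2)
      \<le> 2 * \<eta> n * (real n * chi_form K Q (p n))"
    using order_tendstoD(2)[OF \<eta>_lim, of "1/2", simplified]
  proof eventually_elim
    case (elim n)
    have "\<bar>relent (mixture {0..K} (p n) Q) (Q 0) UNIV - chi_form K Q (p n) / 2\<bar>
        \<le> 2 * \<eta> n * chi_form K Q (p n)"
      unfolding chi2_mixture[OF p_dist, symmetric]
    proof (rule abs_relent_minus_half_chi2_le)
      show "sum (mixture {0..K} (p n) Q) UNIV = sum (Q 0) UNIV"
        using Q_channel(1) prob_dist_sum[OF prob_dist_mixture[OF Q_channel(1) p_dist]]
        by (simp add: stochastic_sum)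
      show "\<bar>mixture {0..K} (p n) Q z / Q 0 z - 1\<bar> \<le> \<eta> n" for z
        unfolding \<eta>_def by (rule member_le_sum) auto
    qed (use elim Q_channel(2) in auto)
    then have "real n * \<bar>relent (mixture {0..K} (p n) Q) (Q 0) UNIV - chi_form K Q (p n) / 2\<bar>
        \<le> real n * (2 * \<eta> n * chi_form K Q (p n))"
      by (intro mult_left_mono) auto
    moreover have "real n * \<bar>u\<bar> = \<bar>real n * u\<bar>" for u by (simp add: abs_mult)
    ultimately show ?case by (simp add: right_diff_distrib mult_ac)
  qed
  have "(\<lambda>n. 2 * \<eta> n * (real n * chi_form K Q (p n))) \<longlonglongrightarrow> 2 * 0 * chi_form K Q \<beta>"
    by (intro tendsto_intros \<eta>_lim scaled_chi_form_tendsto)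
  then show "(\<lambda>n. real n * relent (mixture {0..K} (p n) Q) (Q 0) UNIV - real n * chi_form K Q (p n) / 2) \<longlonglongrightarrow> 0"
    by (intro Lim_null_comparison[OF gap]) simp
qed

context
  fixes m :: "nat \<Rightarrow> nat" and \<theta> :: real
  assumes m_lim: "(\<lambda>n. real (m n) / real n) \<longlonglongrightarrow> \<theta>"
begin

lemma miss_term_tendsto_0:
  assumes dominated_W: "dominated K W"
    and exponent_less: "t * c < \<theta> * (\<Sum>k=1..K. \<beta> k * (1 - tilt W (W 0) t k))"
  shows "(\<lambda>n. exp (t * (c * sqrt (real n))) * (\<Sum>k=0..K. p n k * tilt W (W 0) t k)^m n) \<longlonglongrightarrow> 0"
proof -
  define E where "E n = (\<Sum>k=1..K. p n k * (1 - tilt W (W 0) t k))" for n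
  let ?x = "\<lambda>n. t * c - real (m n) / real n * (sqrt (real n) * E n)"
  have "(\<lambda>n. \<Sum>k=1..K. sqrt (real n) * p n k * (1 - tilt W (W 0) t k))
      \<longlonglongrightarrow> (\<Sum>k=1..K. \<beta> k * (1 - tilt W (W 0) t k))"
    by (intro tendsto_intros lim)
  then have "(\<lambda>n. sqrt (real n) * E n) \<longlonglongrightarrow> (\<Sum>k=1..K. \<beta> k * (1 - tilt W (W 0) t k))"
    by (simp add: E_def sum_distrib_left mult.assoc)
  then have "?x \<longlonglongrightarrow> t * c - \<theta> * (\<Sum>k=1..K. \<beta> k * (1 - tilt W (W 0) t k))"
    by (intro tendsto_intros m_lim)
  then have "(\<lambda>n. exp (?x n * sqrt (real n))) \<longlonglongrightarrow> 0"
    using exponent_less by (intro exp_sqrt_tendsto_0) auto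
  moreover have "\<forall>\<^sub>F n in sequentially.
      norm (exp (t * (c * sqrt (real n))) * (\<Sum>k=0..K. p n k * tilt W (W 0) t k)^m n)
      \<le> exp (?x n * sqrt (real n))"
    using eventually_gt_at_top[of 0]
  proof eventually_elim
    case (elim n)
    let ?A = "\<Sum>k=0..K. p n k * tilt W (W 0) t k"
    have "?A + E n = (\<Sum>k=0..K. p n k)"
      using tilt_self[of W 0, OF dominated_prob_dist[OF dominated_W]]
      by (simp add: E_def sum_0_to_K[of "\<lambda>k. p n k * tilt W (W 0) t k"] sum_0_to_K[of "p n"] algebra_simps
          sum_subtractf)
    then have "?A = 1 - E n" using prob_dist_sum[OF p_dist[of n]] by simp
    also have "\<dots> \<le> exp (- E n)" using exp_ge_add_one_self[of "- E n"] by simp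
    finally have A_le: "?A \<le> exp (- E n)" .
    have A_nonneg: "0 \<le> ?A"
      using prob_dist_nonneg[OF p_dist[of n]] dominated_stochastic[OF dominated_W] unfolding tilt_def
      by (intro sum_nonneg mult_nonneg_nonneg) (auto simp: stochastic_nonneg)
    have "exp (t * (c * sqrt (real n))) * ?A^m n \<le> exp (t * (c * sqrt (real n))) * exp (- E n)^m n"
      by (intro mult_left_mono power_mono A_le A_nonneg) simp
    also have "\<dots> = exp (?x n * sqrt (real n))"
      using elim by (simp add: field_simps flip: exp_of_nat_mult exp_add)
    finally show ?case using A_nonneg by simp
  qed
  ultimately show ?thesis by (rule Lim_null_comparison[rotated])
qed

lemma collision_term_tendsto_0:
  assumes dominated_W: "dominated K W" and M_le: "\<And>n. real (M n) \<le> 2 * exp (l * sqrt (real n))"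
    and l_less: "l < c"
  shows "(\<lambda>n. M n * (exp (- (c * sqrt (real n))) * (1 + chi_form K W (p n))^m n)) \<longlonglongrightarrow> 0"
proof -
  let ?x = "\<lambda>n. l - c + real (m n) / real n * (real n * chi_form K W (p n)) * (1 / sqrt (real n))"
  have "(\<lambda>n. 1 / sqrt (real n)) \<longlonglongrightarrow> 0" by real_asymp
  then have "?x \<longlonglongrightarrow> l - c + \<theta> * chi_form K W \<beta> * 0"
    by (intro tendsto_intros m_lim scaled_chi_form_tendsto)
  then have "(\<lambda>n. exp (?x n * sqrt (real n))) \<longlonglongrightarrow> 0"
    using l_less by (intro exp_sqrt_tendsto_0) auto
  from tendsto_mult_right_zero[OF this, of 2]
  have "(\<lambda>n. 2 * exp (?x n * sqrt (real n))) \<longlonglongrightarrow> 0" .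
  moreover have "\<forall>\<^sub>F n in sequentially.
      norm (M n * (exp (- (c * sqrt (real n))) * (1 + chi_form K W (p n))^m n))
      \<le> 2 * exp (?x n * sqrt (real n))"
    using eventually_gt_at_top[of 0]
  proof eventually_elim
    case (elim n)
    have chi_nonneg: "0 \<le> chi_form K W (p n)"
      by (rule chi_form_nonneg[OF dominated_stochastic[OF dominated_W]])
    have "(1 + chi_form K W (p n))^m n \<le> exp (chi_form K W (p n))^m n"
      using chi_nonneg by (intro power_mono exp_ge_add_one_self) auto
    then have "M n * (exp (- (c * sqrt (real n))) * (1 + chi_form K W (p n))^m n)
        \<le> 2 * exp (l * sqrt (real n)) * (exp (- (c * sqrt (real n))) * exp (chi_form K W (p n))^m n)"
      using chi_nonneg by (intro mult_mono M_le mult_left_mono) auto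
    also have "\<dots> = 2 * exp (?x n * sqrt (real n))"
      using elim by (simp add: field_simps flip: exp_of_nat_mult exp_add)
    finally show ?case using chi_nonneg by simp
  qed
  ultimately show ?thesis by (rule Lim_null_comparison[rotated])
qed

lemma random_coding_bound_tendsto_0:
  assumes dominated_W: "dominated K W" and \<theta>_pos: "0 < \<theta>" and l_less: "l < \<theta> * weighted_relent K W \<beta>"
    and M_le: "\<And>n. real (M n) \<le> 2 * exp (l * sqrt (real n))"
  obtains t c where "0 < t"
    "(\<lambda>n. exp (t * (c * sqrt (real n))) * (\<Sum>k=0..K. p n k * tilt W (W 0) t k)^m n
      + M n * (exp (- (c * sqrt (real n))) * (1 + chi_form K W (p n))^m n)) \<longlonglongrightarrow> 0"
proof -
  obtain c where c_between: "l < c" "c < \<theta> * weighted_relent K W \<beta>" using dense[OF l_less] by blast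
  then have "c / \<theta> < weighted_relent K W \<beta>" using \<theta>_pos by (simp add: field_simps)
  then obtain t where t_exponent: "0 < t" "t * (c / \<theta>) < (\<Sum>k=1..K. \<beta> k * (1 - tilt W (W 0) t k))"
    by (rule tilt_exponent[OF dominated_W])
  then have "t * c < \<theta> * (\<Sum>k=1..K. \<beta> k * (1 - tilt W (W 0) t k))"
    using \<theta>_pos by (simp add: field_simps)
  from tendsto_add_zero[OF miss_term_tendsto_0[OF dominated_W this] collision_term_tendsto_0[OF dominated_W
      M_le c_between(1)]]
  show thesis by (rule that[OF t_exponent(1)])
qed

lemma eventually_output_relent_le:
  assumes Q_channel: "stochastic {0..K} UNIV Q" "\<And>z. 0 < Q 0 z" and \<theta>_pos: "0 < \<theta>"
    and chi: "chi_form K Q \<beta> / 2 < \<delta>"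
  shows "\<forall>\<^sub>F n in sequentially. real (m n) * relent (mixture {0..K} (p n) Q) (Q 0) UNIV \<le> \<theta> * \<delta>"
proof -
  have "(\<lambda>n. real (m n) / real n * (real n * relent (mixture {0..K} (p n) Q) (Q 0) UNIV))
      \<longlonglongrightarrow> \<theta> * (chi_form K Q \<beta> / 2)"
    by (intro tendsto_mult m_lim scaled_output_relent_tendsto Q_channel)
  then have "\<forall>\<^sub>F n in sequentially.
      real (m n) / real n * (real n * relent (mixture {0..K} (p n) Q) (Q 0) UNIV) < \<theta> * \<delta>"
    by (rule order_tendstoD(2)) (rule mult_strict_left_mono[OF chi \<theta>_pos])
  then show ?thesis using eventually_gt_at_top[of 0] by eventually_elim simp
qed

end

end

lemma message_count_exists:
  fixes l :: real
  assumes "0 \<le> l"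
  obtains M :: "nat \<Rightarrow> nat" where "\<And>n. 1 \<le> M n" "\<And>n. l * sqrt (real n) \<le> ln (real (M n))"
    "\<And>n. real (M n) \<le> 2 * exp (l * sqrt (real n))"
proof
  let ?M = "\<lambda>n. nat \<lceil>exp (l * sqrt (real n))\<rceil>"
  have exp_ge_1: "1 \<le> exp (l * sqrt (real n))" for n using assms by simp
  have M_ge: "exp (l * sqrt (real n)) \<le> real (?M n)" for n by linarith
  show "1 \<le> ?M n" for n using exp_ge_1[of n] M_ge[of n] by linarith
  show "l * sqrt (real n) \<le> ln (real (?M n))" for n using ln_mono[OF M_ge[of n]] by simp
  show "real (?M n) \<le> 2 * exp (l * sqrt (real n))" for n using exp_ge_1[of n] by linarith
qed

context covert_channel
begin

lemma keyed_codes_exist_below_capacity: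
  assumes \<delta>_pos: "0 < \<delta>" and \<theta>_pos: "0 < \<theta>" and L_bounds: "0 \<le> L" "L < \<theta> * cap"
    and m_lim: "(\<lambda>n. real (m n) / real n) \<longlonglongrightarrow> \<theta>"
  obtains M and S :: "nat \<Rightarrow> (nat \<Rightarrow> (nat \<times> nat) list) set" and enc dec R e where
    "\<And>n. keyed_code K W Q (m n) (M n) (S n) (enc n) (dec n) (R n) (e n)" "e \<longlonglongrightarrow> 0"
    "\<And>n. L * sqrt (real n * \<delta>) \<le> ln (real (M n))"
    "\<forall>\<^sub>F n in sequentially. real (m n) * relent (R n) (Q 0) UNIV \<le> \<theta> * \<delta>"
proof -
  have scaled: "0 \<le> L / \<theta>" "L / \<theta> < cap" using L_bounds \<theta>_pos
    by (simp_all add: pos_divide_less_eq mult.commute)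
  obtain \<beta> where \<beta>_nonneg: "\<And>k. k \<in> {1..K} \<Longrightarrow> 0 \<le> \<beta> k"
    and chi: "chi_form K Q \<beta> / 2 < \<delta>" and "L / \<theta> * sqrt \<delta> < weighted_relent K W \<beta>"
    by (rule covert_cap_direction[OF scaled \<delta>_pos]) blast
  then have rate: "L * sqrt \<delta> < \<theta> * weighted_relent K W \<beta>" using \<theta>_pos by (simp add: field_simps)
  obtain T :: "nat \<Rightarrow> (nat \<times> nat) set"
    where letters: "\<And>n. finite (T n)" "\<And>n. T n \<noteq> {}" "\<And>n. fst ` T n \<subseteq> {0..K}"
    and lim: "\<And>k. k \<in> {1..K} \<Longrightarrow> (\<lambda>n. sqrt (real n) * freq (T n) fst k) \<longlonglongrightarrow> \<beta> k"
    by (rule frequencies_approximating[OF \<beta>_nonneg]) blast+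
  have p_dist: "prob_dist {0..K} (freq (T n) fst)" for n
    using letters by (intro prob_dist_freq) auto
  have "0 \<le> L * sqrt \<delta>" using L_bounds \<delta>_pos by simp
  then obtain M where M_pos: "\<And>n. 1 \<le> M n" and M_ge: "\<And>n. L * sqrt \<delta> * sqrt (real n) \<le> ln (real (M n))"
    and M_le: "\<And>n. real (M n) \<le> 2 * exp (L * sqrt \<delta> * sqrt (real n))"
    by (rule message_count_exists) (rule that)
  define e where "e t c n = exp (t * (c * sqrt (real n))) * (\<Sum>k=0..K. freq (T n) fst k * tilt W (W 0) t k)^m n
      + M n * (exp (- (c * sqrt (real n))) * (1 + chi_form K W (freq (T n) fst))^m n)" for t c n
  obtain t c where t_pos: "0 < t" and e_lim: "e t c \<longlonglongrightarrow> 0"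
    unfolding e_def by (rule random_coding_bound_tendsto_0[OF p_dist lim m_lim dominated_W \<theta>_pos rate M_le])
  have "keyed_code K W Q (m n) (M n) (codebooks (M n) (m n) (T n)) (\<lambda>w \<kappa>. map fst (\<kappa> w))
      (threshold_dec (\<lambda>t. W (fst t)) (W 0) (m n) (c * sqrt (real n)) (M n))
      (mixture {0..K} (freq (T n) fst) Q) (e t c n)" for n
    unfolding e_def using t_pos by (intro keyed_code_codebooks dominated_W stochastic_Q letters M_pos) simp
  moreover have "L * sqrt (real n * \<delta>) \<le> ln (real (M n))" for n
    using M_ge[of n] by (simp add: real_sqrt_mult mult_ac)
  moreover have "\<forall>\<^sub>F n in sequentially. real (m n) * output_relent (freq (T n) fst) \<le> \<theta> * \<delta>"
    by (rule eventually_output_relent_le[OF p_dist lim m_lim stochastic_Q Q0_pos \<theta>_pos chi])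
  ultimately show thesis using e_lim by (intro that)
qed

lemma keyed_codes_exist:
  assumes \<delta>_pos: "0 < \<delta>" and \<theta>_nonneg: "0 \<le> \<theta>" and L_bound: "L = 0 \<or> 0 < L \<and> L < \<theta> * cap"
    and m_lim: "(\<lambda>n. real (m n) / real n) \<longlonglongrightarrow> \<theta>"
  obtains M and S :: "nat \<Rightarrow> (nat \<Rightarrow> (nat \<times> nat) list) set" and enc dec R e where
    "\<And>n. keyed_code K W Q (m n) (M n) (S n) (enc n) (dec n) (R n) (e n)" "e \<longlonglongrightarrow> 0"
    "\<And>n. L * sqrt (real n * \<delta>) \<le> ln (real (M n))"
    "\<forall>\<^sub>F n in sequentially. real (m n) * relent (R n) (Q 0) UNIV \<le> \<theta> * \<delta>"
proof (cases "L = 0")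
  case True
  show thesis
    by (rule that[OF keyed_code_single_message[of Q, OF Q0_dist] tendsto_const])
       (use True \<delta>_pos \<theta>_nonneg in \<open>simp_all add: relent_self\<close>)
next
  case False
  then have "0 < \<theta>" using L_bound \<theta>_nonneg by (cases "\<theta> = 0") auto
  show thesis
  proof (rule keyed_codes_exist_below_capacity[OF \<delta>_pos \<open>0 < \<theta>\<close> _ _ m_lim])
    show "0 \<le> L" "L < \<theta> * cap" using False L_bound by auto
  qed (rule that)
qed

end

section \<open>Time sharing\<close>

locale time_sharing = covert_bc K P
  for K and P :: "nat \<Rightarrow> 'y1::finite \<Rightarrow> 'y2::finite \<Rightarrow> 'z::finite \<Rightarrow> real" +
  fixes m1 M1 and S1 :: "'k1 set" and enc1 dec1 R1 e1 and m2 M2 and S2 :: "'k2 set" and enc2 dec2 R2 e2 and h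
  assumes code1: "keyed_code K (chanW P) (chanQ P) m1 M1 S1 enc1 dec1 R1 e1"
    and code2: "keyed_code K (chanV P) (chanQ P) m2 M2 S2 enc2 dec2 R2 e2"
    and bij_key: "bij_betw h {1..card (S1 \<times> S2)} (S1 \<times> S2)"
begin

abbreviation Kn :: nat where
  "Kn \<equiv> card (S1 \<times> S2)"

definition shared_enc :: "nat \<Rightarrow> nat \<Rightarrow> nat \<Rightarrow> nat list" where
  "shared_enc w1 w2 s = enc1 w1 (fst (h s)) @ enc2 w2 (snd (h s))"

definition shared_dec1 :: "'y1 list \<Rightarrow> nat \<Rightarrow> nat" where
  "shared_dec1 ys s = dec1 (fst (h s)) (take m1 ys)"

definition shared_dec2 :: "'y2 list \<Rightarrow> nat \<Rightarrow> nat" where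
  "shared_dec2 ys s = dec2 (snd (h s)) (drop m1 ys)"

lemma finite_nonempty_keys: "finite S1" "S1 \<noteq> {}" "finite S2" "S2 \<noteq> {}" and messages_ge_1: "1 \<le> M1" "1 \<le> M2"
  using code1 code2 by (simp_all add: keyed_code_def)

lemma key_components: "s \<in> {1..Kn} \<Longrightarrow> fst (h s) \<in> S1" "s \<in> {1..Kn} \<Longrightarrow> snd (h s) \<in> S2"
  using bij_betwE[OF bij_key] by (auto simp: mem_Times_iff)

lemma enc_words: "w1 \<in> {1..M1} \<Longrightarrow> s \<in> {1..Kn} \<Longrightarrow> enc1 w1 (fst (h s)) \<in> nlists m1 {0..K}"
  "w2 \<in> {1..M2} \<Longrightarrow> s \<in> {1..Kn} \<Longrightarrow> enc2 w2 (snd (h s)) \<in> nlists m2 {0..K}"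
  using code1 code2 key_components unfolding keyed_code_def by blast+

lemma avg_shared_key: "avg {1..Kn} (\<lambda>s. f (h s)) = avg S1 (\<lambda>a. avg S2 (\<lambda>b. f (a, b)))"
  unfolding avg_reindex_bij_betw[OF bij_key, of f] by (rule avg_Times)

lemma is_code_shared: "is_code K (m1 + m2) M1 M2 Kn shared_enc shared_dec1 shared_dec2"
proof -
  have "shared_enc w1 w2 s \<in> nlists (m1 + m2) {0..K}"
    if "w1 \<in> {1..M1}" "w2 \<in> {1..M2}" "s \<in> {1..Kn}" for w1 w2 s
    unfolding shared_enc_def using that by (intro nlists_appendI enc_words)
  moreover have "0 < Kn" using finite_nonempty_keys by (simp add: card_gt_0_iff)
  then have "1 \<le> Kn" by linarith
  moreover have "shared_dec1 ys s \<in> {1..M1}" "shared_dec2 ys' s \<in> {1..M2}" for ys ys' s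
    using code1 code2 unfolding shared_dec1_def shared_dec2_def keyed_code_def by blast+
  ultimately show ?thesis
    using messages_ge_1 unfolding is_code_def nlists_def by blast
qed

lemma avg_code_index_le:
  assumes "\<And>w1 w2. w1 \<in> {1..M1} \<Longrightarrow> w2 \<in> {1..M2} \<Longrightarrow> avg {1..Kn} (f w1 w2) \<le> e"
  shows "avg (code_index M1 M2 Kn) (\<lambda>(w1, w2, s). f w1 w2 s) \<le> e"
  unfolding avg_Times prod.case
  by (rule avg_le[rotated 2], rule avg_le[rotated 2], rule assms) (use messages_ge_1 in auto)

lemma user1_error_shared_le: "user1_error (chanW P) (m1 + m2) M1 M2 Kn shared_enc shared_dec1 \<le> e1"
  unfolding user1_error_def
proof (rule avg_code_index_le)
  fix w1 w2 assume messages_range: "w1 \<in> {1..M1}" "w2 \<in> {1..M2}"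
  let ?err = "\<lambda>a. decoding_error (nlists m1 UNIV) (memoryless (chanW P) (enc1 w1 a)) (dec1 a) w1"
  show "avg {1..Kn} (\<lambda>s. decoding_error (nlists (m1 + m2) UNIV) (memoryless (chanW P) (shared_enc w1 w2 s))
      (\<lambda>ys. shared_dec1 ys s) w1) \<le> e1" (is "?error \<le> e1")
  proof -
    have "?error = avg {1..Kn} (\<lambda>s. ?err (fst (h s)))"
      unfolding shared_enc_def shared_dec1_def using messages_range
      by (intro avg_cong decoding_error_append_take[OF dominated_stochastic[OF dominated_chanW]] enc_words)
    also have "\<dots> = avg S1 ?err"
      using avg_shared_key[of "\<lambda>k. ?err (fst k)"] finite_nonempty_keys by (simp add: avg_const)
    also have "\<dots> \<le> e1"
      using code1 messages_range unfolding keyed_code_def by blast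
    finally show ?thesis .
  qed
qed

lemma user2_error_shared_le: "user2_error (chanV P) (m1 + m2) M1 M2 Kn shared_enc shared_dec2 \<le> e2"
  unfolding user2_error_def
proof (rule avg_code_index_le)
  fix w1 w2 assume messages_range: "w1 \<in> {1..M1}" "w2 \<in> {1..M2}"
  let ?err = "\<lambda>b. decoding_error (nlists m2 UNIV) (memoryless (chanV P) (enc2 w2 b)) (dec2 b) w2"
  show "avg {1..Kn} (\<lambda>s. decoding_error (nlists (m1 + m2) UNIV) (memoryless (chanV P) (shared_enc w1 w2 s))
      (\<lambda>ys. shared_dec2 ys s) w2) \<le> e2" (is "?error \<le> e2")
  proof -
    have "?error = avg {1..Kn} (\<lambda>s. ?err (snd (h s)))"
      unfolding shared_enc_def shared_dec2_def using messages_range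
      by (intro avg_cong decoding_error_append_drop[OF dominated_stochastic[OF dominated_chanV]] enc_words)
    also have "\<dots> = avg S2 ?err"
      using avg_shared_key[of "\<lambda>k. ?err (snd k)"] finite_nonempty_keys by (simp add: avg_const)
    also have "\<dots> \<le> e2"
      using code2 messages_range unfolding keyed_code_def by blast
    finally show ?thesis .
  qed
qed

lemma code_error_shared_le: "code_error P (m1 + m2) M1 M2 Kn shared_enc shared_dec1 shared_dec2 \<le> e1 + e2"
  using code_error_le[OF bc_channel is_code_shared] user1_error_shared_le user2_error_shared_le by linarith

lemma avg_memoryless_shared:
  assumes zs_word: "zs \<in> nlists (m1 + m2) UNIV"
  shows "avg (code_index M1 M2 Kn) (\<lambda>(w1, w2, s). memoryless (chanQ P) (shared_enc w1 w2 s) zs)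
    = product_dist (m1 + m2) (\<lambda>i. if i < m1 then R1 else R2) zs" (is "_ = ?R")
proof -
  have len: "length (take m1 zs) = m1" using nlistsE_length[OF zs_word] by simp
  have "avg {1..Kn} (\<lambda>s. memoryless (chanQ P) (shared_enc w1 w2 s) zs) = ?R"
    if messages_range: "w1 \<in> {1..M1}" "w2 \<in> {1..M2}" for w1 w2
  proof -
    let ?u = "\<lambda>a. memoryless (chanQ P) (enc1 w1 a) (take m1 zs)"
    let ?v = "\<lambda>b. memoryless (chanQ P) (enc2 w2 b) (drop m1 zs)"
    have "memoryless (chanQ P) (shared_enc w1 w2 s) zs = ?u (fst (h s)) * ?v (snd (h s))"
      if "s \<in> {1..Kn}" for s
      using memoryless_append[of "take m1 zs" "enc1 w1 (fst (h s))" "chanQ P" "enc2 w2 (snd (h s))"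
          "drop m1 zs"]
        len nlistsE_length[OF enc_words(1)[OF messages_range(1) that]] by (simp add: shared_enc_def)
    then have "avg {1..Kn} (\<lambda>s. memoryless (chanQ P) (shared_enc w1 w2 s) zs)
        = avg {1..Kn} (\<lambda>s. ?u (fst (h s)) * ?v (snd (h s)))"
      by (rule avg_cong)
    also have "\<dots> = avg S1 ?u * avg S2 ?v"
      using avg_shared_key[of "\<lambda>k. ?u (fst k) * ?v (snd k)"] by (simp add: avg_mult_left avg_mult_right)
    also have "\<dots> = product_dist m1 (\<lambda>_. R1) (take m1 zs) * product_dist m2 (\<lambda>_. R2) (drop m1 zs)"
      using code1 code2 messages_range unfolding keyed_code_def by simp
    also have "\<dots> = ?R"
      using product_dist_append[OF len, of m2 R1 R2 "drop m1 zs"] by simp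
    finally show ?thesis .
  qed
  then have "avg (code_index M1 M2 Kn) (\<lambda>(w1, w2, s). memoryless (chanQ P) (shared_enc w1 w2 s) zs)
      = avg {1..M1} (\<lambda>_. avg {1..M2} (\<lambda>_. ?R))"
    unfolding avg_Times prod.case by (intro avg_cong)
  then show ?thesis using messages_ge_1 by (simp add: avg_const)
qed

lemma covertness_shared:
  "covertness P (m1 + m2) M1 M2 Kn shared_enc
    = m1 * relent R1 (chanQ P 0) UNIV + m2 * relent R2 (chanQ P 0) UNIV"
proof -
  let ?R = "\<lambda>i. if i < m1 then R1 else R2"
  have R_dist: "prob_dist UNIV R1" "prob_dist UNIV R2"
    using code1 code2 by (simp_all add: keyed_code_def)
  have "covertness P (m1 + m2) M1 M2 Kn shared_enc
      = relent (product_dist (m1 + m2) ?R) (product_dist (m1 + m2) (\<lambda>_. chanQ P 0)) (nlists (m1 + m2) UNIV)"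
    unfolding covertness_eq[OF is_code_shared] by (intro relent_cong avg_memoryless_shared)
  also have "\<dots> = (\<Sum>i<m1 + m2. relent (?R i) (chanQ P 0) UNIV)"
    using prob_dist_sum[OF R_dist(1)] prob_dist_sum[OF R_dist(2)]
    by (intro relent_product_dist abs_cont_Q0) simp
  also have "\<dots> = m1 * relent R1 (chanQ P 0) UNIV + m2 * relent R2 (chanQ P 0) UNIV"
    by (induction m2) (simp_all add: algebra_simps)
  finally show ?thesis .
qed

end

definition covert_code_exists :: "nat \<Rightarrow> (nat \<Rightarrow> 'y1::finite \<Rightarrow> 'y2::finite \<Rightarrow> 'z::finite \<Rightarrow> real) \<Rightarrow> nat \<Rightarrow> real \<Rightarrow>
    real \<Rightarrow> real \<Rightarrow> real \<Rightarrow> bool" where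
  "covert_code_exists K P n \<delta> r1 r2 e \<longleftrightarrow> (\<exists>M1 M2 Kn enc dec1 dec2.
     is_code K n M1 M2 Kn enc (dec1 :: 'y1 list \<Rightarrow> nat \<Rightarrow> nat) (dec2 :: 'y2 list \<Rightarrow> nat \<Rightarrow> nat) \<and>
     covertness P n M1 M2 Kn enc \<le> \<delta> \<and> r1 \<le> ln (real M1) \<and> r2 \<le> ln (real M2) \<and>
     code_error P n M1 M2 Kn enc dec1 dec2 \<le> e)"

lemma covert_code_exists_mono:
  "covert_code_exists K P n \<delta> r1 r2 e \<Longrightarrow> \<delta> \<le> \<delta>' \<Longrightarrow> r1' \<le> r1 \<Longrightarrow> r2' \<le> r2 \<Longrightarrow> e \<le> e' \<Longrightarrow>
    covert_code_exists K P n \<delta>' r1' r2' e'"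
  unfolding covert_code_exists_def by (blast intro: order_trans)

lemma Liminf_rate_ge:
  fixes M :: "nat \<Rightarrow> nat"
  assumes "0 < \<delta>" "\<forall>\<^sub>F n in sequentially. l * sqrt (real n * \<delta>) \<le> ln (real (M n))"
  shows "ereal l \<le> Liminf sequentially (\<lambda>n. ereal (ln (real (M n)) / sqrt (real n * \<delta>)))"
proof (rule Liminf_bounded)
  show "\<forall>\<^sub>F n in sequentially. ereal l \<le> ereal (ln (real (M n)) / sqrt (real n * \<delta>))"
    using assms(2) eventually_gt_at_top[of 0]
    by eventually_elim (use assms(1) in \<open>simp add: pos_le_divide_eq\<close>)
qed

context covert_bc
begin

lemma covert_code_exists_time_sharing:
  assumes code1: "keyed_code K (chanW P) (chanQ P) m1 M1 S1 enc1 dec1 R1 e1"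
    and code2: "keyed_code K (chanV P) (chanQ P) m2 M2 S2 enc2 dec2 R2 e2"
  shows "covert_code_exists K P (m1 + m2) (m1 * relent R1 (chanQ P 0) UNIV + m2 * relent R2 (chanQ P 0) UNIV)
    (ln M1) (ln M2) (e1 + e2)"
proof -
  have "finite (S1 \<times> S2)" using code1 code2 by (simp add: keyed_code_def)
  then obtain h where bij_h: "bij_betw h {1..card (S1 \<times> S2)} (S1 \<times> S2)"
    by (rule exE[OF ex_bij_betw_nat_finite_1])
  interpret time_sharing K P m1 M1 S1 enc1 dec1 R1 e1 m2 M2 S2 enc2 dec2 R2 e2 h
    by unfold_locales (fact code1 code2 bij_h)+
  show ?thesis
    unfolding covert_code_exists_def
    by (intro exI conjI, rule is_code_shared) (simp_all add: covertness_shared code_error_shared_le)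
qed

lemma covert_code_exists_trivial:
  assumes "0 < \<delta>" shows "covert_code_exists K P n \<delta> 0 0 0"
  using assms
  by (intro covert_code_exists_mono[OF covert_code_exists_time_sharing[OF keyed_code_single_message
        keyed_code_single_message, of n 0, OF Q0_dist Q0_dist, simplified]])
    (simp_all add: relent_self)

lemma achievableI:
  assumes \<delta>_pos: "0 < \<delta>" and \<epsilon>_pos: "0 < \<epsilon>" and L_nonneg: "0 \<le> L1" "0 \<le> L2" and e_lim: "e \<longlonglongrightarrow> 0"
    and codes: "\<forall>\<^sub>F n in sequentially.
      covert_code_exists K P n \<delta> (L1 * sqrt (real n * \<delta>)) (L2 * sqrt (real n * \<delta>)) (e n)"
  shows "achievable K P \<epsilon> \<delta> (L1, L2)"
proof -
  let ?good = "\<lambda>n. covert_code_exists K P n \<delta> (L1 * sqrt (real n * \<delta>)) (L2 * sqrt (real n * \<delta>)) (e n)"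
  have "\<forall>n. covert_code_exists K P n \<delta> (if ?good n then L1 * sqrt (real n * \<delta>) else 0)
      (if ?good n then L2 * sqrt (real n * \<delta>) else 0) (if ?good n then e n else 0)"
    using covert_code_exists_trivial[OF \<delta>_pos] by simp
  then obtain M1 M2 Kn enc dec1 dec2 where
    code: "\<forall>n. is_code K n (M1 n) (M2 n) (Kn n) (enc n) (dec1 n) (dec2 n)
        \<and> covertness P n (M1 n) (M2 n) (Kn n) (enc n) \<le> \<delta>
      \<and> (if ?good n then L1 * sqrt (real n * \<delta>) else 0) \<le> ln (real (M1 n))
      \<and> (if ?good n then L2 * sqrt (real n * \<delta>) else 0) \<le> ln (real (M2 n))
      \<and> code_error P n (M1 n) (M2 n) (Kn n) (enc n) (dec1 n) (dec2 n) \<le> (if ?good n then e n else 0)"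
    unfolding covert_code_exists_def choice_iff by blast
  have "\<forall>\<^sub>F n in sequentially. e n < \<epsilon>" using e_lim \<epsilon>_pos by (rule order_tendstoD(2))
  then have "\<forall>\<^sub>F n in sequentially. ereal (code_error P n (M1 n) (M2 n) (Kn n) (enc n) (dec1 n) (dec2 n))
      \<le> ereal \<epsilon>"
    using codes
  proof eventually_elim
    case (elim n)
    then show ?case using code[rule_format, of n] by simp
  qed
  then have "Limsup sequentially (\<lambda>n. ereal (code_error P n (M1 n) (M2 n) (Kn n) (enc n) (dec1 n) (dec2 n)))
      \<le> ereal \<epsilon>"
    by (rule Limsup_bounded)
  moreover have "ereal L1 \<le> Liminf sequentially (\<lambda>n. ereal (ln (real (M1 n)) / sqrt (real n * \<delta>)))"
    using codes by (intro Liminf_rate_ge \<delta>_pos, eventually_elim)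
      (use code in \<open>simp split: if_splits\<close>)
  moreover have "ereal L2 \<le> Liminf sequentially (\<lambda>n. ereal (ln (real (M2 n)) / sqrt (real n * \<delta>)))"
    using codes by (intro Liminf_rate_ge \<delta>_pos, eventually_elim)
      (use code in \<open>simp split: if_splits\<close>)
  ultimately show ?thesis
    unfolding achievable_def using L_nonneg code by fastforce
qed

end

section \<open>Achievability\<close>

lemma block_fractions:
  assumes \<theta>_bounds: "0 \<le> \<theta>" "\<theta> \<le> 1"
  obtains m where "\<And>n. m n \<le> n" "(\<lambda>n. real (m n) / real n) \<longlonglongrightarrow> \<theta>" "(\<lambda>n. real (n - m n) / real n) \<longlonglongrightarrow> 1 - \<theta>"
proof
  let ?m = "\<lambda>n. nat \<lfloor>\<theta> * real n\<rfloor>"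
  show m_le: "?m n \<le> n" for n
  proof -
    have "\<theta> * real n \<le> real n" using \<theta>_bounds by (intro mult_left_le_one_le) auto
    then show ?thesis by linarith
  qed
  show m_lim: "(\<lambda>n. real (?m n) / real n) \<longlonglongrightarrow> \<theta>"
    by (rule nat_floor_mult_tendsto[OF \<theta>_bounds(1)])
  show "(\<lambda>n. real (n - ?m n) / real n) \<longlonglongrightarrow> 1 - \<theta>"
  proof (rule Lim_transform_eventually)
    show "(\<lambda>n. 1 - real (?m n) / real n) \<longlonglongrightarrow> 1 - \<theta>" by (intro tendsto_diff tendsto_const m_lim)
    show "\<forall>\<^sub>F n in sequentially. 1 - real (?m n) / real n = real (n - ?m n) / real n"
      using eventually_gt_at_top[of 0]
      by eventually_elim (simp add: of_nat_diff[OF m_le] diff_divide_distrib)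
  qed
qed

context covert_bc
begin

lemma achievable_time_sharing:
  assumes \<delta>_pos: "0 < \<delta>" and \<epsilon>_pos: "0 < \<epsilon>" and \<theta>_bounds: "0 \<le> \<theta>" "\<theta> \<le> 1"
    and L1_bound: "L1 = 0 \<or> 0 < L1 \<and> L1 < \<theta> * user1.cap"
    and L2_bound: "L2 = 0 \<or> 0 < L2 \<and> L2 < (1 - \<theta>) * user2.cap"
  shows "achievable K P \<epsilon> \<delta> (L1, L2)"
proof -
  obtain m1 where m1_le: "\<And>n. m1 n \<le> n" and m1_lim: "(\<lambda>n. real (m1 n) / real n) \<longlonglongrightarrow> \<theta>"
    and m2_lim: "(\<lambda>n. real (n - m1 n) / real n) \<longlonglongrightarrow> 1 - \<theta>"
    by (rule block_fractions[OF \<theta>_bounds]) (rule that)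
  obtain M1 and S1 :: "nat \<Rightarrow> (nat \<Rightarrow> (nat \<times> nat) list) set" and enc1 dec1 R1 e1 where
    code1: "\<And>n. keyed_code K (chanW P) (chanQ P) (m1 n) (M1 n) (S1 n) (enc1 n) (dec1 n) (R1 n) (e1 n)"
    and e1_lim: "e1 \<longlonglongrightarrow> 0" and rate1: "\<And>n. L1 * sqrt (real n * \<delta>) \<le> ln (real (M1 n))"
    and cov1: "\<forall>\<^sub>F n in sequentially. real (m1 n) * relent (R1 n) (chanQ P 0) UNIV \<le> \<theta> * \<delta>"
    by (rule user1.keyed_codes_exist[OF \<delta>_pos \<theta>_bounds(1) L1_bound m1_lim]) (rule that)
  obtain M2 and S2 :: "nat \<Rightarrow> (nat \<Rightarrow> (nat \<times> nat) list) set" and enc2 dec2 R2 e2 where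
    code2: "\<And>n. keyed_code K (chanV P) (chanQ P) (n - m1 n) (M2 n) (S2 n) (enc2 n) (dec2 n) (R2 n) (e2 n)"
    and e2_lim: "e2 \<longlonglongrightarrow> 0" and rate2: "\<And>n. L2 * sqrt (real n * \<delta>) \<le> ln (real (M2 n))"
    and cov2: "\<forall>\<^sub>F n in sequentially. real (n - m1 n) * relent (R2 n) (chanQ P 0) UNIV \<le> (1 - \<theta>) * \<delta>"
    by (rule user2.keyed_codes_exist[OF \<delta>_pos _ L2_bound m2_lim]) (use \<theta>_bounds(2) in simp, rule that)
  show ?thesis
  proof (rule achievableI[OF \<delta>_pos \<epsilon>_pos _ _ tendsto_add_zero[OF e1_lim e2_lim]])
    show "\<forall>\<^sub>F n in sequentially.
        covert_code_exists K P n \<delta> (L1 * sqrt (real n * \<delta>)) (L2 * sqrt (real n * \<delta>)) (e1 n + e2 n)"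
      using cov1 cov2
    proof eventually_elim
      case (elim n)
      have "real (m1 n) * relent (R1 n) (chanQ P 0) UNIV + real (n - m1 n) * relent (R2 n) (chanQ P 0) UNIV
          \<le> \<theta> * \<delta> + (1 - \<theta>) * \<delta>"
        using elim by (rule add_mono)
      also have "\<dots> = \<delta>" by (simp add: algebra_simps)
      finally show ?case
        using covert_code_exists_time_sharing[OF code1[of n] code2[of n]] rate1[of n] rate2[of n] m1_le[of n]
        by (auto elim: covert_code_exists_mono)
    qed
  qed (use L1_bound L2_bound in auto)
qed

lemma covert_region_achievability:
  assumes \<delta>_pos: "0 < \<delta>" and L_bounds: "0 \<le> fst L" "fst L \<le> user1.cap" "0 \<le> snd L" "snd L \<le> user2.cap"
    and time_sharing: "fst L * user2.cap + snd L * user1.cap \<le> user1.cap * user2.cap"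
  shows "L \<in> covert_region K P \<delta>"
proof -
  define \<theta> where "\<theta> = (if user1.cap = 0 then 0 else fst L / user1.cap)"
  have \<theta>_bounds: "0 \<le> \<theta>" "\<theta> \<le> 1" using L_bounds user1.covert_cap_nonneg by (simp_all add: \<theta>_def)
  have fst_L_le: "fst L \<le> \<theta> * user1.cap" using L_bounds by (simp add: \<theta>_def)
  have snd_L_le: "snd L \<le> (1 - \<theta>) * user2.cap"
    using L_bounds user1.covert_cap_nonneg time_sharing by (simp add: \<theta>_def field_simps)
  have achievable_scaled: "achievable K P \<epsilon> \<delta> (r * fst L, r * snd L)" if "0 < \<epsilon>" "0 < r" "r < 1" for \<epsilon> r
  proof (rule achievable_time_sharing[OF \<delta>_pos \<open>0 < \<epsilon>\<close> \<theta>_bounds])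
    have shrink: "r * x = 0 \<or> 0 < r * x \<and> r * x < y" if "0 \<le> x" "x \<le> y" for x y :: real
    proof (cases "x = 0")
      case False
      then have "0 < x" using that by simp
      then have "0 < r * x" "r * x < 1 * x" using \<open>0 < r\<close> \<open>r < 1\<close> by simp_all
      then show ?thesis using that by linarith
    qed simp
    show "r * fst L = 0 \<or> 0 < r * fst L \<and> r * fst L < \<theta> * user1.cap"
      by (rule shrink[OF L_bounds(1) fst_L_le])
    show "r * snd L = 0 \<or> 0 < r * snd L \<and> r * snd L < (1 - \<theta>) * user2.cap"
      by (rule shrink[OF L_bounds(3) snd_L_le])
  qed
  have "L \<in> closure {L. achievable K P \<epsilon> \<delta> L}" if \<epsilon>_pos: "0 < \<epsilon>" for \<epsilon>
  proof (rule Lim_in_closed_set[OF closed_closure _ trivial_limit_at_left_real])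
    have "((\<lambda>r. (r * fst L, r * snd L)) \<longlongrightarrow> (1 * fst L, 1 * snd L)) (at_left 1)"
      by (intro tendsto_intros)
    then show "((\<lambda>r. (r * fst L, r * snd L)) \<longlongrightarrow> L) (at_left 1)" by simp
    have "\<forall>\<^sub>F r in at_left 1. (r * fst L, r * snd L) \<in> {L. achievable K P \<epsilon> \<delta> L}"
      unfolding eventually_at_left_field using achievable_scaled[OF \<epsilon>_pos] by (intro exI[of _ 0]) auto
    then show "\<forall>\<^sub>F r in at_left 1. (r * fst L, r * snd L) \<in> closure {L. achievable K P \<epsilon> \<delta> L}"
      by eventually_elim (rule subsetD[OF closure_subset])
  qed
  then show ?thesis by (auto simp: covert_region_def region_eps_def)
qed

end

theorem theorem2:
  fixes K :: nat
    and P :: "nat \<Rightarrow> 'y1::finite \<Rightarrow> 'y2::finite \<Rightarrow> 'z::finite \<Rightarrow> real"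
    and \<delta> :: real
  assumes K_pos: "1 \<le> K"
    and chan: "bc_channel K P"
    and supp_Q0: "\<forall>z. chanQ P 0 z > 0"
    and not_redundant: "\<not> (\<exists>p\<in>prob_vecs K. \<forall>z. chanQ P 0 z = (\<Sum>k=1..K. p k * chanQ P k z))"
    and acW: "\<forall>k\<in>{1..K}. abs_cont (chanW P k) (chanW P 0)"
    and acV: "\<forall>k\<in>{1..K}. abs_cont (chanV P k) (chanV P 0)"
    and cond1: "covert_cap K (chanV P) (chanQ P) \<le> covert_cap K (chanW P) (chanQ P) \<longrightarrow>
       (\<forall>p\<in>input_dists K. mutual_info K p (chanW P) * covert_cap K (chanV P) (chanQ P)
                          \<le> covert_cap K (chanW P) (chanQ P) * mutual_info K p (chanV P))"
    and cond2: "covert_cap K (chanW P) (chanQ P) < covert_cap K (chanV P) (chanQ P) \<longrightarrow>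
       (\<forall>p\<in>input_dists K. mutual_info K p (chanV P) * covert_cap K (chanW P) (chanQ P)
                          \<le> covert_cap K (chanV P) (chanQ P) * mutual_info K p (chanW P))"
    and delta_pos: "\<delta> > 0"
  shows "covert_region K P \<delta> =
    {L. fst L \<ge> 0 \<and> snd L \<ge> 0 \<and>
        ratio_term (fst L) (covert_cap K (chanW P) (chanQ P))
          + ratio_term (snd L) (covert_cap K (chanV P) (chanQ P)) \<le> 1}"
proof -
  interpret covert_bc K P
    by (intro covert_bc.intro warden.intro covert_bc_axioms.intro K_pos not_redundant chan
        supp_Q0[rule_format] stochastic_chanQ dominatedI stochastic_chanW stochastic_chanV acW acV)
  have "L \<in> covert_region K P \<delta> \<longleftrightarrow> 0 \<le> fst L \<and> 0 \<le> snd L \<and>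
      ratio_term (fst L) user1.cap + ratio_term (snd L) user2.cap \<le> 1" for L
    using covert_region_time_sharing_bound[OF _ delta_pos cond1[rule_format] cond2[rule_format], of L]
      covert_region_achievability[OF delta_pos, of L] covert_region_nonneg[of L K P \<delta>]
      covert_region_fst_le[OF _ delta_pos, of L] covert_region_snd_le[OF _ delta_pos, of L]
      ratio_term_add_le_1_iff[OF _ _ user1.covert_cap_nonneg user2.covert_cap_nonneg, of "fst L" "snd L"]
    by blast
  then show ?thesis by blast
qed

end
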